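(* Let $F$ be a gauge on $\mathbb{S}^n$, let $\mathbf{W}\subset\mathbb{R}^{n+1}$ be the classical wedge determined by linearly independent unit vectors $\mathbf{n}_1,\mathbf{n}_2$, and let $\Sigma\subset\overline{\mathbf{W}}$ be a compact immersed hypersurface in the wedge with unit normal vector field $\nu$ and anisotropic normal vector field $\nu^F=\Phi(\nu)$. For $i=1,2$, assume that $$\langle \nu^{F},\mathbf{n}_i\rangle=\omega_0^i\quad\text{on }\partial_i\Sigma,$$ where $\omega_0^1,\omega_0^2\in\mathbb{R}$ are constants. Suppose $\mathbf{k}^F\in\mathbb{R}^{n+1}$ is a constant vector with $\langle \mathbf{k}^F,\mathbf{n}_i\rangle=\omega_0^i$ for $i=1,2$. Then for every $r\in\{1,\dots,n\}$, $$\int_\Sigma H^F_{r-1}\,\bigl(F(\nu)-\langle \mathbf{k}^F,\nu\rangle\bigr)\,\mathrm{d}A=\int_\Sigma H_r^F\,\langle x,\nu\rangle\,\mathrm{d}A,$$ where $x$ denotes the position vector. In particular, $$\int_\Sigma \bigl(F(\nu)-\langle \mathbf{k}^F,\nu\rangle\bigr)\,\mathrm{d}A=\int_\Sigma H_1^F\,\langle x,\nu\rangle\,\mathrm{d}A.$$ When $\omega_0^1=\omega_0^2=0$ (i.e. $\Sigma$ has anisotropic free boundary), one can take $\mathbf{k}^F=0$.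
   Context: Let $n\ge 2$. Gauge: a nonnegative $C^2$ function $F:\mathbb{S}^n\to\mathbb{R}$ such that $\nabla^2F+F\sigma$ is positive definite everywhere, where $\sigma$ is the round metric on $\mathbb{S}^n$ and $\nabla,\nabla^2$ are its gradient and Hessian. The Cahn-Hoffman map is $\Phi:\mathbb{S}^n\to\mathbb{R}^{n+1}$, $\Phi(\xi)=\nabla F(\xi)+F(\xi)\xi$. Wedge: for linearly independent unit vectors $\mathbf{n}_1,\mathbf{n}_2\in\mathbb{R}^{n+1}$, $\mathbf{W}=\{x\in\mathbb{R}^{n+1}\mid\langle x,\mathbf{n}_i\rangle<0,\ i=1,2\}$. Its boundary is the disjoint union of two open half-hyperplanes $P_1,P_2$ ($P_i$ has outward unit normal $\mathbf{n}_i$) and the codimension-2 linear subspace $L=\{x\mid\langle x,\mathbf{n}_1\rangle=\langle x,\mathbf{n}_2\rangle=0\}$. Immersed hypersurface in the wedge: a compact smooth $n$-dimensional manifold $\Sigma$ with corners of codimension at most 2 (locally diffeomorphic to open subsets of $\mathbb{R}_{\ge0}^2\times\mathbb{R}^{n-2}$), smoothly immersed in $\overline{\mathbf{W}}$ and carrying a smooth unit normal field $\nu$, with stratification $\Sigma=\Sigma_0\sqcup\Sigma_1\sqcup\Sigma_2$, where $\Sigma_j$ has dimension $n-j$, $\Sigma_0$ is the interior and $\partial\Sigma=\Sigma_1\sqcup\Sigma_2$. The interior $\Sigma_0$ is mapped into $\mathbf{W}$, $\Sigma_1$ into $P_1\cup P_2$ and $\Sigma_2$ into $L$. $\partial_i\Sigma$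 denotes the part of $\partial\Sigma$ mapped into $\overline{P_i}$. Anisotropic curvatures: $\nu^F=\Phi(\nu)$; the anisotropic shape operator is $\mathrm{d}\nu^F=\mathrm{d}\Phi|_\nu\circ\mathrm{d}\nu:T\Sigma\to T\Sigma$, whose (real) eigenvalues $\kappa_1^F,\dots,\kappa_n^F$ are the anisotropic principal curvatures; for $r=0,\dots,n$, $H_r^F=\binom{n}{r}^{-1}\sigma_r(\kappa_1^F,\dots,\kappa_n^F)$, where $\sigma_r$ is the $r$-th elementary symmetric polynomial ($H_0^F=1$). *)

theory Defs
  imports "HOL-Analysis.Analysis" "HOL-Library.Multiset"
begin

section \<open>Differentiability classes\<close>

text \<open>\<open>Ck_on k U f\<close>: \<open>f\<close> is of class \<open>C\<^sup>k\<close> on \<open>U\<close>; meant for open \<open>U\<close> only.\<close>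

fun Ck_on :: "nat \<Rightarrow> 'a::euclidean_space set \<Rightarrow> ('a \<Rightarrow> 'b::euclidean_space) \<Rightarrow> bool" where
  "Ck_on 0 U f \<longleftrightarrow> continuous_on U f"
| "Ck_on (Suc k) U f \<longleftrightarrow>
     (\<forall>x\<in>U. f differentiable (at x)) \<and> (\<forall>v. Ck_on k U (\<lambda>x. frechet_derivative f (at x) v))"

text \<open>Smoothness on an arbitrary set (here: relatively open subsets of a corner) means that
  the function extends, locally around each point, to a smooth function on an open set.\<close>

definition smooth_on :: "'a::euclidean_space set \<Rightarrow> ('a \<Rightarrow> 'b::euclidean_space) \<Rightarrow> bool" where
  "smooth_on S f \<longleftrightarrow>
     (\<forall>x\<in>S. \<exists>V g. open V \<and> x \<in> V \<and> (\<forall>k. Ck_on k V g) \<and> (\<forall>y\<in>V \<inter> S. g y = f y))"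


section \<open>Calculus on the unit sphere and gauges\<close>

text \<open>A function on the unit sphere is represented by a function on the ambient space of which
  only the values on the sphere matter. Regularity and differentials are those of the
  extension that is constant along rays.\<close>

definition radial_ext :: "('a::euclidean_space \<Rightarrow> 'b::euclidean_space) \<Rightarrow> 'a \<Rightarrow> 'b" where
  "radial_ext f x = f (x /\<^sub>R norm x)"

definition sphere_diff :: "('a::euclidean_space \<Rightarrow> 'b::euclidean_space) \<Rightarrow> 'a \<Rightarrow> 'a \<Rightarrow> 'b" where
  "sphere_diff f \<xi> u = frechet_derivative (radial_ext f) (at \<xi>) u"

text \<open>The sum below is tangent to the sphere at \<open>\<xi>\<close>, since \<open>sphere_diff F \<xi> \<xi> = 0\<close>.\<close>

definition sphere_grad :: "('a::euclidean_space \<Rightarrow> real) \<Rightarrow> 'a \<Rightarrow> 'a" where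
  "sphere_grad F \<xi> = (\<Sum>b\<in>Basis. sphere_diff F \<xi> b *\<^sub>R b)"

text \<open>The Levi-Civita connection of the round metric is the tangential part of the ambient
  derivative; for tangent \<open>v\<close> the projection may be omitted in the inner product with \<open>v\<close>.
  Hence this is the Hessian for \<open>u\<close>, \<open>v\<close> orthogonal to \<open>\<xi>\<close>.\<close>

definition sphere_hess :: "('a::euclidean_space \<Rightarrow> real) \<Rightarrow> 'a \<Rightarrow> 'a \<Rightarrow> 'a \<Rightarrow> real" where
  "sphere_hess F \<xi> u v = sphere_diff (sphere_grad F) \<xi> u \<bullet> v"

definition anisotropic_gauge :: "('a::euclidean_space \<Rightarrow> real) \<Rightarrow> bool" where
  "anisotropic_gauge F \<longleftrightarrow>
     Ck_on 2 (- {0}) (radial_ext F) \<and>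
     (\<forall>\<xi>\<in>sphere 0 1. 0 \<le> F \<xi>) \<and>
     (\<forall>\<xi>\<in>sphere 0 1. \<forall>u. u \<bullet> \<xi> = 0 \<and> u \<noteq> 0 \<longrightarrow> sphere_hess F \<xi> u u + F \<xi> * (u \<bullet> u) > 0)"

definition Cahn_Hoffman :: "('a::euclidean_space \<Rightarrow> real) \<Rightarrow> 'a \<Rightarrow> 'a" where
  "Cahn_Hoffman F \<xi> = sphere_grad F \<xi> + F \<xi> *\<^sub>R \<xi>"


section \<open>Wedges\<close>

definition wedge :: "'a::euclidean_space \<Rightarrow> 'a \<Rightarrow> 'a set" where
  "wedge n1 n2 = {x. x \<bullet> n1 < 0 \<and> x \<bullet> n2 < 0}"

text \<open>The open face of the wedge with outward normal the first argument:
  \<open>P\<^sub>1 = wedge_face n1 n2\<close> and \<open>P\<^sub>2 = wedge_face n2 n1\<close>.\<close>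

definition wedge_face :: "'a::euclidean_space \<Rightarrow> 'a \<Rightarrow> 'a set" where
  "wedge_face m m' = {x. x \<bullet> m = 0 \<and> x \<bullet> m' < 0}"

definition wedge_edge :: "'a::euclidean_space \<Rightarrow> 'a \<Rightarrow> 'a set" where
  "wedge_edge n1 n2 = {x. x \<bullet> n1 = 0 \<and> x \<bullet> n2 = 0}"


section \<open>Manifolds with corners\<close>

type_synonym ('p, 'n) chart = "'p set \<times> ('p \<Rightarrow> real ^ 'n)"

text \<open>With \<open>card K = 2\<close> the set \<open>corner K\<close> is the model
  \<open>[0,\<infinity>)\<^sup>2 \<times> \<real>\<^bsup>n-2\<^esup>\<close>; \<open>K\<close> names the two restricted coordinates.\<close>

definition corner :: "'n::finite set \<Rightarrow> (real ^ 'n) set" where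
  "corner K = {y. \<forall>k\<in>K. 0 \<le> y $ k}"

definition in_chart :: "('p, 'n::finite) chart \<Rightarrow> ('p \<Rightarrow> 'b) \<Rightarrow> real ^ 'n \<Rightarrow> 'b" where
  "in_chart c f y = f (inv_into (fst c) (snd c) y)"

definition corner_manifold ::
  "'p topology \<Rightarrow> ('p, 'n::finite) chart set \<Rightarrow> 'n set \<Rightarrow> bool" where
  "corner_manifold T A K \<longleftrightarrow>
     card K = 2 \<and> Hausdorff_space T \<and> second_countable T \<and>
     (\<Union>c\<in>A. fst c) = topspace T \<and>
     (\<forall>(U, \<phi>)\<in>A. openin T U \<and> openin (top_of_set (corner K)) (\<phi> ` U) \<and>
        homeomorphic_map (subtopology T U) (top_of_set (\<phi> ` U)) \<phi>) \<and>
     (\<forall>c\<in>A. \<forall>d\<in>A. smooth_on (snd c ` (fst c \<inter> fst d)) (in_chart c (snd d)))"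

text \<open>Points of codimension \<open>j\<close>: exactly \<open>j\<close> of the restricted coordinates vanish
  (for one, equivalently for every, chart around the point).\<close>

definition stratum :: "('p, 'n::finite) chart set \<Rightarrow> 'n set \<Rightarrow> nat \<Rightarrow> 'p set" where
  "stratum A K j = {p. \<exists>c\<in>A. p \<in> fst c \<and> card {k\<in>K. snd c p $ k = 0} = j}"

definition smooth_map :: "('p, 'n::finite) chart set \<Rightarrow> ('p \<Rightarrow> 'b::euclidean_space) \<Rightarrow> bool" where
  "smooth_map A f \<longleftrightarrow> (\<forall>c\<in>A. smooth_on (snd c ` fst c) (in_chart c f))"

text \<open>The differential at \<open>p\<close>, where the chart \<open>c\<close> identifies the tangent space at \<open>p\<close> with
  \<open>\<real>\<^sup>n\<close>. The derivative within the chart image is unique, also at boundary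
  and corner points.\<close>

definition chart_diff ::
  "('p, 'n::finite) chart \<Rightarrow> ('p \<Rightarrow> 'b::euclidean_space) \<Rightarrow> 'p \<Rightarrow> real ^ 'n \<Rightarrow> 'b" where
  "chart_diff c f p = frechet_derivative (in_chart c f) (at (snd c p) within snd c ` fst c)"

definition chart_at :: "('p, 'n::finite) chart set \<Rightarrow> 'p \<Rightarrow> ('p, 'n) chart" where
  "chart_at A p = (SOME c. c \<in> A \<and> p \<in> fst c)"


section \<open>Immersed hypersurfaces in a wedge\<close>

definition immersed_hypersurface ::
  "'p topology \<Rightarrow> ('p, 'n::finite) chart set \<Rightarrow> 'n set \<Rightarrow>
   ('p \<Rightarrow> 'a::euclidean_space) \<Rightarrow> ('p \<Rightarrow> 'a) \<Rightarrow> bool" where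
  "immersed_hypersurface T A K x \<nu> \<longleftrightarrow>
     DIM('a) = CARD('n) + 1 \<and>
     corner_manifold T A K \<and> compact_space T \<and>
     smooth_map A x \<and> (\<forall>c\<in>A. \<forall>p\<in>fst c. inj (chart_diff c x p)) \<and>
     smooth_map A \<nu> \<and> (\<forall>p\<in>topspace T. norm (\<nu> p) = 1) \<and>
     (\<forall>c\<in>A. \<forall>p\<in>fst c. \<forall>w. chart_diff c x p w \<bullet> \<nu> p = 0)"

definition immersed_hypersurface_in_wedge ::
  "'p topology \<Rightarrow> ('p, 'n::finite) chart set \<Rightarrow> 'n set \<Rightarrow>
   ('p \<Rightarrow> 'a::euclidean_space) \<Rightarrow> ('p \<Rightarrow> 'a) \<Rightarrow> 'a \<Rightarrow> 'a \<Rightarrow> bool" where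
  "immersed_hypersurface_in_wedge T A K x \<nu> n1 n2 \<longleftrightarrow>
     immersed_hypersurface T A K x \<nu> \<and>
     x ` topspace T \<subseteq> closure (wedge n1 n2) \<and>
     x ` stratum A K 0 \<subseteq> wedge n1 n2 \<and>
     x ` stratum A K 1 \<subseteq> wedge_face n1 n2 \<union> wedge_face n2 n1 \<and>
     x ` stratum A K 2 \<subseteq> wedge_edge n1 n2"

text \<open>\<open>\<partial>\<^sub>1\<Sigma>\<close> is obtained with \<open>m = n1\<close>, \<open>m' = n2\<close>, and \<open>\<partial>\<^sub>2\<Sigma>\<close> with the roles exchanged.\<close>

definition boundary_part ::
  "('p, 'n::finite) chart set \<Rightarrow> 'n set \<Rightarrow> ('p \<Rightarrow> 'a::euclidean_space) \<Rightarrow> 'a \<Rightarrow> 'a \<Rightarrow> 'p set" where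
  "boundary_part A K x m m' =
     {p \<in> stratum A K 1 \<union> stratum A K 2. x p \<in> closure (wedge_face m m')}"


section \<open>Area measure\<close>

definition area_density ::
  "('p, 'n::finite) chart \<Rightarrow> ('p \<Rightarrow> 'a::euclidean_space) \<Rightarrow> 'p \<Rightarrow> real" where
  "area_density c x p =
     sqrt (det ((\<chi> i j. chart_diff c x p (axis i 1) \<bullet> chart_diff c x p (axis j 1)) :: real ^ 'n ^ 'n))"

text \<open>The Riemannian measure of the metric induced by the immersion \<open>x\<close>: the unique Borel
  measure on the manifold that is given in every chart by the square root of the
  Gram determinant.\<close>

definition area_measure ::
  "'p topology \<Rightarrow> ('p, 'n::finite) chart set \<Rightarrow> ('p \<Rightarrow> 'a::euclidean_space) \<Rightarrow> 'p measure" where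
  "area_measure T A x =
     (THE M. space M = topspace T \<and> sets M = sigma_sets (topspace T) {U. openin T U} \<and>
        (\<forall>c\<in>A. \<forall>B\<in>sets M. B \<subseteq> fst c \<longrightarrow>
           emeasure M B = (\<integral>\<^sup>+y\<in>snd c ` B. ennreal (in_chart c (area_density c x) y) \<partial>lborel)))"


section \<open>Anisotropic curvatures\<close>

text \<open>\<open>d\<nu>\<^sup>F\<close> as an endomorphism of the tangent space: values of the differential of
  \<open>\<nu>\<^sup>F = \<Phi> \<circ> \<nu>\<close> lie in the image of the differential of \<open>x\<close>, through which they are pulled back.
  The tangent space is identified with \<open>\<real>\<^sup>n\<close> by a chart; another chart yields a
  conjugate endomorphism.\<close>

definition anisotropic_shape ::
  "('p, 'n::finite) chart set \<Rightarrow> ('a::euclidean_space \<Rightarrow> real) \<Rightarrow> ('p \<Rightarrow> 'a) \<Rightarrow> ('p \<Rightarrow> 'a) \<Rightarrow>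
   'p \<Rightarrow> real ^ 'n \<Rightarrow> real ^ 'n" where
  "anisotropic_shape A F x \<nu> p w =
     (let c = chart_at A p in
      THE u. chart_diff c x p u = chart_diff c (\<lambda>q. Cahn_Hoffman F (\<nu> q)) p w)"

text \<open>Real eigenvalues of a linear endomorphism, repeated according to algebraic multiplicity,
  i.e. the dimension of the generalized eigenspace.\<close>

definition eigenvalue_list :: "('a::euclidean_space \<Rightarrow> 'a) \<Rightarrow> real list" where
  "eigenvalue_list S = sorted_list_of_multiset
     (\<Sum>\<kappa>\<in>{\<kappa>. \<exists>v. v \<noteq> 0 \<and> S v = \<kappa> *\<^sub>R v}.
        replicate_mset (dim {v. ((\<lambda>w. S w - \<kappa> *\<^sub>R w) ^^ DIM('a)) v = 0}) \<kappa>)"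

definition elem_sym :: "nat \<Rightarrow> real list \<Rightarrow> real" where
  "elem_sym r \<kappa> = (\<Sum>I | I \<subseteq> {..<length \<kappa>} \<and> card I = r. \<Prod>i\<in>I. \<kappa> ! i)"

definition anisotropic_mean_curvature ::
  "('p, 'n::finite) chart set \<Rightarrow> ('a::euclidean_space \<Rightarrow> real) \<Rightarrow> ('p \<Rightarrow> 'a) \<Rightarrow> ('p \<Rightarrow> 'a) \<Rightarrow>
   nat \<Rightarrow> 'p \<Rightarrow> real" where
  "anisotropic_mean_curvature A F x \<nu> r p =
     elem_sym r (eigenvalue_list (anisotropic_shape A F x \<nu> p)) / real (CARD('n) choose r)"

end

theory Submission
  imports Defs
begin

text \<open>
  Put \<open>y = \<nu>\<^sup>F - k\<close> and consider the parallel hypersurfaces \<open>z = x + t y\<close>. Since \<open>dx \<circ> S = d\<nu>\<^sup>F\<close> for the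
  anisotropic shape operator \<open>S\<close>, and \<open>y \<bullet> \<nu> = F(\<nu>) - k \<bullet> \<nu>\<close>, in a chart the forms \<open>det(y, dz, ..., dz)\<close> and
  \<open>det(z, dy, dz, ..., dz)\<close> are the area form times polynomials in \<open>t\<close> whose coefficients are
  the elementary symmetric functions of \<open>S\<close> times \<open>y \<bullet> \<nu>\<close> and \<open>z \<bullet> \<nu>\<close>. As \<open>dz \<and> dz\<close> is closed,
  the sum over \<open>i\<close> of \<open>det(z, dz, ..., dy, ..., dz)\<close>, with \<open>dy\<close> in place \<open>i\<close>, minus \<open>n det(y, dz, ..., dz)\<close> is the
  divergence of the field with components \<open>det(z, dz, ..., y, ..., dz)\<close>. On the part of the boundary in the
  face normal to \<open>n\<^sub>i\<close> the vectors \<open>z\<close>, \<open>y\<close> and the tangential derivatives of \<open>z\<close> are all orthogonal to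
  \<open>n\<^sub>i\<close>, so that the flux of this field vanishes. The integral of the divergence over the hypersurface is
  therefore zero for every \<open>t\<close>, and comparing coefficients gives the formulas for all \<open>r\<close> at once.
  As \<open>F\<close> is only \<open>C\<^sup>2\<close>, \<open>y\<close> and \<open>z\<close> are only \<open>C\<^sup>1\<close>; the divergence identity, which involves second derivatives
  of \<open>z\<close>, is reached by mollification.
\<close>

section \<open>Determinants with a distinguished row\<close>

text \<open>As Phi is only C^1, the identity to be integrated is arranged to contain no second
  derivatives of y or z. They occur only inside the divergence, and there they fall on z alone;
  hence z is mollified, while y is kept and merely multiplied by cutoffs. Near the faces cutoffs
  vanish. Their gradients are unbounded, but they multiply the flux, which tends to zero there; at
  the edge the flux is controlled as a limit from the faces. The curvatures are defined through a
  list of real eigenvalues, so det(1 + t S) is their generating polynomial only once S is known to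
  be diagonalisable over the reals; S is symmetric for the product given by the inverse of dPhi on
  tangent vectors, in general not for the induced metric. Chart expressions are divided by the
  signed density det(\<nu>, dx, ..., dx), which makes them independent of the chart without
  orienting the atlas. The area measure is a definite description, so its existence and uniqueness
  precede every integral over the hypersurface.\<close>

lemma det_embed:
  fixes f :: "'n::finite \<Rightarrow> 'm::finite" and J :: "real^'n^'n"
  assumes "inj f"
  shows "det (\<chi> a b. if a \<in> range f then (if b \<in> range f then J $ inv f a $ inv f b else 0)
                     else of_bool (a = b) :: real^'m^'m) = det J"
    (is "det ?E = _")
proof -
  let ?R = "range f"
  \<comment> \<open>A permutation that moves an index outside \<open>range f\<close> meets an
    off-diagonal entry of the identity block, so only permutations of \<open>range f\<close>
    contribute to the Leibniz sum.\<close>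
  have zero: "(\<Prod>a\<in>UNIV. ?E $ a $ p a) = 0" if p: "p permutes UNIV" "\<not> p permutes ?R" for p
  proof -
    obtain a where "a \<notin> ?R" "p a \<noteq> a"
      using p permutes_superset[of p UNIV ?R] by auto
    then show ?thesis by (auto intro!: prod_zero)
  qed
  have "det ?E = (\<Sum>p | p permutes UNIV. of_int (sign p) * (\<Prod>a\<in>UNIV. ?E $ a $ p a))"
    by (simp only: det_def)
  also have "\<dots> = (\<Sum>p | p permutes ?R. of_int (sign p) * (\<Prod>a\<in>UNIV. ?E $ a $ p a))"
  proof (rule sum.mono_neutral_right)
    show "{p. p permutes ?R} \<subseteq> {p. p permutes UNIV}"
      by (auto intro: permutes_subset)
    show "\<forall>p\<in>{p. p permutes UNIV} - {p. p permutes ?R}.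
        of_int (sign p) * (\<Prod>a\<in>UNIV. ?E $ a $ p a) = 0"
      using zero by auto
  qed (simp add: finite_permutations)
  also have "\<dots> = (\<Sum>p | p permutes UNIV. of_int (sign p) * (\<Prod>i\<in>UNIV. J $ i $ p i))"
  \<comment> \<open>Conjugation by \<open>f\<close> identifies the permutations of the image with
    those of the small index type and preserves the sign.\<close>
  proof (rule sum.reindex_bij_witness
      [where i = "map_permutation UNIV f" and j = "map_permutation ?R (inv f)"])
    have bf: "bij_betw f UNIV ?R" using assms by (simp add: bij_betw_def)
    have bi: "bij_betw (inv f) ?R UNIV" using assms bf by (simp add: bij_betw_inv_into)
    fix p assume p: "p \<in> {p. p permutes ?R}"
    show 1: "map_permutation UNIV f (map_permutation ?R (inv f) p) = p"
      by (rule map_permutation_compose_inv[OF bi]) (use p in \<open>auto simp: f_inv_into_f\<close>)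
    show 2: "map_permutation ?R (inv f) p \<in> {p. p permutes UNIV}"
      using map_permutation_permutes[OF bi] p by auto
    have s: "sign (map_permutation ?R (inv f) p) = sign p"
      using p bi by (intro sign_map_permutation) (auto simp: bij_betw_def)
    define q where "q = map_permutation ?R (inv f) p"
    have pq: "p (f i) = f (q i)" for i
      using map_permutation_apply[of f UNIV i q] assms 1 by (simp add: q_def)
    have "(\<Prod>a\<in>UNIV. ?E $ a $ p a) = (\<Prod>a\<in>?R. ?E $ a $ p a)"
    proof (rule prod.mono_neutral_right)
      show "\<forall>a\<in>UNIV - ?R. ?E $ a $ p a = 1"
        using p by (auto simp: permutes_not_in)
    qed auto
    also have "\<dots> = (\<Prod>i\<in>UNIV. ?E $ f i $ p (f i))"
      by (simp add: prod.reindex[OF assms])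
    also have "\<dots> = (\<Prod>i\<in>UNIV. J $ i $ q i)"
      using assms by (simp add: pq)
    finally show "of_int (sign (map_permutation ?R (inv f) p)) *
        (\<Prod>i\<in>UNIV. J $ i $ map_permutation ?R (inv f) p i) = of_int (sign p) * (\<Prod>a\<in>UNIV. ?E $ a $ p a)"
      using s by (simp add: q_def)
  next
    have bf: "bij_betw f UNIV ?R" using assms by (simp add: bij_betw_def)
    fix p :: "'n \<Rightarrow> 'n" assume p: "p \<in> {p. p permutes UNIV}"
    show "map_permutation ?R (inv f) (map_permutation UNIV f p) = p"
      by (rule map_permutation_compose_inv[OF bf]) (use p assms in auto)
    show "map_permutation UNIV f p \<in> {p. p permutes ?R}"
      using map_permutation_permutes[OF bf] p by auto
  qed
  finally show ?thesis by (simp only: det_def)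
qed

text \<open>The bijection \<open>e\<close> distinguishes one row index \<open>e None\<close> and matches the remaining ones with
  the coordinates of a chart.\<close>

definition vol :: "('n::finite option \<Rightarrow> 'm::finite) \<Rightarrow> real^'m \<Rightarrow> ('n \<Rightarrow> real^'m) \<Rightarrow> real" where
  "vol e v u = det (\<chi> a. case inv e a of None \<Rightarrow> v | Some i \<Rightarrow> u i)"

text \<open>By multilinearity this is the derivative of \<open>vol e v\<close> at \<open>u\<close>
  in the direction \<open>w\<close>. With \<open>u\<close> = dz and \<open>w\<close> = dy it is the
  sum over the places of dy in the divergence identity.\<close>

definition dvol ::
  "('n::finite option \<Rightarrow> 'm::finite) \<Rightarrow> real^'m \<Rightarrow> ('n \<Rightarrow> real^'m) \<Rightarrow> ('n \<Rightarrow> real^'m) \<Rightarrow> real" where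
  "dvol e v u w = (\<Sum>i\<in>UNIV. vol e v (u(i := w i)))"

text \<open>Product rule in each Leibniz term, regrouped by the row that is differentiated. Keeping
  the result as determinants with one replaced row is the shape that \<open>dvol\<close>
  needs.\<close>

lemma has_derivative_det:
  fixes r :: "'a::real_normed_vector \<Rightarrow> 'm::finite \<Rightarrow> real^'m"
  assumes "\<And>a. ((\<lambda>y. r y a) has_derivative r' a) (at x within S)"
  shows "((\<lambda>y. det (\<chi> a. r y a)) has_derivative
     (\<lambda>h. \<Sum>b\<in>UNIV. det (\<chi> a. if a = b then r' b h else r x a))) (at x within S)"
proof -
  have d: "((\<lambda>y. det (\<chi> a. r y a)) has_derivative (\<lambda>h. \<Sum>p | p permutes (UNIV::'m set).
     of_int (sign p) * (\<Sum>b\<in>UNIV. r' b h $ p b * (\<Prod>a\<in>UNIV - {b}. r x a $ p a)))) (at x within S)"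
    unfolding det_def vec_lambda_beta
  proof (intro has_derivative_sum has_derivative_mult_right has_derivative_prod)
    fix p :: "'m \<Rightarrow> 'm" and a
    show "((\<lambda>y. r y a $ p a) has_derivative (\<lambda>h. r' a h $ p a)) (at x within S)"
      by (rule bounded_linear.has_derivative[OF bounded_linear_vec_nth assms])
  qed
  have "(\<Sum>p | p permutes (UNIV::'m set). of_int (sign p) *
           (\<Sum>b\<in>UNIV. r' b h $ p b * (\<Prod>a\<in>UNIV - {b}. r x a $ p a)))
      = (\<Sum>b\<in>UNIV. det (\<chi> a. if a = b then r' b h else r x a))" for h
  proof -
    have "(\<Prod>a\<in>UNIV. (if a = b then r' b h else r x a) $ p a)
        = r' b h $ p b * (\<Prod>a\<in>UNIV - {b}. r x a $ p a)" for b and p :: "'m \<Rightarrow> 'm"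
      by (subst prod.remove[of _ b]) auto
    then show ?thesis
      unfolding det_def vec_lambda_beta sum_distrib_left
      by (subst sum.swap) simp
  qed
  then show ?thesis using d by simp
qed

text \<open>Each Leibniz term is at most \<open>B\<close> to the power of the dimension. This crude
  constant suffices to dominate the integrands when mollified maps converge.\<close>

lemma det_abs_bound:
  fixes M :: "real^'m^'m"
  assumes "\<And>i j. \<bar>M $ i $ j\<bar> \<le> B"
  shows "\<bar>det M\<bar> \<le> real (card {p. p permutes (UNIV::'m set)}) * B ^ CARD('m)"
proof -
  have "\<bar>det M\<bar> \<le> (\<Sum>p | p permutes (UNIV::'m set). \<bar>of_int (sign p) * (\<Prod>i\<in>UNIV. M $ i $ p i)\<bar>)"
    unfolding det_def by (rule sum_abs)
  also have "\<dots> \<le> (\<Sum>p | p permutes (UNIV::'m set). B ^ CARD('m))"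
  proof (rule sum_mono)
    fix p :: "'m \<Rightarrow> 'm"
    have "(\<Prod>i\<in>UNIV. \<bar>M $ i $ p i\<bar>) \<le> (\<Prod>i\<in>(UNIV::'m set). B)"
      by (rule prod_mono) (use assms in auto)
    then show "\<bar>of_int (sign p) * (\<Prod>i\<in>UNIV. M $ i $ p i)\<bar> \<le> B ^ CARD('m)"
      by (simp add: abs_mult abs_prod flip: of_int_abs)
  qed
  finally show ?thesis by simp
qed

text \<open>The vector \<open>c\<close> lies in the kernel of the matrix of rows. With
  \<open>c\<close> a wall normal this makes the flux vanish; with \<open>c\<close> the unit normal
  it shows that \<open>vol\<close> sees only the normal component of its first argument.\<close>

lemma vol_rows_normal:
  assumes "c \<noteq> 0" "v \<bullet> c = 0" "\<And>i. u i \<bullet> c = 0"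
  shows "vol e v u = 0"
proof -
  let ?A = "(\<chi> a. case inv e a of None \<Rightarrow> v | Some i \<Rightarrow> u i) :: real^_^_"
  have "?A *v c = 0"
    using assms by (auto simp: vec_eq_iff matrix_vector_mult_def inner_vec_def split: option.split)
  then have "\<not> inj ((*v) ?A)"
    using assms(1) by (metis injD matrix_vector_mult_0_right)
  then have "\<not> invertible ?A"
    by (metis invertible_eq_bij bij_is_inj)
  then show ?thesis
    by (simp add: vol_def invertible_det_nz)
qed

lemma invertible_det_rows: "det (A :: real^'n^'n) = 0 \<Longrightarrow> \<exists>c. c \<noteq> 0 \<and> A *v c = 0"
  by (metis invertible_det_nz matrix_left_invertible_ker invertible_left_inverse)

section \<open>Multilinearity of \<open>vol\<close> and its behaviour under linear
  substitutions\<close>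

context
  fixes e :: "'n::finite option \<Rightarrow> 'm::finite"
  assumes e: "bij e"
begin

lemma inv_e: "inv e (e p) = p"
  using e by (simp add: bij_is_inj)

lemma ex_e: "\<exists>p. a = e p"
  using e by (metis bij_inv_eq_iff)

lemma e_eq_iff: "e p = e q \<longleftrightarrow> p = q"
  using e by (auto simp: bij_def inj_eq)

lemma sum_rows: "(\<Sum>b\<in>UNIV. g b) = g (e None) + (\<Sum>j\<in>UNIV. g (e (Some j)))" for g :: "'m \<Rightarrow> real"
proof -
  have "(\<Sum>b\<in>UNIV. g b) = (\<Sum>p\<in>UNIV. g (e p))"
    using sum.reindex_bij_betw[OF e, of g] by simp
  also have "\<dots> = g (e None) + (\<Sum>j\<in>UNIV. g (e (Some j)))"
    by (simp add: UNIV_option_conv sum.reindex)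
  finally show ?thesis .
qed

lemma rows_upd_None:
  "(\<chi> a. case inv e a of None \<Rightarrow> v | Some i \<Rightarrow> u i) =
   (\<chi> a. if a = e None then v else case inv e a of None \<Rightarrow> v' | Some i \<Rightarrow> u i)"
proof -
  have "(case inv e a of None \<Rightarrow> v | Some i \<Rightarrow> u i) = (if a = e None then v else case inv e a of None \<Rightarrow> v' | Some i \<Rightarrow> u i)" for a
    using ex_e[of a] by (auto simp: inv_e split: option.split)
  then show ?thesis by simp
qed

lemma rows_upd_Some:
  "(\<chi> a. case inv e a of None \<Rightarrow> v | Some i \<Rightarrow> (u(k := w)) i) =
   (\<chi> a. if a = e (Some k) then w else case inv e a of None \<Rightarrow> v | Some i \<Rightarrow> u i)"
proof -
  have "(case inv e a of None \<Rightarrow> v | Some i \<Rightarrow> (u(k := w)) i) = (if a = e (Some k) then w else case inv e a of None \<Rightarrow> v | Some i \<Rightarrow> u i)" for a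
    using ex_e[of a] by (auto simp: inv_e e_eq_iff split: option.split)
  then show ?thesis by simp
qed

lemma linear_det_row: "linear (\<lambda>v. det (\<chi> a. if a = b then v else (c a :: real^'m)))"
proof (rule linearI)
  fix x y :: "real^'m" and r :: real
  show "det (\<chi> a. if a = b then x + y else c a) = det (\<chi> a. if a = b then x else c a) + det (\<chi> a. if a = b then y else c a)"
    using det_row_add[of b "\<lambda>_. x" "\<lambda>_. y" c] by simp
  show "det (\<chi> a. if a = b then r *\<^sub>R x else c a) = r *\<^sub>R det (\<chi> a. if a = b then x else c a)"
    using det_row_mul[of b r "\<lambda>_. x" c] by (simp add: scalar_mult_eq_scaleR cong: if_cong)
qed

lemma linear_vol_left: "linear (\<lambda>v. vol e v u)"
  unfolding vol_def by (subst rows_upd_None[of _ _ 0]) (rule linear_det_row)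

lemma linear_vol_right: "linear (\<lambda>w. vol e v (u(k := w)))"
  unfolding vol_def by (subst rows_upd_Some) (rule linear_det_row)

lemma dvol_add: "dvol e v u (\<lambda>i. w i + w' i) = dvol e v u w + dvol e v u w'"
  unfolding dvol_def by (simp add: linear_add[OF linear_vol_right] sum.distrib)

lemma dvol_scaleR: "dvol e v u (\<lambda>i. c *\<^sub>R w i) = c * dvol e v u w"
  unfolding dvol_def by (simp add: linear_scale[OF linear_vol_right] sum_distrib_left)

lemma dvol_sum: "finite I \<Longrightarrow> dvol e v u (\<lambda>i. \<Sum>j\<in>I. w j i) = (\<Sum>j\<in>I. dvol e v u (w j))"
proof (induction I rule: finite_induct)
  case empty
  then show ?case using dvol_scaleR[of v u 0 "\<lambda>_. 0"] by simp
qed (simp add: dvol_add)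

text \<open>This moves a vector from a tangential place to the distinguished one. One such term for
  every coordinate is the origin of the factor \<open>CARD('n)\<close> in the divergence
  identity.\<close>

lemma vol_swap_None: "vol e (u i) (u(i := w)) = - vol e w u"
proof -
  let ?p = "Transposition.transpose (e None) (e (Some i))"
  let ?A = "(\<chi> a. case inv e a of None \<Rightarrow> w | Some i \<Rightarrow> u i) :: real^'m^'m"
  have "e None \<noteq> e (Some i)" by (auto simp: e_eq_iff)
  moreover have "(case inv e a of None \<Rightarrow> u i | Some j \<Rightarrow> (u(i := w)) j) = ?A $ ?p a" for a
    using ex_e[of a] by (auto simp: inv_e e_eq_iff Transposition.transpose_def split: option.split)
  ultimately show ?thesis
    using det_permute_rows[of ?p ?A] by (simp add: vol_def sign_swap_id permutes_swap_id)
qed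

lemma vol_swap_Some:
  assumes "i \<noteq> j"
  shows "vol e v (u(i := a, j := b)) = - vol e v (u(i := b, j := a))"
proof -
  let ?p = "Transposition.transpose (e (Some i)) (e (Some j))"
  let ?A = "(\<chi> c. case inv e c of None \<Rightarrow> v | Some k \<Rightarrow> (u(i := b, j := a)) k) :: real^'m^'m"
  have "e (Some j) \<noteq> e (Some i)" using assms by (auto simp: e_eq_iff)
  moreover have "(case inv e c of None \<Rightarrow> v | Some k \<Rightarrow> (u(i := a, j := b)) k) = ?A $ ?p c" for c
    using ex_e[of c] assms by (auto simp: inv_e e_eq_iff Transposition.transpose_def split: option.split)
  ultimately show ?thesis
    using det_permute_rows[of ?p ?A] by (simp add: vol_def sign_swap_id permutes_swap_id)
qed

text \<open>The substitution is left multiplication by a block matrix, with 1 at the distinguished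
  index and the transpose of \<open>J\<close> on the others. It serves both a change of chart and
  the substitution dz = dx o (1 + t S).\<close>

lemma vol_matrix: "vol e v (\<lambda>i. \<Sum>j\<in>UNIV. J $ j $ i *\<^sub>R u j) = det J * vol e v u"
proof -
  let ?f = "\<lambda>i. e (Some i)"
  have f: "inj ?f" using e by (auto simp: inj_on_def bij_def)
  let ?E = "(\<chi> a b. if a \<in> range ?f then (if b \<in> range ?f then transpose J $ inv ?f a $ inv ?f b else 0)
                     else of_bool (a = b)) :: real^'m^'m"
  let ?A = "(\<chi> a. case inv e a of None \<Rightarrow> v | Some i \<Rightarrow> u i) :: real^'m^'m"
  have N: "e None \<notin> range ?f" by (auto simp: e_eq_iff)
  have "(?E ** ?A) $ a = (case inv e a of None \<Rightarrow> v | Some i \<Rightarrow> \<Sum>j\<in>UNIV. J $ j $ i *\<^sub>R u j)" for a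
  proof -
    obtain p where a: "a = e p" using ex_e by blast
    show ?thesis
    proof (cases p)
      case None
      then show ?thesis using a by (auto simp: vec_eq_iff matrix_matrix_mult_def inv_e sum_rows e_eq_iff image_iff)
    next
      case (Some i)
      have "inv ?f (e (Some i)) = i" for i using inv_f_f[OF f] by simp
      then show ?thesis using a N Some
        by (auto simp: vec_eq_iff matrix_matrix_mult_def inv_e sum_rows transpose_def)
    qed
  qed
  then have "(\<chi> a. case inv e a of None \<Rightarrow> v | Some i \<Rightarrow> \<Sum>j\<in>UNIV. J $ j $ i *\<^sub>R u j) = ?E ** ?A"
    by (simp add: vec_eq_iff)
  then show ?thesis
    by (simp add: vol_def det_mul det_embed[OF f])
qed

text \<open>Subtracting the normal component of \<open>v\<close> leaves only rows orthogonal to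
  \<nu>. This is how the factors y \<bullet> \<nu> and z \<bullet> \<nu> come out of the
  determinants.\<close>

lemma vol_tangent:
  assumes "norm \<nu> = 1" "\<And>i. u i \<bullet> \<nu> = 0"
  shows "vol e v u = (v \<bullet> \<nu>) * vol e \<nu> u"
proof -
  have n: "\<nu> \<bullet> \<nu> = 1" using assms(1) by (simp add: norm_eq_1)
  have "vol e (v - (v \<bullet> \<nu>) *\<^sub>R \<nu>) u = 0"
    by (rule vol_rows_normal[of \<nu>]) (use assms n in \<open>auto simp: inner_diff_left\<close>)
  then show ?thesis
    by (simp add: linear_diff[OF linear_vol_left] linear_scale[OF linear_vol_left])
qed

text \<open>Let \<open>A\<close> have the rows \<nu> and \<open>u i\<close>. As \<nu> is a unit
  vector orthogonal to the \<open>u i\<close>, the product of \<open>A\<close> with its transpose is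
  block diagonal with blocks 1 and the Gram matrix.\<close>

lemma gram_det_eq_vol_sq:
  assumes "norm \<nu> = 1" "\<And>i. u i \<bullet> \<nu> = 0"
  shows "det (\<chi> i j. u i \<bullet> u j) = (vol e \<nu> u)\<^sup>2"
proof -
  let ?A = "(\<chi> a. case inv e a of None \<Rightarrow> \<nu> | Some i \<Rightarrow> u i) :: real^'m^'m"
  let ?f = "\<lambda>i. e (Some i)"
  have n: "\<nu> \<bullet> \<nu> = 1" using assms(1) by (simp add: norm_eq_1)
  have f: "inj ?f" using e by (auto simp: inj_on_def bij_def)
  have if': "inv ?f (e (Some i)) = i" for i using inv_f_f[OF f] by simp
  have N: "e None \<notin> range ?f" by (auto simp: e_eq_iff)
  have "(?A ** transpose ?A) $ a $ b = (if a \<in> range ?f then (if b \<in> range ?f then (\<chi> i j. u i \<bullet> u j) $ inv ?f a $ inv ?f b else 0)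
                     else of_bool (a = b))" for a b
  proof -
    obtain p q where "a = e p" "b = e q" using ex_e by blast
    moreover have "(?A ** transpose ?A) $ a $ b = (?A $ a) \<bullet> (?A $ b)"
      by (simp add: matrix_matrix_mult_def transpose_def inner_vec_def)
    ultimately show ?thesis
      using N n assms(2) by (cases p; cases q) (auto simp: inv_e if' inner_commute e_eq_iff)
  qed
  then have "?A ** transpose ?A = (\<chi> a b. if a \<in> range ?f then (if b \<in> range ?f then (\<chi> i j. u i \<bullet> u j) $ inv ?f a $ inv ?f b else 0)
                     else of_bool (a = b))"
    by (simp add: vec_eq_iff)
  then have "det (\<chi> i j. u i \<bullet> u j) = det (?A ** transpose ?A)"
    using det_embed[OF f, of "\<chi> i j. u i \<bullet> u j"] by simp
  then show ?thesis
    by (simp add: vol_def det_mul power2_eq_square)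
qed

text \<open>A kernel vector of the Gram matrix gives a combination of the \<open>u i\<close> that is
  orthogonal to each of them, hence to itself.\<close>

lemma vol_nonzero:
  assumes "norm \<nu> = 1" "\<And>i. u i \<bullet> \<nu> = 0"
    and inj: "\<And>c. (\<Sum>i\<in>UNIV. c $ i *\<^sub>R u i) = 0 \<Longrightarrow> c = 0"
  shows "vol e \<nu> u \<noteq> 0"
proof
  assume "vol e \<nu> u = 0"
  then have "det (\<chi> i j. u i \<bullet> u j) = 0" using gram_det_eq_vol_sq[of \<nu> u] assms by simp
  then obtain c where c: "c \<noteq> 0" "(\<chi> i j. u i \<bullet> u j) *v c = 0"
    using invertible_det_rows by blast
  let ?s = "\<Sum>i\<in>UNIV. c $ i *\<^sub>R u i"
  have "u i \<bullet> ?s = ((\<chi> i j. u i \<bullet> u j) *v c) $ i" for i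
    by (simp add: matrix_vector_mult_def inner_sum_right mult.commute)
  then have "u i \<bullet> ?s = 0" for i using c by simp
  then have "?s \<bullet> ?s = 0" by (subst inner_sum_left) simp
  then show False using inj c by auto
qed

lemma vol_bound:
  fixes v :: "real^'m"
  assumes "norm v \<le> B" "\<And>i. norm (u i) \<le> B"
  shows "\<bar>vol e v u\<bar> \<le> real (card {p. p permutes (UNIV::'m set)}) * B ^ CARD('m)"
  unfolding vol_def
proof (rule det_abs_bound)
  fix a b
  show "\<bar>(\<chi> a. case inv e a of None \<Rightarrow> v | Some i \<Rightarrow> u i) $ a $ b\<bar> \<le> B"
    using assms component_le_norm_cart order_trans by (fastforce split: option.split)
qed

lemma has_derivative_vol:
  fixes v :: "'a::real_normed_vector \<Rightarrow> real^'m"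
  assumes v: "(v has_derivative v') (at x within S)"
    and u: "\<And>i. ((\<lambda>y. u y i) has_derivative u' i) (at x within S)"
  shows "((\<lambda>y. vol e (v y) (u y)) has_derivative
    (\<lambda>h. vol e (v' h) (u x) + dvol e (v x) (u x) (\<lambda>i. u' i h))) (at x within S)"
proof -
  define r where "r y a = (case inv e a of None \<Rightarrow> v y | Some i \<Rightarrow> u y i)" for y a
  define r' where "r' a = (case inv e a of None \<Rightarrow> v' | Some i \<Rightarrow> u' i)" for a
  have d: "((\<lambda>y. r y a) has_derivative r' a) (at x within S)" for a
    using v u by (cases "inv e a") (auto simp: r_def r'_def)
  have "(\<Sum>b\<in>UNIV. det (\<chi> a. if a = b then r' b h else r x a)) =
      vol e (v' h) (u x) + dvol e (v x) (u x) (\<lambda>i. u' i h)" for h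
    unfolding sum_rows dvol_def
  proof (intro arg_cong2[where f="(+)"] sum.cong refl)
    show "det (\<chi> a. if a = e None then r' (e None) h else r x a) = vol e (v' h) (u x)"
      unfolding vol_def rows_upd_None[of "v' h" "u x" "v x"] by (simp add: r_def r'_def inv_e cong: if_cong)
    show "det (\<chi> a. if a = e (Some i) then r' (e (Some i)) h else r x a) = vol e (v x) ((u x)(i := u' i h))" for i
      unfolding vol_def rows_upd_Some by (simp add: r_def r'_def inv_e cong: if_cong)
  qed
  then show ?thesis
    using has_derivative_det[of r r', OF d] by (simp add: vol_def r_def)
qed

lemma dvol_derivative:
  "((\<lambda>s::real. vol e v (\<lambda>i. u i + s *\<^sub>R w i)) has_field_derivative dvol e v u w) (at 0)"
proof -
  have "((\<lambda>s::real. vol e v (\<lambda>i. u i + s *\<^sub>R w i)) has_derivative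
     (\<lambda>h. vol e 0 (\<lambda>i. u i + 0 *\<^sub>R w i) + dvol e v (\<lambda>i. u i + 0 *\<^sub>R w i) (\<lambda>i. h *\<^sub>R w i))) (at 0)"
    by (rule has_derivative_vol) (auto intro!: derivative_eq_intros)
  then show ?thesis
    by (simp add: has_field_derivative_def dvol_scaleR linear_0[OF linear_vol_left] mult_commute_abs)
qed

text \<open>Both sides are derivatives at \<open>s = 0\<close> of \<open>vol_matrix\<close> applied
  to \<open>u\<close> plus \<open>s\<close> times \<open>w\<close>, so the sum in
  \<open>dvol\<close> is never expanded.\<close>

lemma dvol_matrix:
  "dvol e v (\<lambda>i. \<Sum>j\<in>UNIV. J $ j $ i *\<^sub>R u j) (\<lambda>i. \<Sum>j\<in>UNIV. J $ j $ i *\<^sub>R w j) = det J * dvol e v u w"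
proof -
  have "((\<lambda>s::real. det J * vol e v (\<lambda>i. u i + s *\<^sub>R w i)) has_field_derivative det J * dvol e v u w) (at 0)"
    by (rule DERIV_cmult[OF dvol_derivative])
  then show ?thesis
    using dvol_derivative[of v "\<lambda>i. \<Sum>j\<in>UNIV. J $ j $ i *\<^sub>R u j" "\<lambda>i. \<Sum>j\<in>UNIV. J $ j $ i *\<^sub>R w j"]
    by (intro DERIV_unique) (auto simp: vol_matrix[symmetric] scaleR_sum_right scaleR_add_right sum.distrib mult.commute)
qed

lemma continuous_on_vol [continuous_intros]:
  fixes v :: "'a::topological_space \<Rightarrow> real^'m"
  assumes "continuous_on S v" "\<And>i. continuous_on S (\<lambda>y. u y i)"
  shows "continuous_on S (\<lambda>y. vol e (v y) (u y))"
  unfolding vol_def det_def vec_lambda_beta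
proof (intro continuous_on_sum continuous_on_mult continuous_on_const continuous_on_prod)
  fix b :: "'m \<Rightarrow> 'm" and a
  show "continuous_on S (\<lambda>y. (case inv e a of None \<Rightarrow> v y | Some i \<Rightarrow> u y i) $ b a)"
    using assms by (cases "inv e a") (auto intro!: continuous_intros)
qed

lemma continuous_on_dvol [continuous_intros]:
  fixes v :: "'a::topological_space \<Rightarrow> real^'m"
  assumes "continuous_on S v" "\<And>i. continuous_on S (\<lambda>y. u y i)" "\<And>i. continuous_on S (\<lambda>y. w y i)"
  shows "continuous_on S (\<lambda>y. dvol e (v y) (u y) (w y))"
  unfolding dvol_def
proof (intro continuous_intros assms(1))
  fix i j
  show "continuous_on S (\<lambda>y. ((u y)(i := w y i)) j)"
    using assms by (cases "j = i") auto
qed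

end

section \<open>Elementary symmetric functions of eigenvalues\<close>

text \<open>Expanding the product gives one term for each set of indices; grouping these sets by
  cardinality produces the elementary symmetric functions.\<close>

lemma elem_sym_generating:
  "(\<Prod>x\<leftarrow>\<kappa>. 1 + t * x) = (\<Sum>r\<le>length \<kappa>. elem_sym r \<kappa> * t ^ r)"
proof -
  let ?n = "length \<kappa>"
  have "(\<Prod>x\<leftarrow>\<kappa>. 1 + t * x) = (\<Prod>i<?n. t * \<kappa> ! i + 1)"
    by (simp add: prod.list_conv_set_nth atLeast0LessThan add.commute)
  also have "\<dots> = (\<Sum>I\<in>Pow {..<?n}. (\<Prod>i\<in>I. t * \<kappa> ! i) * (\<Prod>i\<in>{..<?n} - I. 1))"
    by (rule prod_add) simp
  also have "\<dots> = (\<Sum>I\<in>Pow {..<?n}. t ^ card I * (\<Prod>i\<in>I. \<kappa> ! i))"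
    by (simp add: prod.distrib)
  also have "\<dots> = (\<Sum>r\<le>?n. \<Sum>I\<in>{I\<in>Pow {..<?n}. card I = r}. t ^ card I * (\<Prod>i\<in>I. \<kappa> ! i))"
  proof (rule sum.group[symmetric])
    show "card ` Pow {..<?n} \<subseteq> {..?n}"
      using card_mono[of "{..<?n}"] by fastforce
  qed auto
  also have "\<dots> = (\<Sum>r\<le>?n. elem_sym r \<kappa> * t ^ r)"
    by (rule sum.cong) (auto simp: elem_sym_def sum_distrib_left mult.commute intro!: sum.cong)
  finally show ?thesis .
qed

text \<open>A maximiser of the Rayleigh quotient \<open>B (S x) x / B x x\<close> on the unit sphere
  of \<open>V\<close> is an eigenvector. The form \<open>B\<close> is arbitrary because the
  anisotropic shape operator is self-adjoint for a product other than the Euclidean one of the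
  coordinates.\<close>

lemma selfadjoint_eigenvector:
  fixes S :: "'a::euclidean_space \<Rightarrow> 'a" and B :: "'a \<Rightarrow> 'a \<Rightarrow> real"
  assumes S: "linear S" and B: "bilinear B"
    and pos: "\<And>x. x \<noteq> 0 \<Longrightarrow> 0 < B x x" and symm: "\<And>x y. B x y = B y x"
    and adj: "\<And>x y. B (S x) y = B x (S y)"
    and V: "subspace V" "S ` V \<subseteq> V" "v0 \<in> V" "v0 \<noteq> 0"
  obtains v \<kappa> where "v \<in> V" "v \<noteq> 0" "S v = \<kappa> *\<^sub>R v"
proof -
  have bB: "bounded_bilinear B" using B by (simp add: bilinear_conv_bounded_bilinear)
  have bS: "bounded_linear S" using S by (simp add: linear_conv_bounded_linear)
  let ?K = "sphere 0 1 \<inter> V"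
  let ?f = "\<lambda>x. B (S x) x / B x x"
  have "compact ?K" by (intro compact_Int_closed compact_sphere closed_subspace V)
  moreover have "v0 /\<^sub>R norm v0 \<in> ?K" using V by (auto simp: subspace_scale)
  moreover have "continuous_on ?K ?f"
    using pos by (intro continuous_intros bounded_bilinear.continuous_on[OF bB]
        bounded_linear.continuous_on[OF bS]) (metis DiffE IntE dist_0_norm less_irrefl mem_sphere norm_zero zero_neq_one)
  ultimately obtain v where v: "v \<in> ?K" and max: "\<And>x. x \<in> ?K \<Longrightarrow> ?f x \<le> ?f v"
    using continuous_attains_sup[of ?K ?f] by blast
  define \<kappa> where "\<kappa> = ?f v"
  have v0: "v \<noteq> 0" "v \<in> V" using v by auto
  interpret B: bounded_bilinear B by fact
  interpret S: bounded_linear S by fact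
  \<comment> \<open>By maximality \<open>q\<close> is nonnegative on \<open>V\<close> and zero at
    \<open>v\<close>, so \<open>v\<close> minimises the quadratic form and lies in its radical.
    Testing this against the residual \<open>\<kappa> *\<^sub>R v - S v\<close> gives the eigenvalue
    equation.\<close>
  define q where "q x y = \<kappa> * B x y - B (S x) y" for x y
  have q0: "0 \<le> q w w" if "w \<in> V" for w
  proof (cases "w = 0")
    case True then show ?thesis by (simp add: q_def B.zero_right)
  next
    case False
    let ?u = "w /\<^sub>R norm w"
    have "?f ?u \<le> \<kappa>" unfolding \<kappa>_def by (rule max) (use that False V in \<open>auto simp: subspace_scale\<close>)
    moreover have "?f ?u = ?f w" using False by (simp add: B.scaleR_left B.scaleR_right S.scaleR)
    ultimately have "?f w \<le> \<kappa>" by (simp only:)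
    then show ?thesis using pos[OF False] by (simp add: q_def pos_divide_le_eq)
  qed
  have qv: "q v v = 0" using pos[OF v0(1)] by (simp add: q_def \<kappa>_def)
  have qvw: "q v w = 0" if w: "w \<in> V" for w
  proof (rule ccontr)
    assume n: "q v w \<noteq> 0"
    have exp: "0 \<le> 2 * t * q v w + t\<^sup>2 * q w w" for t
    proof -
      have "0 \<le> q (v + t *\<^sub>R w) (v + t *\<^sub>R w)" by (rule q0) (use V v0 w in \<open>auto simp: subspace_add subspace_scale\<close>)
      also have "q (v + t *\<^sub>R w) (v + t *\<^sub>R w) = q v v + 2 * t * q v w + t\<^sup>2 * q w w"
        using symm[of w v] adj[of w v] symm[of "S v" w]
        by (simp add: q_def B.add_left B.add_right S.add S.scaleR B.scaleR_left B.scaleR_right algebra_simps power2_eq_square)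
      finally show ?thesis by (simp add: qv)
    qed
    \<comment> \<open>With \<open>s = q w w\<close> the parameter \<open>- q v w / s\<close> would
      minimise the quadratic in \<open>t\<close>; the summand 1 keeps \<open>s\<close> positive when
      \<open>q w w\<close> vanishes.\<close>
    define s where "s = q w w + 1"
    have "0 < s" using q0[OF w] by (simp add: s_def)
    have "2 * (- q v w / s) * q v w + (- q v w / s)\<^sup>2 * q w w = (q v w)\<^sup>2 / s * (q w w / s - 2)"
      using \<open>0 < s\<close> by (simp add: field_simps power2_eq_square)
    moreover have "q w w / s - 2 < 0" using \<open>0 < s\<close> q0[OF w] by (simp add: s_def field_simps)
    ultimately have "2 * (- q v w / s) * q v w + (- q v w / s)\<^sup>2 * q w w < 0"
      using n \<open>0 < s\<close> mult_pos_neg[of "(q v w)\<^sup>2 / s" "q w w / s - 2"] by simp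
    then show False using exp[of "- q v w / s"] by simp
  qed
  let ?w = "\<kappa> *\<^sub>R v - S v"
  have "?w \<in> V" using V v0 by (auto simp: subspace_diff subspace_scale)
  then have "B ?w ?w = 0" using qvw[of ?w] by (simp add: q_def B.diff_left B.scaleR_left)
  then have "?w = 0" using pos by fastforce
  then show ?thesis using that v0 by (metis eq_iff_diff_eq_0)
qed

text \<open>Split off one eigenvector and continue in its \<open>B\<close>-orthogonal complement
  inside \<open>V\<close>, which \<open>S\<close> preserves by self-adjointness. The dimension drops
  since \<open>B v v > 0\<close> excludes \<open>v\<close> from the complement.\<close>

lemma selfadjoint_eigenbasis:
  fixes S :: "'a::euclidean_space \<Rightarrow> 'a" and B :: "'a \<Rightarrow> 'a \<Rightarrow> real"
  assumes S: "linear S" and B: "bilinear B"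
    and pos: "\<And>x. x \<noteq> 0 \<Longrightarrow> 0 < B x x" and symm: "\<And>x y. B x y = B y x"
    and adj: "\<And>x y. B (S x) y = B x (S y)"
  assumes "subspace V" "S ` V \<subseteq> V"
  shows "\<exists>E. finite E \<and> independent E \<and> span E = V \<and> (\<forall>v\<in>E. \<exists>\<kappa>. S v = \<kappa> *\<^sub>R v)"
  using assms(6-)
proof (induction "dim V" arbitrary: V rule: less_induct)
  case less
  interpret B: bounded_bilinear B using B by (simp add: bilinear_conv_bounded_bilinear)
  show ?case
  proof (cases "V = {0}")
    case True
    then show ?thesis by (intro exI[of _ "{}"]) (auto simp: independent_empty)
  next
    case False
    then obtain v0 where "v0 \<in> V" "v0 \<noteq> 0" using subspace_0[OF less.prems(1)] by auto
    then obtain v \<kappa> where v: "v \<in> V" "v \<noteq> 0" "S v = \<kappa> *\<^sub>R v"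
      using selfadjoint_eigenvector[where S=S and B=B and V=V and ?v0.0=v0, OF S B pos symm adj less.prems] by metis
    define V' where "V' = {w \<in> V. B v w = 0}"
    have V': "subspace V'"
      using less.prems(1) by (auto simp: V'_def subspace_def B.add_right B.scaleR_right B.zero_right)
    have "S ` V' \<subseteq> V'"
      using less.prems(2) v by (auto simp: V'_def adj[symmetric] B.scaleR_left)
    have "v \<notin> V'" using pos[OF v(2)] by (simp add: V'_def)
    then have "V' \<subset> V" using v by (auto simp: V'_def)
    then have "dim V' < dim V"
      by (intro dim_psubset) (metis V' less.prems(1) span_eq_iff)
    from less.hyps[OF this V' \<open>S ` V' \<subseteq> V'\<close>] obtain E where
      E: "finite E" "independent E" "span E = V'" "\<forall>v\<in>E. \<exists>\<kappa>. S v = \<kappa> *\<^sub>R v" by blast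
    have "independent (insert v E)"
      using E \<open>v \<notin> V'\<close> by (simp add: independent_insertI)
    moreover have "span (insert v E) = V"
    proof
      show "span (insert v E) \<subseteq> V"
        using v E \<open>V' \<subset> V\<close> less.prems(1) span_superset[of E] by (intro span_minimal) auto
      show "V \<subseteq> span (insert v E)"
      proof
        fix w assume w: "w \<in> V"
        let ?c = "B v w / B v v"
        have "w - ?c *\<^sub>R v \<in> V'"
          using w v less.prems(1) pos[OF v(2)]
          by (simp add: V'_def subspace_diff subspace_scale B.diff_right B.scaleR_right)
        then show "w \<in> span (insert v E)"
          unfolding span_insert using E by blast
      qed
    qed
    ultimately show ?thesis using E v by (intro exI[of _ "insert v E"]) auto
  qed
qed

lemma eigenbasis_coords:
  fixes v :: "'n::finite \<Rightarrow> real^'n"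
  assumes ind: "independent (range v)" and inj: "inj v"
  shows "\<exists>c. w = (\<Sum>i\<in>UNIV. c i *\<^sub>R v i)"
    and "(\<Sum>i\<in>UNIV. c i *\<^sub>R v i) = 0 \<Longrightarrow> c i = 0"
proof -
  have "card (range v) = CARD('n)" using inj by (simp add: card_image)
  then have "span (range v) = UNIV"
    using ind card_ge_dim_independent[of "range v" UNIV] by auto
  then have "w \<in> span (range v)" by simp
  then obtain g where g: "w = (\<Sum>x\<in>range v. g x *\<^sub>R x)"
    by (auto simp: span_finite)
  then show "\<exists>c. w = (\<Sum>i\<in>UNIV. c i *\<^sub>R v i)"
    by (intro exI[of _ "\<lambda>i. g (v i)"]) (simp add: sum.reindex[OF inj])
  assume "(\<Sum>i\<in>UNIV. c i *\<^sub>R v i) = 0"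
  then have "(\<Sum>x\<in>range v. c (inv v x) *\<^sub>R x) = 0"
    using inj by (simp add: sum.reindex[OF inj])
  then have "c (inv v (v i)) = 0"
    using ind independentD[of "range v" "range v" "\<lambda>x. c (inv v x)" "v i"] by auto
  then show "c i = 0" using inj by simp
qed

text \<open>In the eigenbasis every power of \<open>S\<close> minus \<open>l\<close> is diagonal. So
  the generalised eigenspace of \<open>l\<close> is spanned by the basis vectors with eigenvalue
  \<open>l\<close>, and algebraic multiplicity becomes a count of indices.\<close>

lemma eigenvalue_list_eigenbasis:
  fixes v :: "'n::finite \<Rightarrow> real^'n"
  assumes S: "linear S" and ind: "independent (range v)" and inj: "inj v"
    and ev: "\<And>i. S (v i) = \<kappa> i *\<^sub>R v i"
  shows "mset (eigenvalue_list S) = image_mset \<kappa> (mset_set UNIV)"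
proof -
  interpret S: Real_Vector_Spaces.linear S by fact
  note ex = eigenbasis_coords(1)[OF ind inj] and zero = eigenbasis_coords(2)[OF ind inj]
  have Ssum: "S (\<Sum>i\<in>UNIV. c i *\<^sub>R v i) = (\<Sum>i\<in>UNIV. (c i * \<kappa> i) *\<^sub>R v i)" for c
    by (simp add: S.sum S.scale ev)
  have vne: "v i \<noteq> 0" for i using ind by (metis dependent_zero rangeI)
  have evs: "{l. \<exists>w. w \<noteq> 0 \<and> S w = l *\<^sub>R w} = range \<kappa>"
  proof safe
    fix l w assume w: "w \<noteq> 0" "S w = l *\<^sub>R w"
    obtain c where c: "w = (\<Sum>i\<in>UNIV. c i *\<^sub>R v i)" using ex by blast
    then obtain i where i: "c i \<noteq> 0" using w(1) by (metis (no_types, lifting) scaleR_zero_left sum.neutral)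
    have "(\<Sum>i\<in>UNIV. (c i * \<kappa> i - l * c i) *\<^sub>R v i) = 0"
      using w(2) c Ssum by (simp add: scaleR_diff_left sum_subtractf scaleR_sum_right)
    from zero[OF this, of i] i show "l \<in> range \<kappa>" by (auto simp: algebra_simps)
  next
    fix i show "\<exists>w. w \<noteq> 0 \<and> S w = \<kappa> i *\<^sub>R w" using ev vne by blast
  qed
  have step: "S (\<Sum>i\<in>UNIV. c i *\<^sub>R v i) - l *\<^sub>R (\<Sum>i\<in>UNIV. c i *\<^sub>R v i) = (\<Sum>i\<in>UNIV. (c i * (\<kappa> i - l)) *\<^sub>R v i)" for l c
    unfolding Ssum scaleR_sum_right sum_subtractf[symmetric] by (intro sum.cong) (auto simp: algebra_simps)
  have pow: "((\<lambda>w. S w - l *\<^sub>R w) ^^ m) (\<Sum>i\<in>UNIV. c i *\<^sub>R v i) = (\<Sum>i\<in>UNIV. (c i * (\<kappa> i - l) ^ m) *\<^sub>R v i)"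
    for l m c
    by (induction m) (simp_all add: step mult.assoc mult.commute[of "\<kappa> _ - l"])
  have dimk: "dim {w. ((\<lambda>w. S w - l *\<^sub>R w) ^^ DIM(real^'n)) w = 0} = card {i. \<kappa> i = l}" for l
  proof -
    have "{w. ((\<lambda>w. S w - l *\<^sub>R w) ^^ DIM(real^'n)) w = 0} = span (v ` {i. \<kappa> i = l})" (is "?L = ?R")
    proof safe
      fix w assume w: "((\<lambda>w. S w - l *\<^sub>R w) ^^ DIM(real^'n)) w = 0"
      obtain c where c: "w = (\<Sum>i\<in>UNIV. c i *\<^sub>R v i)" using ex by blast
      have "c i = 0" if "\<kappa> i \<noteq> l" for i
        using zero[of "\<lambda>i. c i * (\<kappa> i - l) ^ DIM(real^'n)" i] w c that by (simp add: pow)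
      then have "w = (\<Sum>i | \<kappa> i = l. c i *\<^sub>R v i)"
        unfolding c by (intro sum.mono_neutral_right) auto
      moreover have "(\<Sum>i | \<kappa> i = l. c i *\<^sub>R v i) \<in> ?R" by (intro span_sum span_scale span_base) auto
      ultimately show "w \<in> ?R" by simp
    next
      fix w assume "w \<in> ?R"
      then obtain g where g: "w = (\<Sum>x\<in>v ` {i. \<kappa> i = l}. g x *\<^sub>R x)" by (auto simp: span_finite)
      have "w = (\<Sum>i | \<kappa> i = l. g (v i) *\<^sub>R v i)"
        unfolding g using inj by (subst sum.reindex) (auto simp: inj_on_def inj_def)
      also have "\<dots> = (\<Sum>i\<in>UNIV. (if \<kappa> i = l then g (v i) else 0) *\<^sub>R v i)"
        by (intro sum.mono_neutral_cong_left) auto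
      finally have w: "w = (\<Sum>i\<in>UNIV. (if \<kappa> i = l then g (v i) else 0) *\<^sub>R v i)" .
      show "((\<lambda>w. S w - l *\<^sub>R w) ^^ DIM(real^'n)) w = 0"
        unfolding w pow by (rule sum.neutral) auto
    qed
    moreover have "independent (v ` {i. \<kappa> i = l})" using ind by (rule independent_mono) auto
    ultimately show ?thesis using dim_span_eq_card_independent[of "v ` {i. \<kappa> i = l}"] inj_on_subset[OF inj, of "{i. \<kappa> i = l}"]
      by (simp add: card_image del: dim_span)
  qed
  have "mset (eigenvalue_list S) = (\<Sum>l\<in>range \<kappa>. replicate_mset (card {i. \<kappa> i = l}) l)"
    unfolding eigenvalue_list_def evs dimk by simp
  also have "\<dots> = image_mset \<kappa> (mset_set UNIV)"
  proof (rule multiset_eqI)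
    fix l
    have "count (\<Sum>l\<in>range \<kappa>. replicate_mset (card {i. \<kappa> i = l}) l) l = (\<Sum>l'\<in>range \<kappa>. if l' = l then card {i. \<kappa> i = l'} else 0)"
      by (simp add: count_sum)
    also have "\<dots> = card {i. \<kappa> i = l}" by (auto simp: sum.delta' card_eq_0_iff)
    also have "\<dots> = count (image_mset \<kappa> (mset_set UNIV)) l"
      by (simp add: count_image_mset' vimage_def sum.If_cases eq_commute[of l])
    finally show "count (\<Sum>l\<in>range \<kappa>. replicate_mset (card {i. \<kappa> i = l}) l) l = count (image_mset \<kappa> (mset_set UNIV)) l" .
  qed
  finally show ?thesis .
qed

text \<open>Both sides are the product of the factors \<open>1 + t * \<kappa> i\<close> over an
  eigenbasis. Diagonalisability is what makes this work, since \<open>eigenvalue_list\<close>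
  collects real eigenvalues only.\<close>

lemma det_selfadjoint_eq_elem_sym:
  fixes S :: "real^'n \<Rightarrow> real^'n" and B :: "real^'n \<Rightarrow> real^'n \<Rightarrow> real"
  assumes S: "linear S" and B: "bilinear B"
    and pos: "\<And>x. x \<noteq> 0 \<Longrightarrow> 0 < B x x" and symm: "\<And>x y. B x y = B y x"
    and adj: "\<And>x y. B (S x) y = B x (S y)"
  shows "det (matrix (\<lambda>w. w + t *\<^sub>R S w)) = (\<Sum>r\<le>CARD('n). elem_sym r (eigenvalue_list S) * t ^ r)"
proof -
  obtain E where E: "finite E" "independent E" "span E = UNIV" "\<forall>v\<in>E. \<exists>\<kappa>. S v = \<kappa> *\<^sub>R v"
    using selfadjoint_eigenbasis[where S=S and B=B and V=UNIV] S B pos symm adj by (metis subspace_UNIV subset_UNIV)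
  have "card E = CARD('n)"
    using E dim_eq_card[of E UNIV] by simp
  then obtain v where v: "bij_betw v (UNIV::'n set) E"
    using E(1) finite_same_card_bij[of "UNIV::'n set" E] by auto
  then have inj: "inj v" and rng: "range v = E" by (auto simp: bij_betw_def)
  have "\<forall>i. \<exists>\<kappa>. S (v i) = \<kappa> *\<^sub>R v i" using E(4) rng by auto
  then obtain \<kappa> where \<kappa>: "\<And>i. S (v i) = \<kappa> i *\<^sub>R v i" unfolding choice_iff by blast
  have ms: "mset (eigenvalue_list S) = image_mset \<kappa> (mset_set UNIV)"
    by (rule eigenvalue_list_eigenbasis[OF S _ inj \<kappa>]) (use E rng in auto)
  then have len: "length (eigenvalue_list S) = CARD('n)" by (metis size_mset size_image_mset size_mset_set)
  have "(\<Prod>x\<leftarrow>eigenvalue_list S. 1 + t * x) = (\<Prod>i\<in>UNIV. 1 + t * \<kappa> i)"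
  proof -
    have "(\<Prod>x\<leftarrow>eigenvalue_list S. 1 + t * x) = prod_mset (image_mset (\<lambda>x. 1 + t * x) (mset (eigenvalue_list S)))"
      by (metis mset_map prod_mset_prod_list)
    then show ?thesis by (simp add: ms prod_unfold_prod_mset multiset.map_comp o_def)
  qed
  moreover have "det (matrix (\<lambda>w. w + t *\<^sub>R S w)) = (\<Prod>i\<in>UNIV. 1 + t * \<kappa> i)"
  proof -
    let ?V = "(\<chi> i j. v j $ i) :: real^'n^'n"
    let ?D = "(\<chi> i j. if i = j then 1 + t * \<kappa> i else 0) :: real^'n^'n"
    let ?f = "\<lambda>w. w + t *\<^sub>R S w"
    have lin: "linear ?f"
      by (rule linearI) (simp_all add: linear_add[OF S] linear_scale[OF S] algebra_simps)
    have V: "?V *v c = (\<Sum>i\<in>UNIV. c $ i *\<^sub>R v i)" for c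
      by (simp add: vec_eq_iff matrix_vector_mult_def mult.commute)
    have "det ?V \<noteq> 0"
    proof
      assume "det ?V = 0"
      then obtain c where "c \<noteq> 0" "?V *v c = 0" using invertible_det_rows by blast
      have "c $ i = 0" for i
        by (rule eigenbasis_coords(2)[of v "\<lambda>i. c $ i"]) (use E rng inj \<open>?V *v c = 0\<close> V in auto)
      with \<open>c \<noteq> 0\<close> show False by (simp add: vec_eq_iff)
    qed
    have vi: "?f (v i) = (1 + t * \<kappa> i) *\<^sub>R v i" for i by (simp add: \<kappa> algebra_simps)
    have "matrix ?f ** ?V = ?V ** ?D"
    proof -
      have "(matrix ?f ** ?V) *v axis i 1 = (?V ** ?D) *v axis i 1" for i
      proof -
        have 1: "?V *v axis i 1 = v i" by (simp add: matrix_vector_mult_basis column_def vec_eq_iff)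
        have 2: "?D *v axis i 1 = (1 + t * \<kappa> i) *\<^sub>R axis i 1"
          by (simp only: matrix_vector_mult_basis column_def) (auto simp: vec_eq_iff axis_def)
        have "(matrix ?f ** ?V) *v axis i 1 = matrix ?f *v v i"
          by (simp only: matrix_vector_mul_assoc[symmetric] 1)
        also have "\<dots> = (1 + t * \<kappa> i) *\<^sub>R v i" by (simp only: matrix_works[OF lin[unfolded linear_matrix_vector_mul_eq[symmetric]]] vi)
        also have "\<dots> = ?V *v ((1 + t * \<kappa> i) *\<^sub>R axis i 1)" by (simp only: matrix_vector_mult_scaleR 1)
        also have "\<dots> = (?V ** ?D) *v axis i 1" by (simp only: matrix_vector_mul_assoc[symmetric] 2)
        finally show ?thesis .
      qed
      then have "column j (matrix ?f ** ?V) $ i = column j (?V ** ?D) $ i" for i j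
        by (simp only: matrix_vector_mult_basis)
      then have "(matrix ?f ** ?V) $ i $ j = (?V ** ?D) $ i $ j" for i j
        by (simp only: column_def vec_lambda_beta)
      then show ?thesis unfolding vec_eq_iff by blast
    qed
    from arg_cong[OF this, of det] have "det (matrix ?f) * det ?V = det ?V * det ?D" by (simp only: det_mul)
    then have "det (matrix ?f) = det ?D" using \<open>det ?V \<noteq> 0\<close>
      by (simp only: mult.commute[of "det ?V"] mult_right_cancel not_False_eq_True simp_thms)
    also have "det ?D = (\<Prod>i\<in>UNIV. 1 + t * \<kappa> i)" by (subst det_diagonal) auto
    finally show ?thesis .
  qed
  ultimately show ?thesis using elem_sym_generating[of t "eigenvalue_list S"] len by (simp only:)
qed

section \<open>Divergence theorem and symmetry of second derivatives\<close>

lemma continuous_compact_support: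
  fixes f :: "'a::euclidean_space \<Rightarrow> 'b::euclidean_space"
  assumes "continuous_on UNIV f" "compact C" "\<And>y. y \<notin> C \<Longrightarrow> f y = 0"
  shows "integrable lborel f" "\<exists>B>0. \<forall>y. norm (f y) \<le> B"
    "integral\<^sup>L lborel f = integral UNIV f"
proof -
  have c: "continuous_on C f" using assms(1) continuous_on_subset by blast
  have eq: "f = (\<lambda>y. indicator C y *\<^sub>R f y)" using assms(3) by (auto simp: fun_eq_iff indicator_def)
  have "integrable lborel (\<lambda>y. indicator C y *\<^sub>R f y)"
    by (rule borel_integrable_compact[OF assms(2) c])
  then show "integrable lborel f" using eq by metis
  then show "integral\<^sup>L lborel f = integral UNIV f" by (simp add: integral_lborel)
  have "bounded (f ` C)" using c assms(2) by (intro compact_imp_bounded compact_continuous_image)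
  then obtain B where "B > 0" "\<And>y. y \<in> C \<Longrightarrow> norm (f y) \<le> B" by (auto simp: bounded_pos)
  then show "\<exists>B>0. \<forall>y. norm (f y) \<le> B" using assms(3) by (metis less_imp_le norm_zero)
qed

lemma has_vector_derivative_along_line:
  assumes "(G has_derivative L) (at (p + s *\<^sub>R v))"
  shows "((\<lambda>s. G (p + s *\<^sub>R v)) has_vector_derivative L v) (at s)"
proof -
  have "((\<lambda>s. G (p + s *\<^sub>R v)) has_derivative (\<lambda>t. L (t *\<^sub>R v))) (at s)"
    by (rule has_derivative_compose[of "\<lambda>s. p + s *\<^sub>R v" "\<lambda>t. t *\<^sub>R v" _ _ G, OF _ assms])
       (auto intro!: derivative_eq_intros)
  moreover have "L (t *\<^sub>R v) = t *\<^sub>R L v" for t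
    using has_derivative_linear[OF assms] by (simp add: linear_scale)
  ultimately show ?thesis by (simp add: has_vector_derivative_def)
qed

lemma directional_increment_bound:
  fixes G :: "'a::euclidean_space \<Rightarrow> 'b::euclidean_space"
  assumes d: "\<And>y. (G has_derivative G' y) (at y)" and B: "\<And>y. norm (G' y v) \<le> B"
  shows "norm (G (y + h *\<^sub>R v) - G y) \<le> B * \<bar>h\<bar>"
proof -
  have "norm (G (y + h *\<^sub>R v) - G (y + 0 *\<^sub>R v)) \<le> B * norm (h - 0)"
  proof (rule differentiable_bound[where S = UNIV and f' = "\<lambda>s t. t *\<^sub>R G' (y + s *\<^sub>R v) v"])
    fix s :: real
    show "((\<lambda>s. G (y + s *\<^sub>R v)) has_derivative (\<lambda>t. t *\<^sub>R G' (y + s *\<^sub>R v) v)) (at s within UNIV)"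
      using has_vector_derivative_along_line[OF d] by (simp add: has_vector_derivative_def)
    show "onorm (\<lambda>t. t *\<^sub>R G' (y + s *\<^sub>R v) v) \<le> B"
      by (rule onorm_le) (simp add: mult.commute[of B] mult_left_mono B)
  qed auto
  then show ?thesis by simp
qed

text \<open>By translation invariance every difference quotient of \<open>G\<close> along
  \<open>v\<close> has integral zero, and the quotients converge boundedly, on a fixed compact set,
  to the directional derivative.\<close>

lemma integral_directional_derivative_eq_0:
  fixes G :: "'a::euclidean_space \<Rightarrow> 'b::euclidean_space"
  assumes d: "\<And>y. (G has_derivative G' y) (at y)"
    and c: "continuous_on UNIV (\<lambda>y. G' y v)"
    and C: "compact C" "\<And>y. y \<notin> C \<Longrightarrow> G y = 0"
  shows "integral\<^sup>L lborel (\<lambda>y. G' y v) = 0"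
proof -
  have cG: "continuous_on UNIV G"
    by (meson d continuous_at_imp_continuous_on has_derivative_continuous)
  have G'0: "G' y v = 0" if "y \<notin> C" for y
  proof -
    have "open (- C)" using C(1) by (simp add: compact_imp_closed open_Compl)
    then have "(G has_derivative (\<lambda>_. 0)) (at y)"
      by (rule has_derivative_transform_within_open[OF has_derivative_const, of "- C" y 0]) (use C(2) that in auto)
    then show ?thesis using d[of y] has_derivative_unique by metis
  qed
  obtain B where B: "B > 0" "\<And>y. norm (G' y v) \<le> B"
    using continuous_compact_support(2)[OF c C(1) G'0] by blast
  define h where "h k = inverse (real (Suc k))" for k
  have h: "0 < h k" "h k \<le> 1" for k by (auto simp: h_def field_simps)
  have h0: "h \<longlonglongrightarrow> 0" unfolding h_def by (rule LIMSEQ_inverse_real_of_nat)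
  let ?q = "\<lambda>k y. (G (y + h k *\<^sub>R v) - G y) /\<^sub>R h k"
  \<comment> \<open>\<open>C\<close> swept backwards along \<open>v\<close> for times in the unit
    interval. As \<open>h k \<le> 1\<close>, it contains the support of every difference
    quotient.\<close>
  let ?D = "(\<lambda>(x, s). x - s *\<^sub>R v) ` (C \<times> {0..1::real})"
  have D: "compact ?D"
    by (intro compact_continuous_image compact_Times C(1) compact_Icc) (auto intro!: continuous_intros simp: case_prod_unfold)
  have mG [measurable]: "G \<in> borel_measurable borel" using cG by (rule borel_measurable_continuous_onI)
  have iG: "integrable lborel G" by (rule continuous_compact_support(1)[OF cG C])
  have shift: "integrable lborel (\<lambda>y. G (y + a)) \<and> integral\<^sup>L lborel (\<lambda>y. G (y + a)) = integral\<^sup>L lborel G" for a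
  proof -
    have "integrable (distr lborel borel ((+) a)) G" using iG by (simp add: lborel_distr_plus)
    then have "integrable lborel (\<lambda>y. G (a + y))" by (subst (asm) integrable_distr_eq) auto
    moreover have "integral\<^sup>L (distr lborel borel ((+) a)) G = integral\<^sup>L lborel (\<lambda>y. G (a + y))"
      by (subst integral_distr) (use iG in auto)
    ultimately show ?thesis by (simp add: add.commute lborel_distr_plus)
  qed
  have "(\<lambda>k. integral\<^sup>L lborel (?q k)) \<longlonglongrightarrow> integral\<^sup>L lborel (\<lambda>y. G' y v)"
  proof (rule integral_dominated_convergence[where w = "\<lambda>y. indicator ?D y *\<^sub>R B"])
    show "(\<lambda>y. G' y v) \<in> borel_measurable lborel"
      using borel_measurable_continuous_onI[OF c] by simp
    show "?q k \<in> borel_measurable lborel" for k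
      using borel_measurable_continuous_onI[OF cG] by simp
    show "integrable lborel (\<lambda>y. indicator ?D y *\<^sub>R B)"
      by (rule borel_integrable_compact[OF D]) auto
    show "AE y in lborel. (\<lambda>k. ?q k y) \<longlonglongrightarrow> G' y v"
    proof (rule AE_I2)
      fix y
      have "((\<lambda>s. G (y + s *\<^sub>R v)) has_derivative (\<lambda>t. t *\<^sub>R G' y v)) (at 0)"
        using has_vector_derivative_along_line[where s = 0, OF d] by (simp add: has_vector_derivative_def)
      then have "((\<lambda>s. norm (G (y + s *\<^sub>R v) - G y - s *\<^sub>R G' y v) / norm s) \<longlongrightarrow> 0) (at 0)"
        by (simp add: has_derivative_at)
      then have "((\<lambda>s. norm ((G (y + s *\<^sub>R v) - G y) /\<^sub>R s - G' y v)) \<longlongrightarrow> 0) (at 0)"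
      proof (rule Lim_transform_within[of _ _ _ _ 1])
        fix s :: real assume "0 < dist s 0"
        then have "(G (y + s *\<^sub>R v) - G y) /\<^sub>R s - G' y v = (G (y + s *\<^sub>R v) - G y - s *\<^sub>R G' y v) /\<^sub>R s"
          by (simp add: scaleR_diff_right)
        then show "norm (G (y + s *\<^sub>R v) - G y - s *\<^sub>R G' y v) / norm s = norm ((G (y + s *\<^sub>R v) - G y) /\<^sub>R s - G' y v)"
          by (simp only: norm_scaleR norm_inverse real_norm_def) (simp add: field_simps)
      qed auto
      then have "((\<lambda>s. (G (y + s *\<^sub>R v) - G y) /\<^sub>R s) \<longlongrightarrow> G' y v) (at 0)"
        by (rule LIM_zero_cancel[OF tendsto_norm_zero_cancel])
      moreover have "filterlim h (at 0) sequentially"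
        using h0 h(1) by (auto simp: filterlim_at intro!: always_eventually) (metis less_irrefl)
      ultimately show "(\<lambda>k. ?q k y) \<longlonglongrightarrow> G' y v"
        by (rule filterlim_compose)
    qed
    show "AE y in lborel. norm (?q k y) \<le> indicator ?D y *\<^sub>R B" for k
    proof (rule AE_I2)
      fix y
      show "norm (?q k y) \<le> indicator ?D y *\<^sub>R B"
      proof (cases "y \<in> ?D")
        case True
        have "norm (?q k y) = norm (G (y + h k *\<^sub>R v) - G y) / h k"
          using h(1)[of k] by (simp only: norm_scaleR norm_inverse real_norm_def) (simp add: divide_inverse mult.commute)
        also have "\<dots> \<le> B"
          using directional_increment_bound[OF d B(2), of y "h k"] h(1)[of k] by (simp add: pos_divide_le_eq)
        finally show ?thesis using True by simp
      next
        case False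
        have "y \<notin> C" using False by (force simp: image_iff)
        moreover have "y + h k *\<^sub>R v \<notin> C"
        proof
          assume "y + h k *\<^sub>R v \<in> C"
          then have "y \<in> ?D" using h[of k] by (intro image_eqI[of _ _ "(y + h k *\<^sub>R v, h k)"]) auto
          then show False using False by blast
        qed
        ultimately show ?thesis using C(2) False by simp
      qed
    qed
  qed
  moreover have "integral\<^sup>L lborel (?q k) = 0" for k
    using shift[of "h k *\<^sub>R v"] iG by simp
  ultimately have "(\<lambda>k. 0) \<longlonglongrightarrow> integral\<^sup>L lborel (\<lambda>y. G' y v)" by (simp only:)
  then show ?thesis by (simp only: LIMSEQ_const_iff)
qed

text \<open>The second difference over a small parallelogram equals \<open>h * h\<close> times
  either mixed derivative at some intermediate point; shrinking \<open>h\<close> gives equality at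
  \<open>x\<close>. Two fixed directions suffice because \<open>Ck_on\<close> records regularity one
  direction at a time.\<close>

lemma symmetric_second_derivative_real:
  fixes f :: "'a::euclidean_space \<Rightarrow> real"
  assumes U: "open U" "x \<in> U"
    and f': "\<And>y. y \<in> U \<Longrightarrow> (f has_derivative f' y) (at y)"
    and f''a: "\<And>y. y \<in> U \<Longrightarrow> ((\<lambda>y. f' y a) has_derivative fa y) (at y)"
    and f''b: "\<And>y. y \<in> U \<Longrightarrow> ((\<lambda>y. f' y b) has_derivative fb y) (at y)"
    and ca: "continuous_on U (\<lambda>y. fa y b)" and cb: "continuous_on U (\<lambda>y. fb y a)"
  shows "fa x b = fb x a"
proof -
  obtain r where r: "r > 0" "ball x r \<subseteq> U" using U by (meson openE)
  \<comment> \<open>Chosen so that the parallelogram with parameters below \<open>R\<close> stays in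
    the ball; the summand 1 excludes a zero denominator.\<close>
  define R where "R = r / (norm a + norm b + 1)"
  have R: "R > 0" using r by (auto simp: R_def intro!: divide_pos_pos add_nonneg_pos)
  have inU: "x + s *\<^sub>R a + t *\<^sub>R b \<in> U" if "\<bar>s\<bar> < R" "\<bar>t\<bar> < R" for s t
  proof -
    have "norm (s *\<^sub>R a + t *\<^sub>R b) \<le> \<bar>s\<bar> * norm a + \<bar>t\<bar> * norm b"
      by (metis norm_scaleR norm_triangle_ineq)
    also have "\<dots> \<le> R * norm a + R * norm b"
      using that by (intro add_mono mult_right_mono) auto
    also have "\<dots> < R * (norm a + norm b + 1)" using R by (simp add: algebra_simps)
    also have "\<dots> = r"
    proof -
      have "norm a + norm b + 1 > 0" by (intro add_nonneg_pos) auto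
      then show ?thesis by (simp add: R_def)
    qed
    finally have "x + (s *\<^sub>R a + t *\<^sub>R b) \<in> ball x r"
      by (metis add_diff_cancel_left' dist_commute dist_norm mem_ball)
    then show ?thesis using r by (auto simp: add.assoc)
  qed
  \<comment> \<open>The mean value theorem is applied along \<open>c\<close> to a difference in the
    direction \<open>d\<close>, and then along \<open>d\<close> to the derivative. Both orders of
    \<open>a\<close> and \<open>b\<close> are inserted below.\<close>
  have key: "\<exists>s t. 0 < s \<and> s < h \<and> 0 < t \<and> t < h \<and>
      f (x + h *\<^sub>R c + h *\<^sub>R d) - f (x + h *\<^sub>R c) - f (x + h *\<^sub>R d) + f x = h * h * fc (x + s *\<^sub>R c + t *\<^sub>R d) d"
    if h: "0 < h" "h < R"
      and inU: "\<And>s t. \<bar>s\<bar> < R \<Longrightarrow> \<bar>t\<bar> < R \<Longrightarrow> x + s *\<^sub>R c + t *\<^sub>R d \<in> U"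
      and fc: "\<And>y. y \<in> U \<Longrightarrow> ((\<lambda>y. f' y c) has_derivative fc y) (at y)" for h c d fc
  proof -
    have d1: "((\<lambda>s. f (x + s *\<^sub>R c + t *\<^sub>R d)) has_field_derivative f' (x + s *\<^sub>R c + t *\<^sub>R d) c) (at s)"
      if "\<bar>s\<bar> < R" "\<bar>t\<bar> < R" for s t
      using has_vector_derivative_along_line[of f "f' (x + s *\<^sub>R c + t *\<^sub>R d)" "x + t *\<^sub>R d" s c] f'[OF inU[OF that]]
      by (simp add: has_real_derivative_iff_has_vector_derivative ac_simps)
    have d2: "((\<lambda>t. f' (x + s *\<^sub>R c + t *\<^sub>R d) c) has_field_derivative fc (x + s *\<^sub>R c + t *\<^sub>R d) d) (at t)"
      if "\<bar>s\<bar> < R" "\<bar>t\<bar> < R" for s t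
      using has_vector_derivative_along_line[of "\<lambda>y. f' y c" "fc (x + s *\<^sub>R c + t *\<^sub>R d)" "x + s *\<^sub>R c" t d] fc[OF inU[OF that]]
      by (simp add: has_real_derivative_iff_has_vector_derivative)
    have "\<exists>s. 0 < s \<and> s < h \<and>
       (f (x + h *\<^sub>R c + h *\<^sub>R d) - f (x + h *\<^sub>R c + 0 *\<^sub>R d)) - (f (x + 0 *\<^sub>R c + h *\<^sub>R d) - f (x + 0 *\<^sub>R c + 0 *\<^sub>R d))
       = (h - 0) * (f' (x + s *\<^sub>R c + h *\<^sub>R d) c - f' (x + s *\<^sub>R c + 0 *\<^sub>R d) c)"
      using h by (intro MVT2[of 0 h "\<lambda>s. f (x + s *\<^sub>R c + h *\<^sub>R d) - f (x + s *\<^sub>R c + 0 *\<^sub>R d)"]) (auto intro!: DERIV_diff d1[of _ h] d1[of _ 0, simplified])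
    then obtain s where s: "0 < s" "s < h" and
      1: "(f (x + h *\<^sub>R c + h *\<^sub>R d) - f (x + h *\<^sub>R c)) - (f (x + h *\<^sub>R d) - f x)
       = h * (f' (x + s *\<^sub>R c + h *\<^sub>R d) c - f' (x + s *\<^sub>R c + 0 *\<^sub>R d) c)" by auto
    have "\<exists>t>0. t < h \<and> f' (x + s *\<^sub>R c + h *\<^sub>R d) c - f' (x + s *\<^sub>R c + 0 *\<^sub>R d) c = (h - 0) * fc (x + s *\<^sub>R c + t *\<^sub>R d) d"
      using h s by (intro MVT2[of 0 h "\<lambda>t. f' (x + s *\<^sub>R c + t *\<^sub>R d) c"] d2) auto
    then obtain t where "0 < t" "t < h"
      and 2: "f' (x + s *\<^sub>R c + h *\<^sub>R d) c - f' (x + s *\<^sub>R c + 0 *\<^sub>R d) c = h * fc (x + s *\<^sub>R c + t *\<^sub>R d) d" by auto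
    moreover have "f (x + h *\<^sub>R c + h *\<^sub>R d) - f (x + h *\<^sub>R c) - f (x + h *\<^sub>R d) + f x = h * h * fc (x + s *\<^sub>R c + t *\<^sub>R d) d"
      using 1 unfolding 2 by (simp only: mult.assoc)
    ultimately show ?thesis using s by blast
  qed
  define h where "h k = R / real (Suc (Suc k))" for k
  have h: "0 < h k" "h k < R" for k
    using R divide_strict_left_mono[of 1 "real (Suc (Suc k))" R] by (simp_all add: h_def)
  have h0: "h \<longlonglongrightarrow> 0"
    unfolding h_def by (rule LIMSEQ_Suc[OF LIMSEQ_Suc[OF lim_const_over_n]])
  have "\<forall>k. \<exists>s t s' t'. 0 < s \<and> s < h k \<and> 0 < t \<and> t < h k \<and> 0 < s' \<and> s' < h k \<and> 0 < t' \<and> t' < h k \<and>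
    fa (x + s *\<^sub>R a + t *\<^sub>R b) b = fb (x + s' *\<^sub>R a + t' *\<^sub>R b) a"
  proof
    fix k
    obtain s t where 1: "0 < s" "s < h k" "0 < t" "t < h k"
      "f (x + h k *\<^sub>R a + h k *\<^sub>R b) - f (x + h k *\<^sub>R a) - f (x + h k *\<^sub>R b) + f x = h k * h k * fa (x + s *\<^sub>R a + t *\<^sub>R b) b"
      using key[OF h inU f''a, of k] by blast
    have inU': "x + s *\<^sub>R b + t *\<^sub>R a \<in> U" if "\<bar>s\<bar> < R" "\<bar>t\<bar> < R" for s t
      using inU[OF that(2,1)] by (simp add: algebra_simps)
    obtain s' t' where 2: "0 < s'" "s' < h k" "0 < t'" "t' < h k"
      "f (x + h k *\<^sub>R b + h k *\<^sub>R a) - f (x + h k *\<^sub>R b) - f (x + h k *\<^sub>R a) + f x = h k * h k * fb (x + s' *\<^sub>R b + t' *\<^sub>R a) a"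
      using key[OF h inU' f''b, of k] by blast
    have e: "x + h k *\<^sub>R a + h k *\<^sub>R b = x + h k *\<^sub>R b + h k *\<^sub>R a" by simp
    have "h k * h k * fa (x + s *\<^sub>R a + t *\<^sub>R b) b = h k * h k * fb (x + s' *\<^sub>R b + t' *\<^sub>R a) a"
      using 1(5)[unfolded e] 2(5) by linarith
    then have "fa (x + s *\<^sub>R a + t *\<^sub>R b) b = fb (x + s' *\<^sub>R b + t' *\<^sub>R a) a" using h[of k] by simp
    also have "x + s' *\<^sub>R b + t' *\<^sub>R a = x + t' *\<^sub>R a + s' *\<^sub>R b" by simp
    finally show "\<exists>s t s' t'. 0 < s \<and> s < h k \<and> 0 < t \<and> t < h k \<and> 0 < s' \<and> s' < h k \<and> 0 < t' \<and> t' < h k \<and>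
       fa (x + s *\<^sub>R a + t *\<^sub>R b) b = fb (x + s' *\<^sub>R a + t' *\<^sub>R b) a"
      using 1 2 by blast
  qed
  then obtain s t s' t' where st: "\<And>k. 0 < s k \<and> s k < h k \<and> 0 < t k \<and> t k < h k \<and> 0 < s' k \<and> s' k < h k \<and> 0 < t' k \<and> t' k < h k \<and>
    fa (x + s k *\<^sub>R a + t k *\<^sub>R b) b = fb (x + s' k *\<^sub>R a + t' k *\<^sub>R b) a"
    unfolding choice_iff by blast
  have to0: "u \<longlonglongrightarrow> 0" if "\<And>k. 0 < u k \<and> u k < h k" for u
    by (rule tendsto_sandwich[OF _ _ tendsto_const h0]) (use that less_imp_le in \<open>auto intro!: always_eventually\<close>)
  have pt: "(\<lambda>k. x + u k *\<^sub>R a + w k *\<^sub>R b) \<longlonglongrightarrow> x" if "\<And>k. 0 < u k \<and> u k < h k" "\<And>k. 0 < w k \<and> w k < h k" for u w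
    using tendsto_add[OF tendsto_add[OF tendsto_const[of x] tendsto_scaleR[OF to0[of u] tendsto_const[of a]]] tendsto_scaleR[OF to0[of w] tendsto_const[of b]]] that by simp
  have "isCont (\<lambda>y. fa y b) x" "isCont (\<lambda>y. fb y a) x"
    using ca cb U by (auto simp: continuous_on_eq_continuous_at)
  note cont = this
  have "(\<lambda>k. fa (x + s k *\<^sub>R a + t k *\<^sub>R b) b) \<longlonglongrightarrow> fa x b"
    by (rule isCont_tendsto_compose[OF cont(1)]) (use st in \<open>auto intro!: pt\<close>)
  moreover have "(\<lambda>k. fb (x + s' k *\<^sub>R a + t' k *\<^sub>R b) a) \<longlonglongrightarrow> fb x a"
    by (rule isCont_tendsto_compose[OF cont(2)]) (use st in \<open>auto intro!: pt\<close>)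
  moreover have "(\<lambda>k. fa (x + s k *\<^sub>R a + t k *\<^sub>R b) b) = (\<lambda>k. fb (x + s' k *\<^sub>R a + t' k *\<^sub>R b) a)"
    using st by auto
  ultimately show ?thesis using LIMSEQ_unique by simp
qed

lemma symmetric_second_derivative:
  fixes f :: "'a::euclidean_space \<Rightarrow> 'b::euclidean_space"
  assumes U: "open U" "x \<in> U"
    and f': "\<And>y. y \<in> U \<Longrightarrow> (f has_derivative f' y) (at y)"
    and f''a: "\<And>y. y \<in> U \<Longrightarrow> ((\<lambda>y. f' y a) has_derivative fa y) (at y)"
    and f''b: "\<And>y. y \<in> U \<Longrightarrow> ((\<lambda>y. f' y b) has_derivative fb y) (at y)"
    and ca: "continuous_on U (\<lambda>y. fa y b)" and cb: "continuous_on U (\<lambda>y. fb y a)"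
  shows "fa x b = fb x a"
proof (rule euclidean_eqI)
  fix i :: 'b
  show "fa x b \<bullet> i = fb x a \<bullet> i"
    by (rule symmetric_second_derivative_real[where f = "\<lambda>y. f y \<bullet> i" and f' = "\<lambda>y v. f' y v \<bullet> i"
          and fa = "\<lambda>y v. fa y v \<bullet> i" and fb = "\<lambda>y v. fb y v \<bullet> i" and U = U])
       (use assms in \<open>auto intro!: has_derivative_inner_left continuous_intros\<close>)
qed

section \<open>Cutoff functions and smoothing kernels\<close>

text \<open>The truncated square is C^1, and this is enough for every cutoff and kernel below: a
  mollified map gets its second derivative from one derivative of the kernel and one of the
  map.\<close>

definition sqpos :: "real \<Rightarrow> real" where "sqpos s = (max 0 s)\<^sup>2"

lemma sqpos_deriv: "(sqpos has_field_derivative 2 * max 0 s) (at s)"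
proof -
  consider "s < 0" | "s = 0" | "s > 0" by linarith
  then show ?thesis
  proof cases
    case 1
    have "((\<lambda>_. 0) has_field_derivative 2 * max 0 s) (at s)" using 1 by simp
    then show ?thesis
      by (rule has_field_derivative_transform_within_open[of _ _ _ "{..<0}"]) (use 1 in \<open>auto simp: sqpos_def\<close>)
  next
    case 3
    have "((\<lambda>s. s\<^sup>2) has_field_derivative 2 * max 0 s) (at s)" using 3 by (auto intro!: derivative_eq_intros)
    then show ?thesis
      by (rule has_field_derivative_transform_within_open[of _ _ _ "{0<..}"]) (use 3 in \<open>auto simp: sqpos_def\<close>)
  next
    case 2
    have "((\<lambda>h. sqpos h / h) \<longlongrightarrow> 0) (at 0)"
    proof (rule Lim_null_comparison)
      show "((\<lambda>h::real. \<bar>h\<bar>) \<longlongrightarrow> 0) (at 0)" by (rule tendsto_eq_intros refl)+ simp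
      have "norm (sqpos h / h) \<le> \<bar>h\<bar>" for h
        by (cases "h > 0") (auto simp: sqpos_def power2_eq_square max_def)
      then show "\<forall>\<^sub>F h in at 0. norm (sqpos h / h) \<le> \<bar>h\<bar>" by simp
    qed
    then show ?thesis using 2 by (simp add: DERIV_def sqpos_def)
  qed
qed

lemma sqpos_simps [simp]: "s \<le> 0 \<Longrightarrow> sqpos s = 0" "0 \<le> sqpos s" "0 < sqpos s \<longleftrightarrow> 0 < s"
  by (auto simp: sqpos_def max_def)

text \<open>A C^1 step from 0 on the negative axis to 1 beyond \<open>s = 1\<close>: the inner
  truncated square flattens it at 0, the outer one at 1.\<close>

definition ramp :: "real \<Rightarrow> real" where "ramp s = 1 - sqpos (1 - sqpos s)"

lemma ramp_deriv: "(ramp has_field_derivative 4 * max 0 (1 - sqpos s) * max 0 s) (at s)"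
  unfolding ramp_def
  by (rule derivative_eq_intros DERIV_chain2[OF sqpos_deriv] sqpos_deriv refl)+ simp

lemma sqpos_cont [continuous_intros]: "continuous_on S f \<Longrightarrow> continuous_on S (\<lambda>x. sqpos (f x))"
  unfolding sqpos_def by (intro continuous_intros)

lemma sqpos_ge1: "1 \<le> s \<Longrightarrow> 1 \<le> sqpos s"
  by (simp add: sqpos_def power2_eq_square) (metis mult_mono' mult_1 zero_le_one)

lemma sqpos_le1: "s \<le> 1 \<Longrightarrow> sqpos s \<le> 1"
  by (simp add: sqpos_def power_le_one)

lemma ramp_simps [simp]: "s \<le> 0 \<Longrightarrow> ramp s = 0" "1 \<le> s \<Longrightarrow> ramp s = 1"
  using sqpos_ge1[of s] by (auto simp: ramp_def sqpos_def)

lemma ramp_bounds: "0 \<le> ramp s" "ramp s \<le> 1"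
  using sqpos_le1[of "1 - sqpos s"] by (auto simp: ramp_def)

definition bump :: "'a::euclidean_space \<Rightarrow> real \<Rightarrow> 'a \<Rightarrow> real" where
  "bump a r y = sqpos (r\<^sup>2 - (y - a) \<bullet> (y - a))"

definition dbump :: "'a::euclidean_space \<Rightarrow> real \<Rightarrow> 'a \<Rightarrow> 'a" where
  "dbump a r y = (- 4 * max 0 (r\<^sup>2 - (y - a) \<bullet> (y - a))) *\<^sub>R (y - a)"

lemma bump_deriv: "(bump a r has_derivative (\<lambda>v. dbump a r y \<bullet> v)) (at y)"
proof -
  have "((\<lambda>y. r\<^sup>2 - (y - a) \<bullet> (y - a)) has_derivative (\<lambda>v. - 2 * ((y - a) \<bullet> v))) (at y)"
    by (rule derivative_eq_intros refl)+ (simp add: inner_commute)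
  from has_derivative_compose[OF this sqpos_deriv[THEN has_field_derivative_imp_has_derivative]]
  show ?thesis by (simp add: bump_def[abs_def] dbump_def algebra_simps)
qed

lemma bump_cont [continuous_intros]: "continuous_on S f \<Longrightarrow> continuous_on S (\<lambda>x. bump a r (f x))"
  unfolding bump_def by (intro continuous_intros)

lemma dbump_cont [continuous_intros]: "continuous_on S f \<Longrightarrow> continuous_on S (\<lambda>x. dbump a r (f x))"
  unfolding dbump_def by (intro continuous_intros)

lemma bump_pos: "0 < r \<Longrightarrow> 0 < bump a r y \<longleftrightarrow> y \<in> ball a r"
proof -
  assume r: "0 < r"
  have "0 < bump a r y \<longleftrightarrow> norm (y - a) ^ 2 < r ^ 2" by (simp add: bump_def power2_norm_eq_inner)
  also have "\<dots> \<longleftrightarrow> norm (y - a) < r" using r power2_less_imp_less[of "norm (y - a)" r] power_strict_mono[of "norm (y - a)" r 2] by auto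
  finally show ?thesis by (simp add: dist_norm norm_minus_commute)
qed

lemma bump_nonneg [simp]: "0 \<le> bump a r y" by (simp add: bump_def)

lemma bump_zero: "0 < r \<Longrightarrow> y \<notin> ball a r \<Longrightarrow> bump a r y = 0"
  using bump_pos[of r a y] bump_nonneg[of a r y] by linarith

text \<open>A finite sum \<open>b\<close> of bumps covering \<open>C\<close> is bounded below by
  some \<open>m > 0\<close> on \<open>C\<close>, and \<open>1 - sqpos (1 - b y / m)\<close> is 1
  where \<open>b\<close> is at least \<open>m\<close> and 0 where \<open>b\<close> vanishes. The
  zero gradient on \<open>C\<close> ensures that multiplication by the cutoff alters no derivative
  there.\<close>

lemma exists_cutoff:
  fixes C :: "'a::euclidean_space set"
  assumes "compact C" "open U" "C \<subseteq> U"
  obtains ct :: "'a \<Rightarrow> real" and g C' where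
    "\<And>y. (ct has_derivative (\<lambda>v. g y \<bullet> v)) (at y)" "continuous_on UNIV g"
    "\<And>y. y \<in> C \<Longrightarrow> ct y = 1" "\<And>y. y \<in> C \<Longrightarrow> g y = 0"
    "compact C'" "C' \<subseteq> U" "\<And>y. y \<notin> C' \<Longrightarrow> ct y = 0"
proof -
  have "\<forall>p\<in>C. \<exists>r>0. cball p r \<subseteq> U" using assms open_contains_cball by blast
  then obtain r where r: "\<And>p. p \<in> C \<Longrightarrow> 0 < r p \<and> cball p (r p) \<subseteq> U" by metis
  have "C \<subseteq> (\<Union>p\<in>C. ball p (r p))" using r by force
  then obtain D where D: "D \<subseteq> C" "finite D" "C \<subseteq> (\<Union>p\<in>D. ball p (r p))"
    using compactE_image[OF assms(1), of C "\<lambda>p. ball p (r p)"] by (metis open_ball)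
  define b where "b y = (\<Sum>p\<in>D. bump p (r p) y)" for y
  define db where "db y = (\<Sum>p\<in>D. dbump p (r p) y)" for y
  have b: "(b has_derivative (\<lambda>v. db y \<bullet> v)) (at y)" for y
    unfolding b_def[abs_def] db_def inner_sum_left by (intro has_derivative_sum bump_deriv)
  have bpos: "0 < b y" if "y \<in> C" for y
  proof -
    have "y \<in> (\<Union>p\<in>D. ball p (r p))" using D(3) that by (rule subsetD)
    then obtain p where p: "p \<in> D" "y \<in> ball p (r p)" by blast
    then have "0 < bump p (r p) y" using r D bump_pos by blast
    then show ?thesis unfolding b_def using p D by (intro sum_pos2[of _ p]) auto
  qed
  have bcont: "continuous_on S b" for S unfolding b_def[abs_def] by (intro continuous_intros)
  have dbcont: "continuous_on S db" for S unfolding db_def[abs_def] by (intro continuous_intros)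
  obtain m where m: "0 < m" "\<And>y. y \<in> C \<Longrightarrow> m \<le> b y"
  proof (cases "C = {}")
    case False
    then obtain y where "y \<in> C" "\<forall>z\<in>C. b y \<le> b z" using continuous_attains_inf[OF assms(1) _ bcont] by blast
    then show ?thesis using that bpos by blast
  qed (use that[of 1] in auto)
  show ?thesis
  proof (rule that)
    show "((\<lambda>y. 1 - sqpos (1 - b y / m)) has_derivative (\<lambda>v. ((2 * max 0 (1 - b y / m) / m) *\<^sub>R db y) \<bullet> v)) (at y)" for y
    proof -
      have "((\<lambda>y. 1 - b y / m) has_derivative (\<lambda>v. - (db y \<bullet> v) / m)) (at y)"
        using m(1) by (auto intro!: derivative_eq_intros b)
      from has_derivative_compose[OF this sqpos_deriv[THEN has_field_derivative_imp_has_derivative]]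
      have "((\<lambda>y. sqpos (1 - b y / m)) has_derivative (\<lambda>v. 2 * max 0 (1 - b y / m) * (- (db y \<bullet> v) / m))) (at y)" .
      from has_derivative_diff[OF has_derivative_const[of 1] this]
      show ?thesis by (simp add: field_simps)
    qed
    show "continuous_on UNIV (\<lambda>y. (2 * max 0 (1 - b y / m) / m) *\<^sub>R db y)"
      using m(1) by (auto intro!: continuous_intros bcont dbcont)
    show "1 - sqpos (1 - b y / m) = 1" if "y \<in> C" for y
      using m(1) m(2)[OF that] by simp
    show "(2 * max 0 (1 - b y / m) / m) *\<^sub>R db y = 0" if "y \<in> C" for y
      using m(1) m(2)[OF that] by (simp add: max_def)
    show "compact (\<Union>p\<in>D. cball p (r p))" using D by (intro compact_UN) auto
    show "(\<Union>p\<in>D. cball p (r p)) \<subseteq> U" using D r by blast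
    show "1 - sqpos (1 - b y / m) = 0" if "y \<notin> (\<Union>p\<in>D. cball p (r p))" for y
    proof -
      have "bump p (r p) y = 0" if "p \<in> D" for p
      proof -
        have "y \<notin> ball p (r p)" using that \<open>y \<notin> _\<close> by auto
        moreover have "0 < r p" using r D(1) that by blast
        ultimately show ?thesis by (intro bump_zero)
      qed
      then have "b y = 0" by (simp add: b_def)
      then show ?thesis by (simp add: sqpos_def)
    qed
  qed
qed

text \<open>The derivative falls on the kernel, so continuity of \<open>w\<close> is enough. Compact
  support of \<open>w\<close> turns the integral into one over a box, where differentiation under
  the integral sign applies.\<close>

lemma kernel_convolution_deriv:
  fixes w :: "'a::euclidean_space \<Rightarrow> 'b::euclidean_space"
  assumes w: "continuous_on UNIV w" and W: "compact W" "\<And>s. s \<notin> W \<Longrightarrow> w s = 0"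
    and \<psi>: "\<And>x. (\<psi> has_derivative (\<lambda>v. g x \<bullet> v)) (at x)" and g: "continuous_on UNIV g"
  shows "((\<lambda>y. \<integral>s. \<psi> (s - y) *\<^sub>R w s \<partial>lborel) has_derivative
           (\<lambda>v. - (\<integral>s. (g (s - y) \<bullet> v) *\<^sub>R w s \<partial>lborel))) (at y)"
    and "continuous_on UNIV (\<lambda>y. \<integral>s. (g (s - y) \<bullet> v) *\<^sub>R w s \<partial>lborel)"
proof -
  obtain a b where ab: "W \<subseteq> cbox a b" using W(1) by (meson bounded_subset_cbox_symmetric compact_imp_bounded)
  have c\<psi>: "continuous_on S \<psi>" for S
    by (meson \<psi> continuous_at_imp_continuous_on has_derivative_continuous)
  have cg: "continuous_on S (\<lambda>x. g (f x))" if "continuous_on S f" for S and f :: "'c::topological_space \<Rightarrow> 'a"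
    using continuous_on_compose2[OF g that] by simp
  have cp: "continuous_on S (\<lambda>x. \<psi> (f x))" if "continuous_on S f" for S and f :: "'c::topological_space \<Rightarrow> 'a"
    using continuous_on_compose2[OF c\<psi>[of UNIV] that] by simp
  have cw: "continuous_on S (\<lambda>x. w (f x))" if "continuous_on S f" for S and f :: "'c::topological_space \<Rightarrow> 'a"
    using continuous_on_compose2[OF w that] by simp
  have leb: "(\<integral>s. h s *\<^sub>R w s \<partial>lborel) = integral (cbox a b) (\<lambda>s. h s *\<^sub>R w s)"
    if "continuous_on UNIV h" for h
  proof -
    have "continuous_on UNIV (\<lambda>s. h s *\<^sub>R w s)" using that w by (intro continuous_intros)
    moreover have "s \<notin> W \<Longrightarrow> h s *\<^sub>R w s = 0" for s using W(2) by simp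
    ultimately have "(\<integral>s. h s *\<^sub>R w s \<partial>lborel) = integral UNIV (\<lambda>s. h s *\<^sub>R w s)"
      using continuous_compact_support(3)[OF _ W(1)] by blast
    also have "\<dots> = integral (cbox a b) (\<lambda>s. h s *\<^sub>R w s)"
      by (rule integral_spike_set[symmetric, of _ _ ]) (use ab W(2) in \<open>auto intro!: negligible_subset[OF negligible_empty]\<close>)
    finally show ?thesis .
  qed
  \<comment> \<open>The Leibniz rule asks for the partial derivative as a continuous map into the
    bounded linear maps; continuity is checked on basis vectors.\<close>
  define fx where "fx y s = Blinfun (\<lambda>v. - ((g (s - y) \<bullet> v) *\<^sub>R w s))" for y s
  have fx: "blinfun_apply (fx y s) = (\<lambda>v. - ((g (s - y) \<bullet> v) *\<^sub>R w s))" for y s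
    unfolding fx_def by (rule bounded_linear_Blinfun_apply) (auto intro!: bounded_linear_minus bounded_linear_scaleR_const bounded_linear_inner_right)
  have cfx: "continuous_on UNIV (\<lambda>(y, s). fx y s)"
    unfolding continuous_on_eq_continuous_within case_prod_unfold
  proof (intro ballI continuous_blinfun_componentwiseI1)
    fix p :: "'a \<times> 'a" and i :: 'a
    have "continuous_on UNIV (\<lambda>p. blinfun_apply (fx (fst p) (snd p)) i)"
      unfolding fx by (intro continuous_intros cg cw)
    then show "continuous (at p) (\<lambda>p. blinfun_apply (fx (fst p) (snd p)) i)"
      by (cases p) (simp add: continuous_on_eq_continuous_at)
  qed
  have "((\<lambda>y. integral (cbox a b) (\<lambda>s. \<psi> (s - y) *\<^sub>R w s)) has_derivative integral (cbox a b) (fx y)) (at y within UNIV)"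
  proof (rule leibniz_rule)
    fix x t
    have "((\<lambda>x. \<psi> (t - x)) has_derivative (\<lambda>v. g (t - x) \<bullet> (- v))) (at x)"
      by (rule has_derivative_compose[OF _ \<psi>]) (auto intro!: derivative_eq_intros)
    then show "((\<lambda>x. \<psi> (t - x) *\<^sub>R w t) has_derivative blinfun_apply (fx x t)) (at x within UNIV)"
      unfolding fx by (auto intro!: derivative_eq_intros)
    show "(\<lambda>s. \<psi> (s - x) *\<^sub>R w s) integrable_on cbox a b"
      by (intro integrable_continuous continuous_intros cp cw)
  qed (use cfx in \<open>auto intro: continuous_on_subset\<close>)
  moreover have "blinfun_apply (integral (cbox a b) (fx y)) = (\<lambda>v. - (\<integral>s. (g (s - y) \<bullet> v) *\<^sub>R w s \<partial>lborel))"
  proof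
    fix v
    have "continuous_on (cbox a b) (fx y)"
      using continuous_on_compose2[OF cfx, of "cbox a b" "\<lambda>s. (y, s)"] by (simp add: continuous_on_Pair)
    then have "blinfun_apply (integral (cbox a b) (fx y)) v = integral (cbox a b) (\<lambda>s. blinfun_apply (fx y s) v)"
      by (intro blinfun_apply_integral integrable_continuous)
    then show "blinfun_apply (integral (cbox a b) (fx y)) v = - (\<integral>s. (g (s - y) \<bullet> v) *\<^sub>R w s \<partial>lborel)"
      unfolding fx by (subst leb) (auto intro!: continuous_intros cg)
  qed
  moreover have "(\<integral>s. \<psi> (s - y) *\<^sub>R w s \<partial>lborel) = integral (cbox a b) (\<lambda>s. \<psi> (s - y) *\<^sub>R w s)" for y
    by (intro leb continuous_intros cp)
  ultimately show "((\<lambda>y. \<integral>s. \<psi> (s - y) *\<^sub>R w s \<partial>lborel) has_derivative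
           (\<lambda>v. - (\<integral>s. (g (s - y) \<bullet> v) *\<^sub>R w s \<partial>lborel))) (at y)"
    by simp
  have "continuous_on UNIV (\<lambda>y. integral (cbox a b) (\<lambda>s. (g (s - y) \<bullet> v) *\<^sub>R w s))"
    by (rule integral_continuous_on_param) (auto simp: case_prod_unfold intro!: continuous_intros cg cw)
  moreover have "(\<integral>s. (g (s - y) \<bullet> v) *\<^sub>R w s \<partial>lborel) = integral (cbox a b) (\<lambda>s. (g (s - y) \<bullet> v) *\<^sub>R w s)" for y
    by (intro leb continuous_intros cg)
  ultimately show "continuous_on UNIV (\<lambda>y. \<integral>s. (g (s - y) \<bullet> v) *\<^sub>R w s \<partial>lborel)" by simp
qed

section \<open>Variation of the volume form\<close>

lemma derivative_zero_off_support:
  assumes "(G has_derivative G') (at y)" "closed C" "\<And>y. y \<notin> C \<Longrightarrow> G y = 0" "y \<notin> C"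
  shows "G' v = 0"
proof -
  have "(G has_derivative (\<lambda>_. 0)) (at y)"
    by (rule has_derivative_transform_within_open[OF has_derivative_const, of "- C" y 0])
      (use assms in \<open>auto simp: open_Compl\<close>)
  then show ?thesis using assms(1) has_derivative_unique by metis
qed

text \<open>On \<open>U\<close> the product rule applies, off \<open>C\<close> the function is
  locally zero, and the two open sets cover the space. The vanishing is required of the product,
  since sometimes the cutoff and sometimes the map is the factor that vanishes.\<close>

lemma cutoff_extension:
  fixes z :: "'a::euclidean_space \<Rightarrow> 'b::euclidean_space" and ct :: "'a \<Rightarrow> real"
  assumes U: "open U" and z: "\<And>y. y \<in> U \<Longrightarrow> (z has_derivative z' y) (at y)"
    and cz': "\<And>v. continuous_on U (\<lambda>y. z' y v)"
    and ct: "\<And>y. (ct has_derivative ct' y) (at y)" and cct': "\<And>v. continuous_on UNIV (\<lambda>y. ct' y v)"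
    and C: "closed C" "C \<subseteq> U" and zero: "\<And>y. y \<in> U \<Longrightarrow> y \<notin> C \<Longrightarrow> ct y *\<^sub>R z y = 0"
  shows "((\<lambda>y. if y \<in> U then ct y *\<^sub>R z y else 0) has_derivative
           (\<lambda>v. if y \<in> U then ct y *\<^sub>R z' y v + ct' y v *\<^sub>R z y else 0)) (at y)"
    and "continuous_on UNIV (\<lambda>y. if y \<in> U then ct y *\<^sub>R z' y v + ct' y v *\<^sub>R z y else 0)"
proof -
  define w where "w y = (if y \<in> U then ct y *\<^sub>R z y else 0)" for y
  define w' where "w' y v = (if y \<in> U then ct y *\<^sub>R z' y v + ct' y v *\<^sub>R z y else 0)" for y v
  have cct: "continuous_on S ct" for S using ct by (meson continuous_at_imp_continuous_on has_derivative_continuous)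
  have cz: "continuous_on U z"
    using z by (meson continuous_at_imp_continuous_on has_derivative_continuous)
  have w0: "w y = 0" if "y \<notin> C" for y
    using zero that by (auto simp: w_def)
  have op: "open (- C)" using C(1) by (simp add: open_Compl)
  have dU: "(w has_derivative w' y) (at y)" if y: "y \<in> U" for y
  proof -
    have "((\<lambda>y. ct y *\<^sub>R z y) has_derivative w' y) (at y)"
      using has_derivative_scaleR[OF ct z[OF y]] y by (simp add: w'_def[abs_def])
    then show ?thesis
      by (rule has_derivative_transform_within_open[OF _ U y]) (simp add: w_def)
  qed
  have w'0: "w' y v = 0" if "y \<notin> C" for y v
  proof (cases "y \<in> U")
    case True
    show ?thesis by (rule derivative_zero_off_support[OF dU[OF True] C(1) w0 that])
  qed (simp add: w'_def)
  show "((\<lambda>y. if y \<in> U then ct y *\<^sub>R z y else 0) has_derivative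
           (\<lambda>v. if y \<in> U then ct y *\<^sub>R z' y v + ct' y v *\<^sub>R z y else 0)) (at y)"
    unfolding w_def[symmetric] w'_def[symmetric]
  proof (cases "y \<in> U")
    case True
    then show "(w has_derivative w' y) (at y)" by (rule dU)
  next
    case False
    then have y: "y \<in> - C" using C(2) by blast
    have "w' y = (\<lambda>_. 0)" using w'0 y by auto
    then show "(w has_derivative w' y) (at y)"
      using has_derivative_transform_within_open[OF has_derivative_const op y, of 0 w] w0 by auto
  qed
  have "continuous_on U (\<lambda>y. w' y v) \<longleftrightarrow> continuous_on U (\<lambda>y. ct y *\<^sub>R z' y v + ct' y v *\<^sub>R z y)"
    by (rule continuous_on_cong) (auto simp: w'_def)
  moreover have "continuous_on U (\<lambda>y. ct y *\<^sub>R z' y v + ct' y v *\<^sub>R z y)"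
    by (intro continuous_intros cct cz cz' continuous_on_subset[OF cct']) auto
  moreover have "continuous_on (- C) (\<lambda>y. w' y v) \<longleftrightarrow> continuous_on (- C) (\<lambda>y. 0 :: 'b)"
    by (rule continuous_on_cong) (auto simp: w'0)
  ultimately have "continuous_on (U \<union> - C) (\<lambda>y. w' y v)"
    by (intro continuous_on_open_Un U op) auto
  moreover have "U \<union> - C = UNIV" using C(2) by blast
  ultimately show "continuous_on UNIV (\<lambda>y. if y \<in> U then ct y *\<^sub>R z' y v + ct' y v *\<^sub>R z y else 0)"
    by (simp add: w'_def)
qed

lemma tendsto_vol:
  assumes "bij e" "(v \<longlongrightarrow> v0) F" "\<And>i. ((\<lambda>k. u k i) \<longlongrightarrow> u0 i) F"
  shows "((\<lambda>k. vol e (v k) (u k)) \<longlongrightarrow> vol e v0 u0) F"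
  unfolding vol_def det_def vec_lambda_beta
proof (intro tendsto_sum tendsto_mult tendsto_const tendsto_prod)
  fix p :: "'b \<Rightarrow> 'b" and a
  show "((\<lambda>k. (case inv e a of None \<Rightarrow> v k | Some i \<Rightarrow> u k i) $ p a)
     \<longlongrightarrow> (case inv e a of None \<Rightarrow> v0 | Some i \<Rightarrow> u0 i) $ p a) F"
    using assms by (cases "inv e a") (auto intro!: tendsto_vec_nth)
qed

lemma tendsto_dvol:
  assumes "bij e" "(v \<longlongrightarrow> v0) F" "\<And>i. ((\<lambda>k. u k i) \<longlongrightarrow> u0 i) F"
  shows "((\<lambda>k. dvol e (v k) (u k) w) \<longlongrightarrow> dvol e v0 u0 w) F"
  unfolding dvol_def
proof (intro tendsto_sum tendsto_vol assms(1,2))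
  fix i j
  show "((\<lambda>k. ((u k)(i := w i)) j) \<longlongrightarrow> (u0(i := w i)) j) F"
    using assms(3) by (cases "j = i") auto
qed

section \<open>Mollification with a C^1 kernel of integral one\<close>

definition moll :: "real \<Rightarrow> 'a::euclidean_space \<Rightarrow> real" where
  "moll r y = bump 0 r y / (\<integral>s. bump (0::'a) r s \<partial>lborel)"

lemma bump_integrable: "0 < r \<Longrightarrow> integrable lborel (bump a r)"
  by (rule continuous_compact_support(1)[where C = "cball a r"])
     (auto intro!: bump_cont continuous_on_id bump_zero)

lemma bump_integral_pos:
  assumes "0 < r" shows "0 < (\<integral>s. bump (0::'a::euclidean_space) r s \<partial>lborel)"
proof -
  have "0 \<le> (\<integral>s. bump (0::'a) r s \<partial>lborel)" by simp
  moreover have "(\<integral>s. bump (0::'a) r s \<partial>lborel) \<noteq> 0"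
  proof
    assume "(\<integral>s. bump (0::'a) r s \<partial>lborel) = 0"
    then have "AE s in lborel. bump (0::'a) r s = 0"
      using integral_nonneg_eq_0_iff_AE[OF bump_integrable[OF assms, of 0]] by auto
    then have "AE s in lborel. s \<notin> ball (0::'a) r"
      by eventually_elim (use bump_pos[OF assms, of 0] in \<open>metis less_irrefl\<close>)
    then have "ball (0::'a) r \<in> null_sets lborel"
      by (subst AE_iff_null_sets) auto
    then have "measure lborel (ball (0::'a) r) = 0" by (auto simp: measure_def null_sets_def)
    then show False using content_ball_pos[OF assms, of 0] by simp
  qed
  ultimately show ?thesis by linarith
qed

lemma moll_deriv:
  fixes y :: "'a::euclidean_space"
  shows
  "(moll r has_derivative (\<lambda>v. (dbump 0 r y /\<^sub>R (\<integral>s. bump (0::'a::euclidean_space) r s \<partial>lborel)) \<bullet> v)) (at y)"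
  unfolding moll_def[abs_def]
  using has_derivative_mult_right[OF bump_deriv[of "0::'a" r y], of "inverse (\<integral>s. bump (0::'a) r s \<partial>lborel)"]
  by (simp add: divide_inverse mult.commute)

lemma moll_cont: "continuous_on S f \<Longrightarrow> continuous_on S (\<lambda>x. moll r (f x))"
  unfolding moll_def divide_inverse by (intro continuous_intros)

lemma translation_integral:
  fixes f :: "'a::euclidean_space \<Rightarrow> 'b::euclidean_space"
  assumes "integrable lborel f"
  shows "integrable lborel (\<lambda>s. f (s - y))" "(\<integral>s. f (s - y) \<partial>lborel) = (\<integral>s. f s \<partial>lborel)"
proof -
  have [measurable]: "f \<in> borel_measurable borel" using assms by (auto dest: borel_measurable_integrable)
  have "integrable (distr lborel borel ((+) (- y))) f" using assms by (simp add: lborel_distr_plus)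
  then have "integrable lborel (\<lambda>s. f (- y + s))" by (subst (asm) integrable_distr_eq) auto
  then show "integrable lborel (\<lambda>s. f (s - y))" by simp
  have "integral\<^sup>L (distr lborel borel ((+) (- y))) f = (\<integral>s. f (- y + s) \<partial>lborel)"
    by (subst integral_distr) (use assms in auto)
  then show "(\<integral>s. f (s - y) \<partial>lborel) = (\<integral>s. f s \<partial>lborel)" by (simp add: lborel_distr_plus)
qed

lemma moll_facts:
  fixes y :: "'a::euclidean_space"
  assumes "0 < r"
  shows "0 \<le> moll r y" "y \<notin> ball 0 r \<Longrightarrow> moll r y = 0"
    "integrable lborel (\<lambda>s. moll r (s - y))" "(\<integral>s. moll r (s - y) \<partial>lborel) = 1"
proof -
  note pos = bump_integral_pos[OF assms, where 'a='a]
  show "0 \<le> moll r y" "y \<notin> ball 0 r \<Longrightarrow> moll r y = 0"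
    using pos bump_zero[OF assms, of y 0] by (auto simp: moll_def)
  have i: "integrable lborel (moll r :: 'a \<Rightarrow> real)"
    unfolding moll_def[abs_def] using bump_integrable[OF assms] by auto
  show "integrable lborel (\<lambda>s. moll r (s - y))" by (rule translation_integral(1)[OF i])
  have "(\<integral>s. moll r (s - y) \<partial>lborel) = (\<integral>s. moll r (s::'a) \<partial>lborel)" by (rule translation_integral(2)[OF i])
  also have "\<dots> = 1" unfolding moll_def using pos by simp
  finally show "(\<integral>s. moll r (s - y) \<partial>lborel) = 1" .
qed

text \<open>The kernel is nonnegative with integral one and supported in the ball of radius
  \<open>r\<close>, so this is an average. The choice \<open>c = w y\<close> gives convergence, the
  choice \<open>c = 0\<close> a bound that is uniform in \<open>r\<close>.\<close>

lemma moll_approx: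
  fixes w :: "'a::euclidean_space \<Rightarrow> 'b::euclidean_space"
  assumes w: "continuous_on UNIV w" and W: "compact W" "\<And>s. s \<notin> W \<Longrightarrow> w s = 0"
    and r: "0 < r" and d: "\<And>s. s \<in> ball y r \<Longrightarrow> norm (w s - c) \<le> \<epsilon>"
  shows "norm ((\<integral>s. moll r (s - y) *\<^sub>R w s \<partial>lborel) - c) \<le> \<epsilon>"
proof -
  have i1: "integrable lborel (\<lambda>s. moll r (s - y) *\<^sub>R w s)"
    by (rule continuous_compact_support(1)[OF _ W(1)]) (auto intro!: continuous_intros moll_cont w simp: W(2))
  note m = moll_facts[OF r, where 'a='a]
  have i2: "integrable lborel (\<lambda>s. moll r (s - y) *\<^sub>R c)" by (rule integrable_scaleR_left[OF m(3)])
  have "(\<integral>s. moll r (s - y) *\<^sub>R w s \<partial>lborel) - c = (\<integral>s. moll r (s - y) *\<^sub>R w s \<partial>lborel) - (\<integral>s. moll r (s - y) *\<^sub>R c \<partial>lborel)"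
    by (simp only: integral_scaleR_left[OF m(3)] m(4) scaleR_one)
  also have "\<dots> = (\<integral>s. moll r (s - y) *\<^sub>R (w s - c) \<partial>lborel)"
    using i1 i2 by (simp add: scaleR_diff_right)
  also have "norm \<dots> \<le> (\<integral>s. moll r (s - y) * \<epsilon> \<partial>lborel)"
  proof (rule order_trans[OF integral_norm_bound integral_mono])
    show "integrable lborel (\<lambda>s. norm (moll r (s - y) *\<^sub>R (w s - c)))"
      unfolding scaleR_diff_right by (intro integrable_norm Bochner_Integration.integrable_diff i1 i2)
    show "integrable lborel (\<lambda>s. moll r (s - y) * \<epsilon>)" using m(3) by simp
    fix s
    show "norm (moll r (s - y) *\<^sub>R (w s - c)) \<le> moll r (s - y) * \<epsilon>"
    proof (cases "s \<in> ball y r")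
      case True then show ?thesis using d m(1)[of "s - y"] by (auto intro!: mult_left_mono)
    next
      case False
      then have "s - y \<notin> ball 0 r" by (simp add: dist_norm norm_minus_commute)
      then show ?thesis using m(2) by simp
    qed
  qed
  also have "\<dots> = \<epsilon>" using m(3,4) by simp
  finally show ?thesis .
qed

lemma moll_tendsto:
  fixes w :: "'a::euclidean_space \<Rightarrow> 'b::euclidean_space"
  assumes w: "continuous_on UNIV w" and W: "compact W" "\<And>s. s \<notin> W \<Longrightarrow> w s = 0"
  shows "(\<lambda>k. \<integral>s. moll (inverse (real (Suc k))) (s - y) *\<^sub>R w s \<partial>lborel) \<longlonglongrightarrow> w y"
proof (rule LIMSEQ_I)
  fix e :: real assume "0 < e"
  have "isCont w y" using w by (simp add: continuous_on_eq_continuous_at)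
  then obtain d where d: "d > 0" "\<And>s. dist s y < d \<Longrightarrow> dist (w s) (w y) < e / 2"
    using \<open>0 < e\<close> unfolding continuous_at_eps_delta by (metis half_gt_zero)
  obtain N where N: "inverse (real (Suc N)) < d" using reals_Archimedean[OF d(1)] by blast
  show "\<exists>no. \<forall>k\<ge>no. norm ((\<integral>s. moll (inverse (real (Suc k))) (s - y) *\<^sub>R w s \<partial>lborel) - w y) < e"
  proof (intro exI allI impI)
    fix k assume "N \<le> k"
    then have "inverse (real (Suc k)) < d"
      using N by (meson le_less_trans le_imp_inverse_le of_nat_0_less_iff of_nat_mono Suc_le_mono zero_less_Suc)
    then have "norm (w s - w y) \<le> e / 2" if "s \<in> ball y (inverse (real (Suc k)))" for s
      using d(2)[of s] that by (simp add: dist_norm norm_minus_commute)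
    then have "norm ((\<integral>s. moll (inverse (real (Suc k))) (s - y) *\<^sub>R w s \<partial>lborel) - w y) \<le> e / 2"
      by (intro moll_approx[OF w W]) auto
    then show "norm ((\<integral>s. moll (inverse (real (Suc k))) (s - y) *\<^sub>R w s \<partial>lborel) - w y) < e"
      using \<open>0 < e\<close> by simp
  qed
qed

section \<open>The divergence identity for maps of class C^2 and C^1\<close>

context
  fixes e :: "'n::finite option \<Rightarrow> 'm::finite"
  assumes e: "bij e"
begin

text \<open>The integrand is the sum of the derivatives of \<open>G i\<close> along the axes
  \<open>i\<close>, each of which integrates to zero. Derivatives falling on the other tangential
  places give second derivatives of \<open>z\<close>, and these terms cancel in pairs.\<close>

lemma volume_variation_C2:
  fixes z Y :: "real^'n \<Rightarrow> real^'m"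
  assumes z: "\<And>y. (z has_derivative z' y) (at y)"
    and z2: "\<And>j y. ((\<lambda>y. z' y (axis j 1)) has_derivative z'' j y) (at y)"
    and cz2: "\<And>j i. continuous_on UNIV (\<lambda>y. z'' j y (axis i 1))"
    and Y: "\<And>y. (Y has_derivative Y' y) (at y)" and cY: "\<And>v. continuous_on UNIV (\<lambda>y. Y' y v)"
    and C: "compact C" "\<And>y. y \<notin> C \<Longrightarrow> Y y = 0"
  shows "(\<integral>y. dvol e (z y) (\<lambda>i. z' y (axis i 1)) (\<lambda>i. Y' y (axis i 1))
     - real CARD('n) * vol e (Y y) (\<lambda>i. z' y (axis i 1)) \<partial>lborel) = 0"
proof -
  define u where "u y i = z' y (axis i 1)" for y i
  define G where "G i y = vol e (z y) ((u y)(i := Y y))" for i y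
  define G' where "G' i y v = vol e (z' y v) ((u y)(i := Y y)) +
     dvol e (z y) ((u y)(i := Y y)) (\<lambda>j. if j = i then Y' y v else z'' j y v)" for i y v
  have cz: "continuous_on UNIV z" and cYY: "continuous_on UNIV Y"
    using z Y by (meson continuous_at_imp_continuous_on has_derivative_continuous)+
  have cu: "continuous_on UNIV (\<lambda>y. u y i)" for i
    unfolding u_def using z2 by (meson continuous_at_imp_continuous_on has_derivative_continuous)
  have cupd: "continuous_on UNIV (\<lambda>y. ((u y)(i := Y y)) j)" for i j
    by (cases "j = i") (auto simp: cu cYY)
  have G: "(G i has_derivative G' i y) (at y)" for i y
    unfolding G_def[abs_def] G'_def[abs_def]
  proof (rule has_derivative_vol[OF e z])
    show "((\<lambda>y. ((u y)(i := Y y)) j) has_derivative (\<lambda>v. if j = i then Y' y v else z'' j y v)) (at y)" for j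
      by (cases "j = i") (auto simp: Y z2 u_def)
  qed
  have cG': "continuous_on UNIV (\<lambda>y. G' i y (axis i 1))" for i
    unfolding G'_def
  proof (intro e continuous_intros continuous_on_vol[OF e] continuous_on_dvol[OF e] cz cupd)
    show "continuous_on UNIV (\<lambda>y. z' y (axis i 1))" using cu by (simp add: u_def)
    show "continuous_on UNIV (\<lambda>y. if j = i then Y' y (axis i 1) else z'' j y (axis i 1))" for j
      by (cases "j = i") (auto simp: cY cz2)
  qed
  have u0: "vol e v ((w)(i := 0)) = 0" for v w i
    using linear_0[OF linear_vol_right[OF e]] .
  have G0: "G i y = 0" if "y \<notin> C" for i y
    using C(2)[OF that] by (simp add: G_def u0)
  have int0: "(\<integral>y. G' i y (axis i 1) \<partial>lborel) = 0" for i
    by (rule integral_directional_derivative_eq_0[OF G cG' C(1) G0])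
  have G'0: "G' i y v = 0" if "y \<notin> C" for i y v
    using derivative_zero_off_support[OF G compact_imp_closed[OF C(1)] G0 that] .
  have intG: "integrable lborel (\<lambda>y. G' i y (axis i 1))" for i
    by (rule continuous_compact_support(1)[OF cG' C(1) G'0])
  have sym: "z'' j y (axis i 1) = z'' i y (axis j 1)" for i j y
    by (rule symmetric_second_derivative[of UNIV y z z']) (use z z2 cz2 in auto)
  have "dvol e (z y) (u y) (\<lambda>i. Y' y (axis i 1)) - real CARD('n) * vol e (Y y) (u y) = (\<Sum>i\<in>UNIV. G' i y (axis i 1))" for y
  proof -
    \<comment> \<open>The term with \<open>Y\<close> in place \<open>i\<close> and the second
      derivative of \<open>z\<close> along \<open>i\<close> and \<open>j\<close> in place
      \<open>j\<close>. Exchanging the two places changes the sign while the second derivative is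
      symmetric, so the double sum is zero.\<close>
    define a where "a i j = (if i = j then 0 else vol e (z y) ((u y)(i := Y y, j := z'' j y (axis i 1))))" for i j
    have anti: "a i j = - a j i" for i j
    proof (cases "i = j")
      case False
      then have "a j i = vol e (z y) ((u y)(i := z'' i y (axis j 1), j := Y y))"
        by (simp add: a_def fun_upd_twist)
      also have "\<dots> = - vol e (z y) ((u y)(i := Y y, j := z'' i y (axis j 1)))"
        by (rule vol_swap_Some[OF e False])
      also have "\<dots> = - a i j" using False by (simp add: a_def sym)
      finally show ?thesis by simp
    qed (simp add: a_def)
    have "(\<Sum>i\<in>UNIV. \<Sum>j\<in>UNIV. a i j) = (\<Sum>i\<in>UNIV. \<Sum>j\<in>UNIV. - a j i)"
      by (intro sum.cong refl anti)
    also have "\<dots> = - (\<Sum>j\<in>UNIV. \<Sum>i\<in>UNIV. a j i)"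
      by (subst sum.swap) (simp add: sum_negf)
    finally have a0: "(\<Sum>i\<in>UNIV. \<Sum>j\<in>UNIV. a i j) = 0" by simp
    have d: "dvol e (z y) ((u y)(i := Y y)) (\<lambda>j. if j = i then Y' y (axis i 1) else z'' j y (axis i 1))
       = vol e (z y) ((u y)(i := Y' y (axis i 1))) + (\<Sum>j\<in>UNIV. a i j)" for i
    proof -
      have "vol e (z y) (((u y)(i := Y y))(j := if j = i then Y' y (axis i 1) else z'' j y (axis i 1)))
        = (if j = i then vol e (z y) ((u y)(i := Y' y (axis i 1))) else 0) + a i j" for j
        by (auto simp: a_def)
      then show ?thesis unfolding dvol_def by (simp add: sum.distrib)
    qed
    \<comment> \<open>Here the derivative meets the distinguished argument \<open>z\<close>. The sum
      of these terms over \<open>i\<close> is minus \<open>CARD('n)\<close> times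
      \<open>vol e (Y y) (u y)\<close>.\<close>
    have s: "vol e (z' y (axis i 1)) ((u y)(i := Y y)) = - vol e (Y y) (u y)" for i
      using vol_swap_None[OF e, of "u y" i "Y y"] by (simp add: u_def)
    have "(\<Sum>i\<in>UNIV. G' i y (axis i 1)) = - real CARD('n) * vol e (Y y) (u y)
        + (\<Sum>i\<in>UNIV. vol e (z y) ((u y)(i := Y' y (axis i 1)))) + (\<Sum>i\<in>UNIV. \<Sum>j\<in>UNIV. a i j)"
      unfolding G'_def d s by (simp only: sum.distrib sum_constant sum_negf)
    then show ?thesis using a0 by (simp add: dvol_def)
  qed
  then have "(\<integral>y. dvol e (z y) (u y) (\<lambda>i. Y' y (axis i 1)) - real CARD('n) * vol e (Y y) (u y) \<partial>lborel)
     = (\<Sum>i\<in>UNIV. \<integral>y. G' i y (axis i 1) \<partial>lborel)"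
    using intG by simp
  then show ?thesis by (simp add: int0 u_def[abs_def])
qed

text \<open>Mollifying \<open>z\<close> supplies the second derivatives that the identity for C^2
  maps asks for, while \<open>Y\<close> enters with first derivatives only. The integrated identity
  contains no second derivative and therefore survives the limit.\<close>

lemma volume_variation_C1:
  fixes z Y :: "real^'n \<Rightarrow> real^'m"
  assumes z: "\<And>y. (z has_derivative z' y) (at y)" and cz': "\<And>v. continuous_on UNIV (\<lambda>y. z' y v)"
    and W: "compact W" "\<And>y. y \<notin> W \<Longrightarrow> z y = 0"
    and Y: "\<And>y. (Y has_derivative Y' y) (at y)" and cY: "\<And>v. continuous_on UNIV (\<lambda>y. Y' y v)"
    and C: "compact C" "\<And>y. y \<notin> C \<Longrightarrow> Y y = 0"
  shows "(\<integral>y. dvol e (z y) (\<lambda>i. z' y (axis i 1)) (\<lambda>i. Y' y (axis i 1))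
     - real CARD('n) * vol e (Y y) (\<lambda>i. z' y (axis i 1)) \<partial>lborel) = 0"
proof -
  define r where "r k = inverse (real (Suc k))" for k
  have r: "0 < r k" for k by (simp add: r_def)
  define zk where "zk k y = (\<integral>s. moll (r k) (s - y) *\<^sub>R z s \<partial>lborel)" for k y
  define zk' where "zk' k y v = (\<integral>s. moll (r k) (s - y) *\<^sub>R z' s v \<partial>lborel)" for k y v
  have cz: "continuous_on UNIV z" and cYY: "continuous_on UNIV Y"
    using z Y by (meson continuous_at_imp_continuous_on has_derivative_continuous)+
  have z'0: "z' y v = 0" if "y \<notin> W" for y v
    using derivative_zero_off_support[OF z compact_imp_closed[OF W(1)] W(2) that] .
  have Y'0: "Y' y v = 0" if "y \<notin> C" for y v
    using derivative_zero_off_support[OF Y compact_imp_closed[OF C(1)] C(2) that] .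
  define g where "g k y = dbump 0 (r k) y /\<^sub>R (\<integral>s. bump (0::real^'n) (r k) s \<partial>lborel)" for k and y :: "real^'n"
  have mg: "(moll (r k) has_derivative (\<lambda>v. g k x \<bullet> v)) (at x)" for k x
    unfolding g_def by (rule moll_deriv)
  have cg: "continuous_on UNIV (g k)" for k unfolding g_def[abs_def] by (intro continuous_intros)
  \<comment> \<open>The derivative of the mollified map, computed on the kernel, is rewritten as the
    mollification of \<open>z'\<close>. In this form it converges to \<open>z'\<close> and can be
    differentiated once more, again on the kernel.\<close>
  have by_parts: "- (\<integral>s. (g k (s - y) \<bullet> v) *\<^sub>R z s \<partial>lborel) = zk' k y v" for k y v
  proof -
    let ?a = "\<lambda>s. (g k (s - y) \<bullet> v) *\<^sub>R z s" and ?b = "\<lambda>s. moll (r k) (s - y) *\<^sub>R z' s v"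
    have ca: "continuous_on UNIV ?a"
      by (intro continuous_intros cz continuous_on_compose2[OF cg[of k]]) auto
    have cb: "continuous_on UNIV ?b" by (intro continuous_intros cz' moll_cont)
    have D: "((\<lambda>s. moll (r k) (s - y) *\<^sub>R z s) has_derivative (\<lambda>v. moll (r k) (s - y) *\<^sub>R z' s v + (g k (s - y) \<bullet> v) *\<^sub>R z s)) (at s)" for s
    proof (rule has_derivative_scaleR[OF _ z])
      show "((\<lambda>s. moll (r k) (s - y)) has_derivative (\<lambda>v. g k (s - y) \<bullet> v)) (at s)"
        by (rule has_derivative_compose[OF _ mg, of "\<lambda>s. s - y" "\<lambda>v. v"]) (auto intro!: derivative_eq_intros)
    qed
    have "(\<integral>s. ?b s + ?a s \<partial>lborel) = 0"
      by (rule integral_directional_derivative_eq_0[OF D _ W(1)]) (auto simp: W(2) intro!: continuous_on_add ca cb)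
    moreover have "integrable lborel ?a" by (rule continuous_compact_support(1)[OF ca W(1)]) (simp add: W(2))
    moreover have "integrable lborel ?b" by (rule continuous_compact_support(1)[OF cb W(1)]) (simp add: z'0)
    ultimately have "integral\<^sup>L lborel ?b + integral\<^sup>L lborel ?a = 0" by simp
    then show ?thesis unfolding zk'_def neg_eq_iff_add_eq_0 by (simp only: add.commute)
  qed
  have d1: "(zk k has_derivative zk' k y) (at y)" for k y
  proof -
    have "(zk k has_derivative (\<lambda>v. - (\<integral>s. (g k (s - y) \<bullet> v) *\<^sub>R z s \<partial>lborel))) (at y)"
      unfolding zk_def[abs_def] by (rule kernel_convolution_deriv(1)[OF cz W mg cg])
    then show ?thesis by (simp only: by_parts)
  qed
  define zk2 where "zk2 k j y v = - (\<integral>s. (g k (s - y) \<bullet> v) *\<^sub>R z' s (axis j 1) \<partial>lborel)" for k j y v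
  have d2: "((\<lambda>y. zk' k y (axis j 1)) has_derivative zk2 k j y) (at y)" for k j y
    unfolding zk2_def[abs_def] zk'_def[abs_def] by (rule kernel_convolution_deriv(1)[OF cz' W(1) z'0 mg cg])
  have c2: "continuous_on UNIV (\<lambda>y. zk2 k j y v)" for k j v
    unfolding zk2_def by (intro continuous_on_minus kernel_convolution_deriv(2)[OF cz' W(1) z'0 mg cg])
  let ?T = "\<lambda>k y. dvol e (zk k y) (\<lambda>i. zk' k y (axis i 1)) (\<lambda>i. Y' y (axis i 1))
     - real CARD('n) * vol e (Y y) (\<lambda>i. zk' k y (axis i 1))"
  have eq0: "integral\<^sup>L lborel (?T k) = 0" for k
    by (rule volume_variation_C2[OF d1 d2 c2 Y cY C])
  obtain B0 where B0: "B0 > 0" "\<And>y. norm (z y) \<le> B0" using continuous_compact_support(2)[OF cz W] by blast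
  obtain B1 where B1: "B1 > 0" "\<And>y. norm (Y y) \<le> B1" using continuous_compact_support(2)[OF cYY C] by blast
  have "\<forall>i. \<exists>B>0. \<forall>y. norm (z' y (axis i 1)) \<le> B" using continuous_compact_support(2)[OF cz' W(1) z'0] by blast
  then obtain B2 where B2: "\<And>i. B2 i > 0" "\<And>i y. norm (z' y (axis i 1)) \<le> B2 i" by metis
  have "\<forall>i. \<exists>B>0. \<forall>y. norm (Y' y (axis i 1)) \<le> B" using continuous_compact_support(2)[OF cY C(1) Y'0] by blast
  then obtain B3 where B3: "\<And>i. B3 i > 0" "\<And>i y. norm (Y' y (axis i 1)) \<le> B3 i" by metis
  \<comment> \<open>One bound for all rows of all determinants involved, valid for every
    \<open>k\<close> because averages do not exceed a bound of the averaged function.\<close>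
  define B where "B = B0 + B1 + (\<Sum>i\<in>UNIV. B2 i) + (\<Sum>i\<in>UNIV. B3 i)"
  have s2: "B2 i \<le> (\<Sum>i\<in>UNIV. B2 i)" "B3 i \<le> (\<Sum>i\<in>UNIV. B3 i)" for i
    by (rule member_le_sum; simp add: B2(1) B3(1) less_imp_le)+
  have s0: "0 \<le> (\<Sum>i\<in>UNIV. B2 i)" "0 \<le> (\<Sum>i\<in>UNIV. B3 i)" by (rule sum_nonneg; simp add: B2(1) B3(1) less_imp_le)+
  have le: "B0 \<le> B" "B1 \<le> B" "B2 i \<le> B" "B3 i \<le> B" for i
    using B0(1) B1(1) s2[of i] s0 by (auto simp: B_def)
  have bk: "norm (zk k y) \<le> B" for k y
    using moll_approx[OF cz W r, of y k 0 B0] B0(2) le(1) by (auto simp: zk_def intro: order_trans)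
  have bk': "norm (zk' k y (axis i 1)) \<le> B" for k y i
    using moll_approx[OF cz' W(1) z'0 r, of y k "axis i 1" 0 "B2 i"] B2(2) le(3)[of i] by (auto simp: zk'_def intro: order_trans)
  define M where "M = real (card {p. p permutes (UNIV::'m set)}) * B ^ CARD('m)"
  have vb: "\<bar>vol e v w\<bar> \<le> M" if "norm v \<le> B" "\<And>i. norm (w i) \<le> B" for v :: "real^'m" and w
    unfolding M_def by (rule vol_bound[OF e that])
  have bT: "\<bar>?T k y\<bar> \<le> real CARD('n) * M + real CARD('n) * M" for k y
  proof -
    have "\<bar>dvol e (zk k y) (\<lambda>i. zk' k y (axis i 1)) (\<lambda>i. Y' y (axis i 1))\<bar> \<le> (\<Sum>i\<in>(UNIV::'n set). M)"
      unfolding dvol_def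
    proof (rule order_trans[OF sum_abs], rule sum_mono, rule vb[OF bk])
      show "norm (((\<lambda>i. zk' k y (axis i 1))(i := Y' y (axis i 1))) j) \<le> B" for i j
        using bk'[of k y j] order_trans[OF B3(2) le(4)] by auto
    qed
    moreover have "\<bar>vol e (Y y) (\<lambda>i. zk' k y (axis i 1))\<bar> \<le> M"
      by (rule vb) (use bk' order_trans[OF B1(2) le(2)] in auto)
    then have "\<bar>real CARD('n) * vol e (Y y) (\<lambda>i. zk' k y (axis i 1))\<bar> \<le> real CARD('n) * M"
      unfolding abs_mult by (intro mult_mono) auto
    ultimately show ?thesis
      unfolding sum_constant by linarith
  qed
  have v0: "vol e v ((w)(i := 0)) = 0" for v w i using linear_0[OF linear_vol_right[OF e]] .
  have v0': "vol e 0 w = 0" for w using linear_0[OF linear_vol_left[OF e]] .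
  have T0: "?T k y = 0" if "y \<notin> C" for k y
    using that by (simp add: Y'0 C(2) v0' dvol_def v0)
  have czk: "continuous_on UNIV (zk k)" "continuous_on UNIV (\<lambda>y. zk' k y (axis i 1))" for k i
    using d1 d2 by (meson continuous_at_imp_continuous_on has_derivative_continuous)+
  let ?L = "\<lambda>y. dvol e (z y) (\<lambda>i. z' y (axis i 1)) (\<lambda>i. Y' y (axis i 1))
     - real CARD('n) * vol e (Y y) (\<lambda>i. z' y (axis i 1))"
  have "(\<lambda>k. integral\<^sup>L lborel (?T k)) \<longlonglongrightarrow> integral\<^sup>L lborel ?L"
  \<comment> \<open>The integrands vanish outside \<open>C\<close> together with \<open>Y\<close>
    and its derivative, so a constant on \<open>C\<close> dominates them.\<close>
  proof (rule integral_dominated_convergence[where w = "\<lambda>y. indicator C y *\<^sub>R (real CARD('n) * M + real CARD('n) * M)"])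
    have "continuous_on UNIV ?L"
      by (intro e continuous_intros continuous_on_vol[OF e] continuous_on_dvol[OF e] cz cz' cY cYY)
    then show "?L \<in> borel_measurable lborel" by (simp add: borel_measurable_continuous_onI)
    have "continuous_on UNIV (?T k)" for k
      by (intro e continuous_intros continuous_on_vol[OF e] continuous_on_dvol[OF e] czk cY cYY)
    then show "?T k \<in> borel_measurable lborel" for k by (simp add: borel_measurable_continuous_onI)
    show "integrable lborel (\<lambda>y. indicator C y *\<^sub>R (real CARD('n) * M + real CARD('n) * M))"
      by (rule borel_integrable_compact[OF C(1)]) auto
    show "AE y in lborel. (\<lambda>k. ?T k y) \<longlonglongrightarrow> ?L y"
    proof (rule AE_I2)
      fix y
      have "(\<lambda>k. zk k y) \<longlonglongrightarrow> z y" unfolding zk_def r_def by (rule moll_tendsto[OF cz W])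
      moreover have "(\<lambda>k. zk' k y (axis i 1)) \<longlonglongrightarrow> z' y (axis i 1)" for i
        unfolding zk'_def r_def by (rule moll_tendsto[OF cz' W(1) z'0])
      ultimately show "(\<lambda>k. ?T k y) \<longlonglongrightarrow> ?L y"
        by (intro tendsto_diff tendsto_mult tendsto_const tendsto_vol[OF e] tendsto_dvol[OF e])
    qed
    show "AE y in lborel. norm (?T k y) \<le> indicator C y *\<^sub>R (real CARD('n) * M + real CARD('n) * M)" for k
    proof (rule AE_I2)
      fix y show "norm (?T k y) \<le> indicator C y *\<^sub>R (real CARD('n) * M + real CARD('n) * M)"
        using bT[of k y] T0[of y k] by (cases "y \<in> C") auto
    qed
  qed
  then have "(\<lambda>k. 0) \<longlonglongrightarrow> integral\<^sup>L lborel ?L" by (simp only: eq0)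
  then show ?thesis by (simp only: LIMSEQ_const_iff)
qed

text \<open>A cutoff that is 1 with zero gradient on \<open>C\<close> makes \<open>z\<close> global
  and compactly supported without changing the integrand, which vanishes off \<open>C\<close>
  together with \<open>Y\<close>.\<close>

lemma volume_variation_open:
  fixes z Y :: "real^'n \<Rightarrow> real^'m"
  assumes U: "open U" and z: "\<And>y. y \<in> U \<Longrightarrow> (z has_derivative z' y) (at y)"
    and cz': "\<And>v. continuous_on U (\<lambda>y. z' y v)"
    and Y: "\<And>y. (Y has_derivative Y' y) (at y)" and cY: "\<And>v. continuous_on UNIV (\<lambda>y. Y' y v)"
    and C: "compact C" "C \<subseteq> U" "\<And>y. y \<notin> C \<Longrightarrow> Y y = 0"
  shows "(\<integral>y. dvol e (z y) (\<lambda>i. z' y (axis i 1)) (\<lambda>i. Y' y (axis i 1))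
     - real CARD('n) * vol e (Y y) (\<lambda>i. z' y (axis i 1)) \<partial>lborel) = 0"
proof -
  obtain ct :: "real^'n \<Rightarrow> real" and g C' where
    ct: "\<And>y. (ct has_derivative (\<lambda>v. g y \<bullet> v)) (at y)" and cg: "continuous_on UNIV g" and
    ct1: "\<And>y. y \<in> C \<Longrightarrow> ct y = 1" "\<And>y. y \<in> C \<Longrightarrow> g y = 0" and
    C': "compact C'" "C' \<subseteq> U" and ct0: "\<And>y. y \<notin> C' \<Longrightarrow> ct y = 0"
    using exists_cutoff[OF C(1) U C(2)] by blast
  define w where "w y = (if y \<in> U then ct y *\<^sub>R z y else 0)" for y
  define w' where "w' y v = (if y \<in> U then ct y *\<^sub>R z' y v + (g y \<bullet> v) *\<^sub>R z y else 0)" for y v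
  have w0: "w y = 0" if "y \<notin> C'" for y using ct0[OF that] by (simp add: w_def)
  have cgv: "continuous_on UNIV (\<lambda>y. g y \<bullet> v)" for v by (intro continuous_intros cg)
  have off: "ct y *\<^sub>R z y = 0" if "y \<in> U" "y \<notin> C'" for y using ct0[OF that(2)] by simp
  note ext = cutoff_extension[OF U z cz' ct cgv compact_imp_closed[OF C'(1)] C'(2) off]
  have dw: "(w has_derivative w' y) (at y)" for y
    unfolding w_def w'_def by (rule ext(1))
  have cw': "continuous_on UNIV (\<lambda>y. w' y v)" for v
    unfolding w'_def by (rule ext(2))
  have "(\<integral>y. dvol e (w y) (\<lambda>i. w' y (axis i 1)) (\<lambda>i. Y' y (axis i 1))
     - real CARD('n) * vol e (Y y) (\<lambda>i. w' y (axis i 1)) \<partial>lborel) = 0"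
    by (rule volume_variation_C1[OF dw cw' C'(1) w0 Y cY C(1,3)])
  moreover have "dvol e (w y) (\<lambda>i. w' y (axis i 1)) (\<lambda>i. Y' y (axis i 1)) - real CARD('n) * vol e (Y y) (\<lambda>i. w' y (axis i 1))
    = dvol e (z y) (\<lambda>i. z' y (axis i 1)) (\<lambda>i. Y' y (axis i 1)) - real CARD('n) * vol e (Y y) (\<lambda>i. z' y (axis i 1))" for y
  proof (cases "y \<in> C")
    case True
    then have "w y = z y" "w' y = z' y" using C(2) ct1 by (auto simp: w_def w'_def fun_eq_iff)
    then show ?thesis by simp
  next
    case False
    have v0: "vol e v ((w)(i := 0)) = 0" for v w i using linear_0[OF linear_vol_right[OF e]] .
    have v0': "vol e 0 w = 0" for w using linear_0[OF linear_vol_left[OF e]] .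
    have "Y' y v = 0" for v
      using derivative_zero_off_support[OF Y compact_imp_closed[OF C(1)] C(3) False] .
    then show ?thesis using C(3)[OF False] by (simp add: v0' dvol_def v0)
  qed
  ultimately show ?thesis by simp
qed

end

section \<open>Variation of the volume form on a corner\<close>

definition dramp :: "real \<Rightarrow> real" where "dramp s = 4 * max 0 (1 - sqpos s) * max 0 s"

lemma dramp_cont [continuous_intros]: "continuous_on S f \<Longrightarrow> continuous_on S (\<lambda>x. dramp (f x))"
  unfolding dramp_def by (intro continuous_intros)

lemma ramp_cont [continuous_intros]: "continuous_on S f \<Longrightarrow> continuous_on S (\<lambda>x. ramp (f x))"
  unfolding ramp_def by (intro continuous_intros)

lemma dramp_zero: "s \<le> 0 \<or> 1 \<le> s \<Longrightarrow> dramp s = 0"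
  using sqpos_ge1[of s] by (auto simp: dramp_def max_def)

lemma dramp_bound: "\<bar>dramp s\<bar> \<le> 4"
proof (cases "s \<le> 0 \<or> 1 \<le> s")
  case False
  then have "max 0 (1 - sqpos s) * max 0 s \<le> 1 * 1" by (intro mult_mono) (auto simp: sqpos_def)
  then show ?thesis by (simp add: dramp_def abs_mult)
qed (simp add: dramp_zero)

lemma corner_closed: "closed (corner K)"
proof -
  have "corner K = (\<Inter>k\<in>K. {y. 0 \<le> y $ k})" by (auto simp: corner_def)
  then show ?thesis by (auto intro!: closed_INT closed_Collect_le continuous_intros)
qed

lemma hyperplane_null: "{y :: real^'n. y $ k = c} \<in> null_sets lborel"
proof -
  have "{y :: real^'n. y $ k = c} = {y. y \<bullet> axis k 1 = c}" by (simp add: inner_axis)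
  then have "negligible {y :: real^'n. y $ k = c}"
    using negligible_standard_hyperplane[of "axis k (1::real)" c] by (simp add: axis_in_Basis_iff)
  moreover have "{y :: real^'n. y $ k = c} \<in> sets lborel"
    by (auto intro!: borel_closed closed_Collect_eq continuous_intros)
  ultimately show ?thesis by (simp add: negligible_iff_null_sets null_sets_completion_iff)
qed

text \<open>Concentrating on the strip where the cutoff varies costs a factor \<open>N\<close>, which the volume of
  the strip compensates.\<close>

lemma strip_integral_tendsto_0:
  fixes \<eta> :: "real^'n \<Rightarrow> real" and q :: "nat \<Rightarrow> real^'n \<Rightarrow> real"
  assumes D: "compact D" and \<eta>: "continuous_on D \<eta>"
    and pos: "\<And>y. y \<in> D \<Longrightarrow> 0 \<le> y $ k" and face: "\<And>y. y \<in> D \<Longrightarrow> y $ k = 0 \<Longrightarrow> \<eta> y = 0"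
    and int: "\<And>j. integrable lborel (q j)"
    and q0: "\<And>j y. y \<notin> D \<Longrightarrow> q j y = 0"
    and q1: "\<And>j y. y \<in> D \<Longrightarrow> \<bar>q j y\<bar> \<le> \<bar>dramp (y $ k * real (Suc j) - 1)\<bar> * real (Suc j) * \<bar>\<eta> y\<bar>"
  shows "(\<lambda>j. integral\<^sup>L lborel (q j)) \<longlonglongrightarrow> 0"
proof (rule LIMSEQ_I)
  fix \<epsilon> :: real assume \<epsilon>: "0 < \<epsilon>"
  obtain M where M: "M > 0" "\<And>y. y \<in> D \<Longrightarrow> norm y \<le> M"
    using compact_imp_bounded[OF D] by (auto simp: bounded_pos)
  \<comment> \<open>The volume of a cross section of the box that contains the strip. The box has
    width \<open>1 / N\<close> in the direction \<open>k\<close>, hence volume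
    \<open>V / N\<close>.\<close>
  define V where "V = (2 * M) ^ (CARD('n) - 1)"
  have V: "0 < V" using M by (simp add: V_def)
  \<comment> \<open>With the bound 4 for \<open>dramp\<close>, the factor \<open>N\<close> and the
    volume \<open>V / N\<close> the integral is at most \<open>4 * V * \<epsilon>'\<close>, which is
    half of \<epsilon>.\<close>
  define \<epsilon>' where "\<epsilon>' = \<epsilon> / (8 * V)"
  have \<epsilon>': "0 < \<epsilon>'" using \<epsilon> V by (simp add: \<epsilon>'_def)
  \<comment> \<open>The part of \<open>D\<close> where \<eta> is at least \<open>\<epsilon>'\<close>
    in absolute value is compact and misses the face, so its least \<open>k\<close>-th coordinate
    serves as \<open>m\<close>.\<close>
  obtain m where m: "0 < m" "\<And>y. y \<in> D \<Longrightarrow> y $ k < m \<Longrightarrow> \<bar>\<eta> y\<bar> < \<epsilon>'"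
  proof -
    define E where "E = {y \<in> D. \<epsilon>' \<le> \<bar>\<eta> y\<bar>}"
    have "E = D \<inter> (\<lambda>y. \<bar>\<eta> y\<bar>) -` {\<epsilon>'..}" by (auto simp: E_def)
    moreover have "closedin (top_of_set D) (D \<inter> (\<lambda>y. \<bar>\<eta> y\<bar>) -` {\<epsilon>'..})"
      by (rule continuous_closedin_preimage) (auto intro!: continuous_intros \<eta>)
    ultimately have E: "compact E" using D closedin_compact by metis
    show ?thesis
    proof (cases "E = {}")
      case True
      then show ?thesis using that[of 1] by (force simp: E_def)
    next
      case False
      have "continuous_on E (\<lambda>y. y $ k)" by (intro continuous_intros)
      then obtain y0 where y0: "y0 \<in> E" "\<And>y. y \<in> E \<Longrightarrow> y0 $ k \<le> y $ k"
        using continuous_attains_inf[OF E False] by blast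
      have "y0 \<in> D" "\<eta> y0 \<noteq> 0" using y0(1) \<epsilon>' by (auto simp: E_def)
      then have "0 < y0 $ k" using pos face by (metis less_eq_real_def)
      then show ?thesis using that[of "y0 $ k"] y0(2) by (force simp: E_def)
    qed
  qed
  obtain J where J: "inverse (real (Suc J)) < m / 2" using reals_Archimedean[of "m / 2"] m(1) by auto
  show "\<exists>no. \<forall>j\<ge>no. norm (integral\<^sup>L lborel (q j) - 0) < \<epsilon>"
  proof (intro exI allI impI)
    fix j assume "J \<le> j"
    define N where "N = real (Suc j)"
    have N: "0 < N" by (simp add: N_def)
    have "inverse N \<le> inverse (real (Suc J))" unfolding N_def using \<open>J \<le> j\<close> by (intro le_imp_inverse_le) auto
    moreover have "2 / N = 2 * inverse N" by (simp only: divide_inverse)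
    ultimately have Nm: "2 / N < m" using J by linarith
    \<comment> \<open>The derivative of the ramp at \<open>y $ k * N - 1\<close> is nonzero only if
      \<open>y $ k\<close> lies between \<open>1 / N\<close> and \<open>2 / N\<close>.\<close>
    define l where "l = ((\<chi> i. if i = k then 1 / N else - M) :: real^'n)"
    define u where "u = ((\<chi> i. if i = k then 2 / N else M) :: real^'n)"
    have bound: "norm (q j y) \<le> indicator (cbox l u) y *\<^sub>R (4 * N * \<epsilon>')" for y
    proof (cases "y \<in> D \<and> 0 < y $ k * N - 1 \<and> y $ k * N - 1 < 1")
      case True
      then have y: "y \<in> D" "1 / N < y $ k" "y $ k < 2 / N" using N by (auto simp: field_simps)
      have "\<bar>y $ i\<bar> \<le> M" for i using M(2)[OF y(1)] component_le_norm_cart[of y i] by linarith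
      then have in_box: "y \<in> cbox l u" using y by (auto simp: mem_box_cart l_def u_def abs_le_iff) (metis minus_le_iff)
      have "\<bar>\<eta> y\<bar> \<le> \<epsilon>'" using m(2)[OF y(1)] y(3) Nm by fastforce
      then have "\<bar>dramp (y $ k * N - 1)\<bar> * N * \<bar>\<eta> y\<bar> \<le> 4 * N * \<epsilon>'"
        using N dramp_bound by (intro mult_mono) auto
      then show ?thesis using q1[OF y(1), of j] in_box by (simp add: N_def)
    next
      case False
      then have "y \<notin> D \<or> dramp (y $ k * N - 1) = 0" using dramp_zero[of "y $ k * N - 1"] by linarith
      then have "q j y = 0" using q0[of y j] q1[of y j] by (auto simp: N_def)
      then show ?thesis using N \<epsilon>' by (simp add: indicator_def)
    qed
    have ne: "cbox l u \<noteq> {}" using M(1) N by (auto simp: interval_ne_empty_cart l_def u_def divide_right_mono)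
    have "measure lborel (cbox l u) = (\<Prod>i\<in>UNIV. u $ i - l $ i)" by (rule content_cbox_cart[OF ne])
    also have "\<dots> = (u $ k - l $ k) * (\<Prod>i\<in>UNIV - {k}. u $ i - l $ i)" by (rule prod.remove) auto
    also have "(\<Prod>i\<in>UNIV - {k}. u $ i - l $ i) = (\<Prod>i\<in>UNIV - {k}. 2 * M)"
      by (rule prod.cong) (auto simp: u_def l_def)
    also have "(u $ k - l $ k) * \<dots> = V / N" by (simp add: u_def l_def V_def card_Diff_subset diff_divide_distrib[symmetric])
    finally have meas: "measure lborel (cbox l u) = V / N" .
    have ib: "integrable lborel (\<lambda>y. indicator (cbox l u) y *\<^sub>R (4 * N * \<epsilon>'))"
      by (rule borel_integrable_compact) auto
    have "norm (integral\<^sup>L lborel (q j)) \<le> (\<integral>y. indicator (cbox l u) y *\<^sub>R (4 * N * \<epsilon>') \<partial>lborel)"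
      by (rule order_trans[OF integral_norm_bound integral_mono]) (use int ib bound in auto)
    also have "\<dots> = 4 * V * \<epsilon>'" using N by (simp add: meas)
    also have "\<dots> < \<epsilon>" using \<epsilon> V by (simp add: \<epsilon>'_def)
    finally show "norm (integral\<^sup>L lborel (q j) - 0) < \<epsilon>" by simp
  qed
qed

context
  fixes e :: "'n::finite option \<Rightarrow> 'm::finite"
  assumes e: "bij e"
begin

text \<open>The identity on open sets is applied to \<open>Y\<close> multiplied by the cutoff
  \<open>c j\<close>. The gradient of the cutoff produces, for every face, the flux density times a
  function concentrated near that face, and these integrals tend to zero since the flux vanishes on
  the face. What remains in the limit is the integral of the divergence.\<close>

lemma volume_variation_corner:
  fixes z Y :: "real^'n \<Rightarrow> real^'m" and K :: "'n set"
  defines "T \<equiv> \<lambda>z' Y' y. dvol e (z y) (\<lambda>i. z' y (axis i 1)) (\<lambda>i. Y' y (axis i 1))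
     - real CARD('n) * vol e (Y y) (\<lambda>i. z' y (axis i 1))"
  assumes S: "S = ball a R \<inter> corner K"
    and z: "\<And>y. y \<in> S \<Longrightarrow> (z has_derivative z' y) (at y within S)"
    and cz': "\<And>v. continuous_on S (\<lambda>y. z' y v)"
    and Y: "\<And>y. y \<in> S \<Longrightarrow> (Y has_derivative Y' y) (at y within S)"
    and cY': "\<And>v. continuous_on S (\<lambda>y. Y' y v)"
    and C: "compact C" "C \<subseteq> ball a R" "\<And>y. y \<in> S \<Longrightarrow> y \<notin> C \<Longrightarrow> Y y = 0"
       "\<And>y v. y \<in> S \<Longrightarrow> y \<notin> C \<Longrightarrow> Y' y v = 0"
    and flux: "\<And>k y. k \<in> K \<Longrightarrow> y \<in> S \<Longrightarrow> y $ k = 0 \<Longrightarrow> vol e (z y) ((\<lambda>i. z' y (axis i 1))(k := Y y)) = 0"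
  shows "(\<integral>y. indicator S y *\<^sub>R T z' Y' y \<partial>lborel) = 0"
proof -
  define D where "D = C \<inter> corner K"
  have D: "compact D" "D \<subseteq> S" using C(1,2) corner_closed S by (auto simp: D_def compact_Int_closed)
  \<comment> \<open>The corner without its faces, where two-sided derivatives and the identity on
    open sets are available.\<close>
  define U where "U = ball a R \<inter> {y. \<forall>k\<in>K. 0 < y $ k}"
  have "{y :: real^'n. \<forall>k\<in>K. 0 < y $ k} = (\<Inter>k\<in>K. {y. 0 < y $ k})" by auto
  then have "open {y :: real^'n. \<forall>k\<in>K. 0 < y $ k}"
    by (auto intro!: open_INT open_Collect_less continuous_intros)
  then have U: "open U" unfolding U_def by (intro open_Int) auto
  have US: "U \<subseteq> S" by (auto simp: U_def S corner_def less_imp_le)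
  have atU: "at y within S = at y" if "y \<in> U" for y
    using U US that by (meson at_within_interior interior_maximal subsetD)
  have zU: "(z has_derivative z' y) (at y)" and YU: "(Y has_derivative Y' y) (at y)" if "y \<in> U" for y
    using z[of y] Y[of y] US that atU[OF that] by auto
  have cz: "continuous_on S z" and cY: "continuous_on S Y"
    using z Y by (auto simp: continuous_on_eq_continuous_within intro: has_derivative_continuous)
  define u where "u y i = z' y (axis i 1)" for y i
  define \<eta> where "\<eta> k y = vol e (z y) ((u y)(k := Y y))" for k y
  have v0: "vol e v (w(i := 0)) = 0" for v w i using linear_0[OF linear_vol_right[OF e]] .
  have v0': "vol e 0 w = 0" for w using linear_0[OF linear_vol_left[OF e]] .
  have cT: "continuous_on S (T z' Y')"
    unfolding T_def by (intro e continuous_intros continuous_on_vol[OF e] continuous_on_dvol[OF e] cz cz' cY cY')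
  have c\<eta>: "continuous_on S (\<eta> k)" for k
    unfolding \<eta>_def
  proof (intro continuous_on_vol[OF e] cz)
    show "continuous_on S (\<lambda>y. ((u y)(k := Y y)) i)" for i
      by (cases "i = k") (auto simp: u_def cY cz')
  qed
  have T0: "T z' Y' y = 0" and \<eta>0: "\<eta> k y = 0" if "y \<in> S" "y \<notin> C" for y k
    using C(3,4)[OF that] by (simp_all add: T_def \<eta>_def dvol_def v0 v0')
  \<comment> \<open>The shift by 1 makes a factor vanish as long as \<open>y $ k\<close> is at most
    \<open>1 / real (Suc j)\<close>, so \<open>c j\<close> times \<open>Y\<close> has compact
    support in \<open>U\<close>. From twice that value on the factor is 1, whence \<open>c j\<close>
    tends to 1 on \<open>U\<close>.\<close>
  define c where "c j y = (\<Prod>k\<in>K. ramp (y $ k * real (Suc j) - 1))" for j and y :: "real^'n"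
  define p where "p j k y = dramp (y $ k * real (Suc j) - 1) * real (Suc j) * (\<Prod>l\<in>K - {k}. ramp (y $ l * real (Suc j) - 1))" for j k and y :: "real^'n"
  define c' where "c' j y v = (\<Sum>k\<in>K. p j k y * v $ k)" for j y v
  have dc: "(c j has_derivative c' j y) (at y)" for j y
  proof -
    have r: "((\<lambda>y. ramp (y $ k * real (Suc j) - 1)) has_derivative (\<lambda>v. dramp (y $ k * real (Suc j) - 1) * (v $ k * real (Suc j)))) (at y)" for k
    proof -
      have "((\<lambda>y. y $ k * real (Suc j) - 1) has_derivative (\<lambda>v. v $ k * real (Suc j))) (at y)"
        by (auto intro!: derivative_eq_intros bounded_linear_imp_has_derivative[OF bounded_linear_vec_nth])
      from has_derivative_compose[OF this ramp_deriv[THEN has_field_derivative_imp_has_derivative]]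
      show ?thesis by (simp add: dramp_def)
    qed
    have "(\<lambda>v. \<Sum>k\<in>K. dramp (y $ k * real (Suc j) - 1) * (v $ k * real (Suc j)) * (\<Prod>l\<in>K - {k}. ramp (y $ l * real (Suc j) - 1))) = c' j y"
      by (auto simp: c'_def p_def fun_eq_iff mult_ac intro!: sum.cong)
    then show ?thesis
      using has_derivative_prod[of K "\<lambda>k y. ramp (y $ k * real (Suc j) - 1)", OF r] by (simp add: c_def[abs_def])
  qed
  have cp: "continuous_on A (p j k)" for A j k
    unfolding p_def by (intro continuous_intros)
  have cc': "continuous_on UNIV (\<lambda>y. c' j y v)" for j v
    unfolding c'_def by (intro continuous_intros cp)
  have cc: "continuous_on A (c j)" for A j unfolding c_def by (intro continuous_intros)
  have c01: "0 \<le> c j y" "c j y \<le> 1" for j y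
    unfolding c_def by (auto intro!: prod_nonneg prod_le_1 simp: ramp_bounds)
  define Cj where "Cj j = D \<inter> (\<Inter>k\<in>K. {y. 1 / real (Suc j) \<le> y $ k})" for j
  have Cj: "compact (Cj j)" "Cj j \<subseteq> U" for j
  proof -
    show "compact (Cj j)" unfolding Cj_def
      by (intro compact_Int_closed D closed_INT ballI closed_Collect_le continuous_intros)
    show "Cj j \<subseteq> U"
    proof
      fix y assume y: "y \<in> Cj j"
      have "0 < y $ k" if "k \<in> K" for k
      proof -
        have "1 / real (Suc j) \<le> y $ k" using y that by (auto simp: Cj_def)
        moreover have "0 < 1 / real (Suc j)" by simp
        ultimately show ?thesis by linarith
      qed
      then show "y \<in> U" using y C(2) by (auto simp: U_def Cj_def D_def)
    qed
  qed
  have off: "c j y *\<^sub>R Y y = 0" if y: "y \<in> U" "y \<notin> Cj j" for j y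
  proof (cases "y \<in> C")
    case True
    then have "y \<in> D" using y US S by (auto simp: D_def)
    then obtain k where k: "k \<in> K" "y $ k < 1 / real (Suc j)" using y by (auto simp: Cj_def not_le)
    then have "ramp (y $ k * real (Suc j) - 1) = 0" by (intro ramp_simps) (simp add: field_simps)
    then have "c j y = 0" unfolding c_def using k by (intro prod_zero) auto
    then show ?thesis by simp
  next
    case False
    then show ?thesis using C(3) y US by auto
  qed
  define A where "A j y = indicator U y * (c j y * T z' Y' y)" for j y
  define B where "B j k y = indicator U y * (p j k y * \<eta> k y)" for j k y
  have intD: "integrable lborel (\<lambda>y. indicator U y * f y)"
    if f: "continuous_on S f" "\<And>y. y \<in> S \<Longrightarrow> y \<notin> C \<Longrightarrow> f y = 0" for f :: "real^'n \<Rightarrow> real"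
  proof -
    have "set_integrable lborel D f" unfolding set_integrable_def
      by (rule borel_integrable_compact[OF D(1) continuous_on_subset[OF f(1) D(2)]])
    then have "set_integrable lborel (U \<inter> D) f"
      by (rule set_integrable_subset) (use borel_open[OF U] borel_compact[OF D(1)] in auto)
    moreover have eq: "indicator (U \<inter> D) y *\<^sub>R f y = indicator U y * f y" for y
    proof (cases "y \<in> U")
      case True
      then have "y \<in> S" using US by blast
      then show ?thesis using f(2)[OF \<open>y \<in> S\<close>] S True by (cases "y \<in> C") (auto simp: D_def)
    qed simp
    ultimately show ?thesis unfolding set_integrable_def eq by blast
  qed
  have intA: "integrable lborel (A j)" for j
    unfolding A_def by (rule intD) (auto intro!: continuous_intros cc cT simp: T0)
  have intB: "integrable lborel (B j k)" for j k
    unfolding B_def by (rule intD) (auto intro!: continuous_intros cp c\<eta> simp: \<eta>0)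
  \<comment> \<open>Product rule: the term with \<open>c j\<close> reproduces the integrand, and the
    gradient of \<open>c j\<close> puts \<open>Y\<close> into the place of each restricted
    coordinate, which is the flux \<eta> through that face. Along the other coordinates
    \<open>c j\<close> is constant.\<close>
  have split: "dvol e (z y) (\<lambda>i. z' y (axis i 1)) (\<lambda>i. if y \<in> U then c j y *\<^sub>R Y' y (axis i 1) + c' j y (axis i 1) *\<^sub>R Y y else 0)
     - real CARD('n) * vol e (if y \<in> U then c j y *\<^sub>R Y y else 0) (\<lambda>i. z' y (axis i 1)) = A j y + (\<Sum>k\<in>K. B j k y)" for j y
  proof (cases "y \<in> U")
    case False
    then show ?thesis by (simp add: A_def B_def dvol_def v0 v0')
  next
    case True
    have "c' j y (axis i 1) = (if i \<in> K then p j i y else 0)" for i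
      by (simp add: c'_def axis_def if_distrib sum.delta' cong: if_cong)
    then have "dvol e (z y) (u y) (\<lambda>i. c' j y (axis i 1) *\<^sub>R Y y) = (\<Sum>i\<in>UNIV. if i \<in> K then p j i y * \<eta> i y else 0)"
      unfolding dvol_def by (intro sum.cong) (auto simp: linear_scale[OF linear_vol_right[OF e]] \<eta>_def v0)
    also have "\<dots> = (\<Sum>i\<in>K. p j i y * \<eta> i y)" by (simp add: sum.If_cases)
    finally show ?thesis
      using True by (simp add: A_def B_def T_def u_def[abs_def] dvol_add[OF e] dvol_scaleR[OF e] linear_scale[OF linear_vol_left[OF e]] right_diff_distrib)
  qed
  have "(\<integral>y. A j y + (\<Sum>k\<in>K. B j k y) \<partial>lborel) = 0" for j
    unfolding split[symmetric]
  proof (rule volume_variation_open[where U = U and C = "Cj j" and Y = "\<lambda>y. if y \<in> U then c j y *\<^sub>R Y y else 0"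
        and Y' = "\<lambda>y v. if y \<in> U then c j y *\<^sub>R Y' y v + c' j y v *\<^sub>R Y y else 0"])
    show "(if y \<in> U then c j y *\<^sub>R Y y else 0) = 0" if "y \<notin> Cj j" for y using off that by simp
    show "continuous_on UNIV (\<lambda>y. if y \<in> U then c j y *\<^sub>R Y' y v + c' j y v *\<^sub>R Y y else 0)" for v
      by (rule cutoff_extension(2)[OF U YU continuous_on_subset[OF cY' US] dc cc' compact_imp_closed[OF Cj(1)] Cj(2) off])
    show "((\<lambda>y. if y \<in> U then c j y *\<^sub>R Y y else 0) has_derivative
        (\<lambda>v. if y \<in> U then c j y *\<^sub>R Y' y v + c' j y v *\<^sub>R Y y else 0)) (at y)" for y
      by (rule cutoff_extension(1)[OF U YU continuous_on_subset[OF cY' US] dc cc' compact_imp_closed[OF Cj(1)] Cj(2) off])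
    show "compact (Cj j)" "Cj j \<subseteq> U" by (rule Cj)+
  qed (rule e U continuous_on_subset[OF cz' US] | erule zU)+
  then have sumAB: "integral\<^sup>L lborel (A j) = - (\<Sum>k\<in>K. integral\<^sup>L lborel (B j k))" for j
    using intA intB by (simp add: add_eq_0_iff2)
  have limB: "(\<lambda>j. integral\<^sup>L lborel (B j k)) \<longlonglongrightarrow> 0" if k: "k \<in> K" for k
  proof (rule strip_integral_tendsto_0[OF D(1) continuous_on_subset[OF c\<eta>[of k] D(2)]])
    show "0 \<le> y $ k" if "y \<in> D" for y using that k by (auto simp: D_def corner_def)
    show "\<eta> k y = 0" if "y \<in> D" "y $ k = 0" for y
      using flux[OF k] that D(2) by (auto simp: \<eta>_def u_def[abs_def])
    show "integrable lborel (B j k)" for j by (rule intB)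
    show "B j k y = 0" if "y \<notin> D" for j y
    proof (cases "y \<in> U")
      case True
      then have "y \<in> S" using US by blast
      moreover have "y \<notin> C" using that calculation S by (simp add: D_def)
      ultimately show ?thesis by (simp add: B_def \<eta>0)
    qed (simp add: B_def)
    show "\<bar>B j k y\<bar> \<le> \<bar>dramp (y $ k * real (Suc j) - 1)\<bar> * real (Suc j) * \<bar>\<eta> k y\<bar>" for j y
    proof -
      let ?P = "\<Prod>l\<in>K - {k}. ramp (y $ l * real (Suc j) - 1)"
      have P: "0 \<le> ?P" "?P \<le> 1" by (auto intro!: prod_nonneg prod_le_1 simp: ramp_bounds)
      have "\<bar>B j k y\<bar> \<le> \<bar>p j k y * \<eta> k y\<bar>" by (auto simp: B_def indicator_def)
      also have "\<dots> = \<bar>dramp (y $ k * real (Suc j) - 1)\<bar> * real (Suc j) * \<bar>\<eta> k y\<bar> * ?P"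
        using P(1) by (simp add: p_def abs_mult mult_ac)
      also have "\<dots> \<le> \<bar>dramp (y $ k * real (Suc j) - 1)\<bar> * real (Suc j) * \<bar>\<eta> k y\<bar> * 1"
        by (intro mult_left_mono P) auto
      finally show ?thesis by simp
    qed
  qed
  have "(\<lambda>j. integral\<^sup>L lborel (A j)) \<longlonglongrightarrow> - (\<Sum>k\<in>K. 0)"
    unfolding sumAB by (intro tendsto_minus tendsto_sum limB)
  moreover have "(\<lambda>j. integral\<^sup>L lborel (A j)) \<longlonglongrightarrow> (\<integral>y. indicator U y * T z' Y' y \<partial>lborel)"
  proof (rule integral_dominated_convergence[where w = "\<lambda>y. \<bar>indicator U y * T z' Y' y\<bar>"])
    have i: "integrable lborel (\<lambda>y. indicator U y * T z' Y' y)" by (rule intD[OF cT T0])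
    then show "(\<lambda>y. indicator U y * T z' Y' y) \<in> borel_measurable lborel" by auto
    show "A j \<in> borel_measurable lborel" for j using intA by auto
    show "integrable lborel (\<lambda>y. \<bar>indicator U y * T z' Y' y\<bar>)" using i by auto
    show "AE y in lborel. (\<lambda>j. A j y) \<longlonglongrightarrow> indicator U y * T z' Y' y"
    proof (rule AE_I2)
      fix y
      show "(\<lambda>j. A j y) \<longlonglongrightarrow> indicator U y * T z' Y' y"
      proof (cases "y \<in> U")
        case True
        have "(\<lambda>j. ramp (y $ k * real (Suc j) - 1)) \<longlonglongrightarrow> 1" if "k \<in> K" for k
        proof -
          have k: "0 < y $ k" using True that by (auto simp: U_def)
          obtain J :: nat where J: "2 / y $ k \<le> real J" using real_arch_simple by blast
          have "ramp (y $ k * real (Suc j) - 1) = 1" if "J \<le> j" for j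
          proof (rule ramp_simps)
            have "2 / y $ k \<le> real (Suc j)" using J that by linarith
            then show "1 \<le> y $ k * real (Suc j) - 1" using k by (simp add: pos_divide_le_eq mult.commute)
          qed
          then show ?thesis by (intro tendsto_eventually eventually_sequentiallyI[of J]) auto
        qed
        then have "(\<lambda>j. c j y) \<longlonglongrightarrow> (\<Prod>k\<in>K. 1)" unfolding c_def by (intro tendsto_prod)
        then have "(\<lambda>j. indicator U y * (c j y * T z' Y' y)) \<longlonglongrightarrow> indicator U y * ((\<Prod>k\<in>K. 1) * T z' Y' y)"
          by (intro tendsto_mult tendsto_const)
        then show ?thesis by (simp add: A_def)
      qed (simp add: A_def)
    qed
    show "AE y in lborel. norm (A j y) \<le> \<bar>indicator U y * T z' Y' y\<bar>" for j
      using c01[of j] by (intro AE_I2) (auto simp: A_def indicator_def abs_mult mult_left_le_one_le)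
  qed
  ultimately have "(\<integral>y. indicator U y * T z' Y' y \<partial>lborel) = 0"
    using LIMSEQ_unique by fastforce
  \<comment> \<open>\<open>S\<close> and \<open>U\<close> differ by parts of coordinate hyperplanes,
    a null set.\<close>
  moreover have "(\<integral>y. indicator S y *\<^sub>R T z' Y' y \<partial>lborel) = (\<integral>y. indicator U y * T z' Y' y \<partial>lborel)"
  proof (rule integral_cong_AE)
    have "set_integrable lborel D (T z' Y')" unfolding set_integrable_def
      by (rule borel_integrable_compact[OF D(1) continuous_on_subset[OF cT D(2)]])
    moreover have eq: "indicator D y *\<^sub>R T z' Y' y = indicator S y *\<^sub>R T z' Y' y" for y
      using T0[of y] D(2) S by (auto simp: indicator_def D_def)
    ultimately show "(\<lambda>y. indicator S y *\<^sub>R T z' Y' y) \<in> borel_measurable lborel"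
      unfolding set_integrable_def eq by (blast intro: borel_measurable_integrable)
    show "(\<lambda>y. indicator U y * T z' Y' y) \<in> borel_measurable lborel" using intD[OF cT T0] by auto
    have "AE y in lborel. y \<notin> (\<Union>k\<in>K. {y :: real^'n. y $ k = 0})"
      by (intro AE_not_in null_sets_UN' countable_finite hyperplane_null finite_class.finite)
    then show "AE y in lborel. indicator S y *\<^sub>R T z' Y' y = indicator U y * T z' Y' y"
    proof eventually_elim
      case (elim y)
      then have "y \<in> S \<longleftrightarrow> y \<in> U" by (force simp: S U_def corner_def less_le)
      then show ?case by (simp add: indicator_def)
    qed
  qed
  ultimately show ?thesis by simp
qed

end

section \<open>Calculus on manifolds with corners\<close>

text \<open>The class of the anisotropic normal, encoded like \<open>smooth_on\<close> by local
  extensions. With a gauge of class C^2 the Cahn-Hoffman map is C^1, and smoothness cannot be asked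
  of it.\<close>

definition C1_on :: "'a::euclidean_space set \<Rightarrow> ('a \<Rightarrow> 'b::euclidean_space) \<Rightarrow> bool" where
  "C1_on S f \<longleftrightarrow> (\<forall>x\<in>S. \<exists>V g. open V \<and> x \<in> V \<and> Ck_on 1 V g \<and> (\<forall>y\<in>V \<inter> S. g y = f y))"

lemma Ck1I:
  assumes "\<And>x. x \<in> U \<Longrightarrow> (f has_derivative f' x) (at x)" "\<And>v. continuous_on U (\<lambda>x. f' x v)"
  shows "Ck_on 1 U f"
proof -
  have "f' x = frechet_derivative f (at x)" if "x \<in> U" for x
    using frechet_derivative_at[OF assms(1)[OF that]] .
  then have "continuous_on U (\<lambda>x. frechet_derivative f (at x) v)" for v
    using continuous_on_cong[of U U "\<lambda>x. f' x v" "\<lambda>x. frechet_derivative f (at x) v"] assms(2) by simp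
  then show ?thesis using assms(1) by (auto simp: One_nat_def differentiable_def simp del: One_nat_def[symmetric])
qed

lemma Ck1D:
  assumes "Ck_on 1 U f"
  shows "x \<in> U \<Longrightarrow> (f has_derivative frechet_derivative f (at x)) (at x)"
    "continuous_on U (\<lambda>x. frechet_derivative f (at x) v)" "continuous_on U f"
proof -
  have *: "\<And>x. x \<in> U \<Longrightarrow> f differentiable (at x)" using assms by (simp add: One_nat_def)
  then show "x \<in> U \<Longrightarrow> (f has_derivative frechet_derivative f (at x)) (at x)"
    by (simp add: frechet_derivative_works)
  show "continuous_on U (\<lambda>x. frechet_derivative f (at x) v)" using assms by (simp add: One_nat_def)
  show "continuous_on U f"
    using * by (meson continuous_at_imp_continuous_on differentiable_imp_continuous_within)
qed

lemma Ck1_subset: "Ck_on 1 U f \<Longrightarrow> V \<subseteq> U \<Longrightarrow> Ck_on 1 V f"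
  by (auto simp: One_nat_def intro: continuous_on_subset)

lemma C1_onI:
  assumes "open U" "\<And>x. x \<in> U \<Longrightarrow> (f has_derivative f' x) (at x)" "\<And>v. continuous_on U (\<lambda>x. f' x v)" "S \<subseteq> U"
  shows "C1_on S f"
  unfolding C1_on_def using assms Ck1I[of U f f'] by blast

lemma C1_on_cong: "C1_on S f \<Longrightarrow> (\<And>x. x \<in> S \<Longrightarrow> f x = g x) \<Longrightarrow> C1_on S g"
  unfolding C1_on_def by (metis IntD2)

lemma C1_on_local:
  assumes "\<And>y. y \<in> S \<Longrightarrow> \<exists>N. openin (top_of_set S) N \<and> y \<in> N \<and> C1_on N f"
  shows "C1_on S f"
  unfolding C1_on_def
proof
  fix x assume "x \<in> S"
  then obtain N where N: "openin (top_of_set S) N" "x \<in> N" "C1_on N f" using assms by blast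
  then obtain W where W: "open W" "N = S \<inter> W" by (auto simp: openin_open)
  obtain V g where "open V" "x \<in> V" "Ck_on 1 V g" "\<forall>y\<in>V \<inter> N. g y = f y"
    using N(2,3) unfolding C1_on_def by blast
  then show "\<exists>V g. open V \<and> x \<in> V \<and> Ck_on 1 V g \<and> (\<forall>y\<in>V \<inter> S. g y = f y)"
    using W N(2) Ck1_subset[of V g "V \<inter> W"] by (intro exI[of _ "V \<inter> W"] exI[of _ g]) (auto simp del: Ck_on.simps One_nat_def)
qed

lemma smooth_on_C1_on: "smooth_on S f \<Longrightarrow> C1_on S f"
  unfolding smooth_on_def C1_on_def by metis

lemma C1_on_const: "C1_on S (\<lambda>_. c)"
  by (rule C1_onI[of UNIV _ "\<lambda>_ _. 0"]) auto

lemma C1_on_add: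
  assumes "C1_on S f" "C1_on S g"
  shows "C1_on S (\<lambda>x. f x + g x)"
  unfolding C1_on_def
proof
  fix x assume x: "x \<in> S"
  obtain V f1 where f: "open V" "x \<in> V" "Ck_on 1 V f1" "\<forall>y\<in>V \<inter> S. f1 y = f y"
    using assms(1) x unfolding C1_on_def by blast
  obtain W g1 where g: "open W" "x \<in> W" "Ck_on 1 W g1" "\<forall>y\<in>W \<inter> S. g1 y = g y"
    using assms(2) x unfolding C1_on_def by blast
  have "Ck_on 1 (V \<inter> W) (\<lambda>x. f1 x + g1 x)"
  proof (rule Ck1I)
    fix y assume "y \<in> V \<inter> W"
    then show "((\<lambda>x. f1 x + g1 x) has_derivative
      (\<lambda>v. frechet_derivative f1 (at y) v + frechet_derivative g1 (at y) v)) (at y)"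
      using Ck1D(1)[OF f(3)] Ck1D(1)[OF g(3)] by (intro has_derivative_add) auto
  next
    fix v show "continuous_on (V \<inter> W) (\<lambda>y. frechet_derivative f1 (at y) v + frechet_derivative g1 (at y) v)"
      using Ck1D(2)[OF f(3)] Ck1D(2)[OF g(3)]
      by (intro continuous_on_add) (auto intro: continuous_on_subset)
  qed
  then show "\<exists>V h. open V \<and> x \<in> V \<and> Ck_on 1 V h \<and> (\<forall>y\<in>V \<inter> S. h y = f y + g y)"
    using f g by (intro exI[of _ "V \<inter> W"] exI[of _ "\<lambda>x. f1 x + g1 x"]) auto
qed

lemma C1_on_scaleR:
  fixes f :: "'a::euclidean_space \<Rightarrow> real"
  assumes "C1_on S f" "C1_on S g"
  shows "C1_on S (\<lambda>x. f x *\<^sub>R g x)"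
  unfolding C1_on_def
proof
  fix x assume x: "x \<in> S"
  obtain V f1 where f: "open V" "x \<in> V" "Ck_on 1 V f1" "\<forall>y\<in>V \<inter> S. f1 y = f y"
    using assms(1) x unfolding C1_on_def by blast
  obtain W g1 where g: "open W" "x \<in> W" "Ck_on 1 W g1" "\<forall>y\<in>W \<inter> S. g1 y = g y"
    using assms(2) x unfolding C1_on_def by blast
  have "Ck_on 1 (V \<inter> W) (\<lambda>x. f1 x *\<^sub>R g1 x)"
  proof (rule Ck1I)
    fix y assume "y \<in> V \<inter> W"
    then show "((\<lambda>x. f1 x *\<^sub>R g1 x) has_derivative
      (\<lambda>v. f1 y *\<^sub>R frechet_derivative g1 (at y) v + frechet_derivative f1 (at y) v *\<^sub>R g1 y)) (at y)"
      using Ck1D(1)[OF f(3)] Ck1D(1)[OF g(3)] by (intro has_derivative_scaleR) auto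
  next
    fix v show "continuous_on (V \<inter> W) (\<lambda>y. f1 y *\<^sub>R frechet_derivative g1 (at y) v + frechet_derivative f1 (at y) v *\<^sub>R g1 y)"
      using Ck1D(2,3)[OF f(3)] Ck1D(2,3)[OF g(3)]
      by (intro continuous_intros) (auto intro: continuous_on_subset)
  qed
  then show "\<exists>V h. open V \<and> x \<in> V \<and> Ck_on 1 V h \<and> (\<forall>y\<in>V \<inter> S. h y = f y *\<^sub>R g y)"
    using f g by (intro exI[of _ "V \<inter> W"] exI[of _ "\<lambda>x. f1 x *\<^sub>R g1 x"]) auto
qed

lemma linear_expand_Basis:
  fixes L :: "'a::euclidean_space \<Rightarrow> 'b::real_vector"
  shows "linear L \<Longrightarrow> L w = (\<Sum>b\<in>Basis. (w \<bullet> b) *\<^sub>R L b)"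
  by (metis (no_types, lifting) euclidean_representation linear_scale linear_sum sum.cong)

lemma C1_on_compose:
  assumes h: "C1_on S' h" and f: "C1_on S f" and sub: "f ` S \<subseteq> S'"
  shows "C1_on S (\<lambda>x. h (f x))"
  unfolding C1_on_def
proof
  fix x assume x: "x \<in> S"
  obtain V f1 where f: "open V" "x \<in> V" "Ck_on 1 V f1" "\<forall>y\<in>V \<inter> S. f1 y = f y"
    using f x unfolding C1_on_def by blast
  obtain W h1 where h: "open W" "f x \<in> W" "Ck_on 1 W h1" "\<forall>y\<in>W \<inter> S'. h1 y = h y"
    using h x sub unfolding C1_on_def by blast
  define V' where "V' = V \<inter> f1 -` W"
  have "openin (top_of_set V) V'"
    unfolding V'_def by (rule continuous_openin_preimage_gen[OF Ck1D(3)[OF f(3)] h(1)])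
  then have V': "open V'" using f(1) openin_open_trans by blast
  have "Ck_on 1 V' (\<lambda>x. h1 (f1 x))"
  proof (rule Ck1I)
    fix y assume y: "y \<in> V'"
    show "((\<lambda>x. h1 (f1 x)) has_derivative (\<lambda>v. frechet_derivative h1 (at (f1 y)) (frechet_derivative f1 (at y) v))) (at y)"
      by (rule has_derivative_compose[OF Ck1D(1)[OF f(3)] Ck1D(1)[OF h(3)]]) (use y in \<open>auto simp: V'_def\<close>)
  next
    fix v
    \<comment> \<open>Expanding in a basis separates the base point from the direction, so that
      continuity in each fixed direction suffices.\<close>
    have "frechet_derivative h1 (at (f1 y)) (frechet_derivative f1 (at y) v) =
      (\<Sum>b\<in>Basis. (frechet_derivative f1 (at y) v \<bullet> b) *\<^sub>R frechet_derivative h1 (at (f1 y)) b)" if "y \<in> V'" for y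
      by (rule linear_expand_Basis, rule has_derivative_linear, rule Ck1D(1)[OF h(3)]) (use that in \<open>auto simp: V'_def\<close>)
    moreover have "continuous_on V' (\<lambda>y. \<Sum>b\<in>Basis. (frechet_derivative f1 (at y) v \<bullet> b) *\<^sub>R frechet_derivative h1 (at (f1 y)) b)"
    proof (intro continuous_intros)
      show "continuous_on V' (\<lambda>y. frechet_derivative f1 (at y) v)"
        by (rule continuous_on_subset[OF Ck1D(2)[OF f(3)]]) (auto simp: V'_def)
      show "continuous_on V' (\<lambda>y. frechet_derivative h1 (at (f1 y)) b)" for b
        by (rule continuous_on_compose2[OF Ck1D(2)[OF h(3)] continuous_on_subset[OF Ck1D(3)[OF f(3)]]]) (auto simp: V'_def)
    qed
    ultimately show "continuous_on V' (\<lambda>y. frechet_derivative h1 (at (f1 y)) (frechet_derivative f1 (at y) v))"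
      using continuous_on_cong[of V' V'] by simp
  qed
  moreover have "x \<in> V'" using f h x by (auto simp: V'_def)
  moreover have "h1 (f1 y) = h (f y)" if "y \<in> V' \<inter> S" for y
    using that f(4) h(4) sub by (auto simp: V'_def image_subset_iff)
  ultimately show "\<exists>V g. open V \<and> x \<in> V \<and> Ck_on 1 V g \<and> (\<forall>y\<in>V \<inter> S. g y = h (f y))"
    using V' by blast
qed

lemma C1_on_inverse:
  fixes f :: "'a::euclidean_space \<Rightarrow> real"
  assumes "C1_on S f" "\<And>x. x \<in> S \<Longrightarrow> f x \<noteq> 0"
  shows "C1_on S (\<lambda>x. inverse (f x))"
proof (rule C1_on_compose[OF _ assms(1)])
  show "C1_on (- {0}) (inverse :: real \<Rightarrow> real)"
    by (rule C1_onI[of "- {0}" _ "\<lambda>x v. - (inverse x * v * inverse x)"])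
       (auto intro!: derivative_eq_intros continuous_intros)
qed (use assms in auto)

lemma C1_on_sum:
  "finite I \<Longrightarrow> (\<And>i. i \<in> I \<Longrightarrow> C1_on S (f i)) \<Longrightarrow> C1_on S (\<lambda>x. \<Sum>i\<in>I. f i x)"
  by (induction I rule: finite_induct) (auto intro!: C1_on_const C1_on_add)

text \<open>From every point of a corner the positive coordinate directions stay in the corner, and
  the derivatives along a basis determine a linear map.\<close>

lemma corner_derivative_unique:
  fixes S :: "(real^'n) set"
  assumes S: "openin (top_of_set (corner K)) S" "y \<in> S"
    and "(f has_derivative f') (at y within S)" "(f has_derivative f'') (at y within S)"
  shows "f' = f''"
proof (rule frechet_derivative_unique_within[OF assms(3,4)])
  fix i :: "real^'n" and e :: real assume i: "i \<in> Basis" and e: "e > 0"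
  obtain O1 where O1: "open O1" "S = corner K \<inter> O1" using S(1) by (auto simp: openin_open)
  obtain r where r: "r > 0" "ball y r \<subseteq> O1" using O1 S(2) by (meson IntD2 openE)
  define d where "d = min e r / 2"
  have d: "0 < d" "d < e" "d < r" using e r by (auto simp: d_def)
  have "norm (d *\<^sub>R i) = d" using i d by simp
  then have "y + d *\<^sub>R i \<in> ball y r" using d by (simp add: dist_norm)
  moreover have "y + d *\<^sub>R i \<in> corner K"
  proof -
    obtain k where "i = axis k 1" using i by (auto simp: Basis_vec_def)
    then have "0 \<le> i $ j" for j by (simp add: axis_def)
    then show ?thesis using S(2) O1 d by (auto simp: corner_def)
  qed
  ultimately show "\<exists>d. 0 < \<bar>d\<bar> \<and> \<bar>d\<bar> < e \<and> y + d *\<^sub>R i \<in> S" using d r O1 by (intro exI[of _ d]) auto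
qed

text \<open>By uniqueness on corners, the derivative within \<open>S\<close> is the derivative of
  any local C^1 extension. Continuity is inherited from the extensions, also at boundary
  points.\<close>

lemma
  fixes S :: "(real^'n) set"
  assumes S: "openin (top_of_set (corner K)) S" and f: "C1_on S f"
  shows C1_on_has_derivative: "y \<in> S \<Longrightarrow> (f has_derivative frechet_derivative f (at y within S)) (at y within S)"
    and C1_on_continuous_derivative: "continuous_on S (\<lambda>y. frechet_derivative f (at y within S) v)"
proof -
  have loc: "(f has_derivative frechet_derivative g (at y)) (at y within S)"
    if V: "open V" "Ck_on 1 V g" "\<forall>y\<in>V \<inter> S. g y = f y" "y \<in> V" "y \<in> S" for V g y
  proof -
    obtain r where "r > 0" "ball y r \<subseteq> V" using V by (meson openE)
    moreover have "(g has_derivative frechet_derivative g (at y)) (at y within S)"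
      using Ck1D(1)[OF V(2,4)] by (rule has_derivative_at_withinI)
    ultimately show ?thesis
      using V(3,5) by (elim has_derivative_transform_within) (auto simp: dist_commute subset_iff)
  qed
  show d: "(f has_derivative frechet_derivative f (at y within S)) (at y within S)" if "y \<in> S" for y
    using f that loc unfolding C1_on_def by (metis differentiable_def frechet_derivative_works)
  show "continuous_on S (\<lambda>y. frechet_derivative f (at y within S) v)"
    unfolding continuous_on_eq_continuous_within
  proof
    fix x assume x: "x \<in> S"
    obtain V g where V: "open V" "x \<in> V" "Ck_on 1 V g" "\<forall>y\<in>V \<inter> S. g y = f y"
      using f x unfolding C1_on_def by blast
    have eq: "frechet_derivative f (at y within S) = frechet_derivative g (at y)" if "y \<in> V \<inter> S" for y
      using corner_derivative_unique[OF S _ d loc[OF V(1,3,4)]] that by blast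
    obtain r where r: "r > 0" "ball x r \<subseteq> V" using V by (meson openE)
    have "isCont (\<lambda>y. frechet_derivative g (at y) v) x"
      using Ck1D(2)[OF V(3)] V(1,2) by (simp add: continuous_on_eq_continuous_at)
    then have "continuous (at x within S) (\<lambda>y. frechet_derivative g (at y) v)"
      by (rule continuous_at_imp_continuous_at_within)
    then show "continuous (at x within S) (\<lambda>y. frechet_derivative f (at y within S) v)"
      by (rule continuous_transform_within[OF _ r(1) x]) (use eq r in \<open>auto simp: dist_commute subset_iff\<close>)
  qed
qed

lemma C1_on_imp_continuous_on: "C1_on S f \<Longrightarrow> continuous_on S f"
  unfolding continuous_on_eq_continuous_within
proof
  fix x assume "C1_on S f" "x \<in> S"
  then obtain V g where V: "open V" "x \<in> V" "Ck_on 1 V g" "\<forall>y\<in>V \<inter> S. g y = f y"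
    unfolding C1_on_def by blast
  obtain r where r: "r > 0" "ball x r \<subseteq> V" using V by (meson openE)
  have "isCont g x" using Ck1D(3)[OF V(3)] V(1,2) by (simp add: continuous_on_eq_continuous_at)
  then have "continuous (at x within S) g" by (rule continuous_at_imp_continuous_at_within)
  then show "continuous (at x within S) f"
    by (rule continuous_transform_within[OF _ r(1) \<open>x \<in> S\<close>]) (use V r in \<open>auto simp: dist_commute subset_iff\<close>)
qed

section \<open>Charts, transition maps and C^1 maps on a manifold with corners\<close>

definition C1_map :: "('p, 'n::finite) chart set \<Rightarrow> ('p \<Rightarrow> 'b::euclidean_space) \<Rightarrow> bool" where
  "C1_map A f \<longleftrightarrow> (\<forall>c\<in>A. C1_on (snd c ` fst c) (in_chart c f))"

lemma smooth_map_C1_map: "smooth_map A f \<Longrightarrow> C1_map A f"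
  by (auto simp: smooth_map_def C1_map_def intro: smooth_on_C1_on)

locale corner_mfd =
  fixes T :: "'p topology" and A :: "('p, 'n::finite) chart set" and K :: "'n set"
  assumes M: "corner_manifold T A K"
begin

lemma chart_open: "c \<in> A \<Longrightarrow> openin T (fst c)"
  using M by (auto simp: corner_manifold_def)

lemma chart_img_open: "c \<in> A \<Longrightarrow> openin (top_of_set (corner K)) (snd c ` fst c)"
  using M by (auto simp: corner_manifold_def)

lemma chart_homeo: "c \<in> A \<Longrightarrow> homeomorphic_map (subtopology T (fst c)) (top_of_set (snd c ` fst c)) (snd c)"
  using M by (auto simp: corner_manifold_def)

lemma chart_sub: "c \<in> A \<Longrightarrow> fst c \<subseteq> topspace T"
  using chart_open openin_subset by blast

lemma chart_inj: "c \<in> A \<Longrightarrow> inj_on (snd c) (fst c)"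
  using homeomorphic_imp_injective_map[OF chart_homeo[of c]] chart_sub[of c] by (simp add: inf.absorb2)

lemma chart_cover: "p \<in> topspace T \<Longrightarrow> \<exists>c\<in>A. p \<in> fst c"
  using M unfolding corner_manifold_def by blast

lemma chart_inv: "c \<in> A \<Longrightarrow> p \<in> fst c \<Longrightarrow> inv_into (fst c) (snd c) (snd c p) = p"
  using chart_inj inv_into_f_f by metis

lemma in_chart_apply: "c \<in> A \<Longrightarrow> p \<in> fst c \<Longrightarrow> in_chart c f (snd c p) = f p"
  by (simp add: in_chart_def chart_inv)

lemma chart_open_image:
  assumes "c \<in> A" "openin T W"
  shows "openin (top_of_set (corner K)) (snd c ` (fst c \<inter> W))"
proof -
  have "openin (subtopology T (fst c)) (fst c \<inter> W)" using assms(2) by (simp add: openin_subtopology_Int2)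
  then have "openin (top_of_set (snd c ` fst c)) (snd c ` (fst c \<inter> W))"
    using homeomorphic_imp_open_map[OF chart_homeo[OF assms(1)]] unfolding open_map_def by blast
  then show ?thesis using chart_img_open[OF assms(1)] by (rule openin_trans)
qed

lemma chart_open_preimage:
  assumes "c \<in> A" "open V"
  shows "openin T {p \<in> fst c. snd c p \<in> V}"
proof -
  have "continuous_map (subtopology T (fst c)) (top_of_set (snd c ` fst c)) (snd c)"
    using chart_homeo[OF assms(1)] by (rule homeomorphic_imp_continuous_map)
  moreover have "openin (top_of_set (snd c ` fst c)) (snd c ` fst c \<inter> V)" using assms(2) by blast
  ultimately have "openin (subtopology T (fst c)) {p \<in> topspace (subtopology T (fst c)). snd c p \<in> snd c ` fst c \<inter> V}"
    by (rule openin_continuous_map_preimage)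
  moreover have "{p \<in> topspace (subtopology T (fst c)). snd c p \<in> snd c ` fst c \<inter> V} = {p \<in> fst c. snd c p \<in> V}"
    using chart_sub[OF assms(1)] by auto
  ultimately show ?thesis using openin_trans_full chart_open[OF assms(1)] by metis
qed

text \<open>Compactness passes through the inverse chart. In a Hausdorff space such sets are closed,
  which is what the extension of bump functions by zero relies on.\<close>

lemma chart_compact_preimage:
  assumes "c \<in> A" "compact D" "D \<subseteq> snd c ` fst c"
  shows "compactin T {p \<in> fst c. snd c p \<in> D}"
proof -
  obtain g where g: "homeomorphic_maps (subtopology T (fst c)) (top_of_set (snd c ` fst c)) (snd c) g"
    using chart_homeo[OF assms(1)] homeomorphic_map_maps by blast
  then have "continuous_map (top_of_set (snd c ` fst c)) (subtopology T (fst c)) g"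
    by (simp add: homeomorphic_maps_def)
  moreover have "compactin (top_of_set (snd c ` fst c)) D"
    using assms(2,3) by (simp add: compactin_subtopology)
  ultimately have "compactin (subtopology T (fst c)) (g ` D)"
    by (rule image_compactin[rotated])
  then have "compactin T (g ` D)" by (simp add: compactin_subtopology)
  moreover have gp: "g (snd c p) = p" if "p \<in> fst c" for p
    using g that chart_sub[OF assms(1)] by (auto simp: homeomorphic_maps_def)
  have "g ` D = {p \<in> fst c. snd c p \<in> D}"
  proof (intro equalityI subsetI)
    fix p assume "p \<in> g ` D"
    then obtain y where y: "y \<in> D" "p = g y" by blast
    then obtain q where "q \<in> fst c" "y = snd c q" using assms(3) by blast
    then show "p \<in> {p \<in> fst c. snd c p \<in> D}" using gp y by simp
  next
    fix p assume "p \<in> {p \<in> fst c. snd c p \<in> D}"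
    then show "p \<in> g ` D" using gp[of p] by (intro image_eqI[of _ _ "snd c p"]) auto
  qed
  ultimately show ?thesis by simp
qed

lemma C1_map_derivative:
  assumes "C1_map A f" "c \<in> A" "p \<in> fst c"
  shows "(in_chart c f has_derivative chart_diff c f p) (at (snd c p) within snd c ` fst c)"
  unfolding chart_diff_def
  by (rule C1_on_has_derivative[OF chart_img_open]) (use assms in \<open>auto simp: C1_map_def\<close>)

lemma C1_map_linear:
  assumes "C1_map A f" "c \<in> A" "p \<in> fst c"
  shows "linear (chart_diff c f p)"
  by (rule has_derivative_linear[OF C1_map_derivative[OF assms]])

lemma chart_diff_eqI:
  assumes "c \<in> A" "p \<in> fst c" "(in_chart c f has_derivative L) (at (snd c p) within snd c ` fst c)"
  shows "chart_diff c f p = L"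
proof -
  have "in_chart c f differentiable (at (snd c p) within snd c ` fst c)" using assms(3) by (auto simp: differentiable_def)
  then have "(in_chart c f has_derivative chart_diff c f p) (at (snd c p) within snd c ` fst c)"
    unfolding chart_diff_def frechet_derivative_works .
  then show ?thesis
    using corner_derivative_unique[OF chart_img_open[OF assms(1)]] assms by blast
qed

lemma chart_diff_continuous:
  assumes "C1_map A f" "c \<in> A"
  shows "continuous_on (snd c ` fst c) (in_chart c (\<lambda>p. chart_diff c f p v))"
proof -
  have "continuous_on (snd c ` fst c) (\<lambda>y. frechet_derivative (in_chart c f) (at y within snd c ` fst c) v)"
    by (rule C1_on_continuous_derivative[OF chart_img_open]) (use assms in \<open>auto simp: C1_map_def\<close>)
  then show ?thesis
    by (rule continuous_on_eq) (use chart_inv[OF assms(2)] in \<open>auto simp: in_chart_def chart_diff_def\<close>)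
qed

definition transition_diff :: "('p, 'n) chart \<Rightarrow> ('p, 'n) chart \<Rightarrow> 'p \<Rightarrow> real^'n \<Rightarrow> real^'n" where
  "transition_diff c d p = frechet_derivative (in_chart c (snd d)) (at (snd c p) within snd c ` (fst c \<inter> fst d))"

lemma transition_derivative:
  assumes "c \<in> A" "d \<in> A" "p \<in> fst c" "p \<in> fst d"
  shows "(in_chart c (snd d) has_derivative transition_diff c d p) (at (snd c p) within snd c ` (fst c \<inter> fst d))"
  unfolding transition_diff_def
proof (rule C1_on_has_derivative)
  show "openin (top_of_set (corner K)) (snd c ` (fst c \<inter> fst d))"
    by (rule chart_open_image[OF assms(1) chart_open[OF assms(2)]])
  show "C1_on (snd c ` (fst c \<inter> fst d)) (in_chart c (snd d))"
    using M assms(1,2) by (intro smooth_on_C1_on) (auto simp: corner_manifold_def)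
qed (use assms in auto)

lemma transition_C1:
  assumes "c \<in> A" "d \<in> A"
  shows "C1_on (snd c ` (fst c \<inter> fst d)) (in_chart c (snd d))"
  using M assms by (intro smooth_on_C1_on) (auto simp: corner_manifold_def)

text \<open>Chain rule on the image of the overlap. This set is relatively open in the corner, so
  derivatives within it are unique and agree with those within the full chart image.\<close>

lemma chart_change:
  assumes "c \<in> A" "d \<in> A" "p \<in> fst c" "p \<in> fst d" and f: "C1_map A f"
  shows "chart_diff c f p w = chart_diff d f p (transition_diff c d p w)"
proof -
  let ?O = "snd c ` (fst c \<inter> fst d)"
  have O: "openin (top_of_set (corner K)) ?O"
    by (rule chart_open_image[OF assms(1) chart_open[OF assms(2)]])
  have im: "in_chart c (snd d) ` ?O \<subseteq> snd d ` fst d"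
    by (auto simp: in_chart_apply[OF assms(1)])
  have at: "in_chart c (snd d) (snd c p) = snd d p" by (rule in_chart_apply[OF assms(1,3)])
  have "(in_chart d f \<circ> in_chart c (snd d) has_derivative chart_diff d f p \<circ> transition_diff c d p) (at (snd c p) within ?O)"
    by (rule diff_chain_within[OF transition_derivative[OF assms(1-4)]], unfold at,
        rule has_derivative_subset[OF C1_map_derivative[OF f assms(2,4)] im])
  moreover have "(in_chart d f \<circ> in_chart c (snd d)) y = in_chart c f y" if "y \<in> ?O" for y
    using that by (auto simp: in_chart_apply assms)
  ultimately have "(in_chart c f has_derivative chart_diff d f p \<circ> transition_diff c d p) (at (snd c p) within ?O)"
    using has_derivative_transform[of "snd c p" ?O "in_chart c f" "in_chart d f \<circ> in_chart c (snd d)"] assms(3,4) by auto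
  moreover have "(in_chart c f has_derivative chart_diff c f p) (at (snd c p) within ?O)"
    by (rule has_derivative_subset[OF C1_map_derivative[OF f assms(1,3)]]) auto
  ultimately have "chart_diff c f p = chart_diff d f p \<circ> transition_diff c d p"
    using corner_derivative_unique[OF O _] assms(3,4) by (metis IntI imageI)
  then show ?thesis by simp
qed

text \<open>The support lies in the preimage of a compact set, which is closed in the Hausdorff
  space. So every point has a neighbourhood inside the chart \<open>c\<close> or one on which the
  function is zero.\<close>

lemma C1_map_bump:
  fixes h :: "real^'n \<Rightarrow> real"
  assumes c: "c \<in> A" and h: "C1_on UNIV h" and D: "compact D" "D \<inter> corner K \<subseteq> snd c ` fst c"
    and zero: "\<And>y. y \<notin> D \<Longrightarrow> h y = 0"
  shows "C1_map A (\<lambda>q. if q \<in> fst c then h (snd c q) else 0)" (is "C1_map A ?b")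
  unfolding C1_map_def
proof (intro ballI C1_on_local)
  fix d y assume d: "d \<in> A" and y: "y \<in> snd d ` fst d"
  let ?Z = "{p \<in> fst c. snd c p \<in> D \<inter> corner K}"
  have Z: "closedin T ?Z"
    by (rule compactin_imp_closedin[OF _ chart_compact_preimage[OF c]])
      (use M D corner_closed in \<open>auto simp: corner_manifold_def compact_Int_closed\<close>)
  have img: "snd c p \<in> corner K" if "p \<in> fst c" for p
    using chart_img_open[OF c] openin_subset that by fastforce
  obtain q where q: "q \<in> fst d" "y = snd d q" using y by blast
  have sub: "openin (top_of_set (snd d ` fst d)) (snd d ` (fst d \<inter> W))" if "openin T W" for W
    using chart_open_image[OF d that] by (rule openin_subset_trans) (use chart_img_open[OF d] openin_subset in fastforce)+
  show "\<exists>N. openin (top_of_set (snd d ` fst d)) N \<and> y \<in> N \<and> C1_on N (in_chart d ?b)"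
  proof (cases "q \<in> fst c")
    case True
    have "C1_on (snd d ` (fst d \<inter> fst c)) (in_chart d ?b)"
    proof (rule C1_on_cong[OF C1_on_compose[OF h transition_C1[OF d c]]])
      show "h (in_chart d (snd c) y) = in_chart d ?b y" if "y \<in> snd d ` (fst d \<inter> fst c)" for y
        using that by (auto simp: in_chart_apply[OF d])
    qed auto
    then show ?thesis using q True sub[OF chart_open[OF c]] by blast
  next
    case False
    let ?W = "topspace T - ?Z"
    have "in_chart d ?b y = 0" if "y \<in> snd d ` (fst d \<inter> ?W)" for y
      using that zero img by (clarsimp simp: in_chart_apply[OF d] split: if_splits) blast
    then have "C1_on (snd d ` (fst d \<inter> ?W)) (in_chart d ?b)"
      by (intro C1_on_cong[OF C1_on_const[of _ 0]]) auto
    moreover have "y \<in> snd d ` (fst d \<inter> ?W)" using q False chart_sub[OF d] by auto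
    ultimately show ?thesis using sub[of ?W] Z by (auto simp: openin_diff)
  qed
qed

lemma continuous_map_charts:
  fixes f :: "'p \<Rightarrow> 'b::topological_space"
  assumes "\<And>c. c \<in> A \<Longrightarrow> continuous_on (snd c ` fst c) (in_chart c f)"
  shows "continuous_map T euclidean f"
proof -
  have "openin T {p \<in> topspace T. f p \<in> V}" if V: "open V" for V
  proof -
    have "openin T {p \<in> fst c. f p \<in> V}" if c: "c \<in> A" for c
    proof -
      have "openin (top_of_set (snd c ` fst c)) (snd c ` fst c \<inter> in_chart c f -` V)"
        by (rule continuous_openin_preimage_gen[OF assms[OF c] V])
      then obtain W where W: "open W" "snd c ` fst c \<inter> in_chart c f -` V = snd c ` fst c \<inter> W"
        by (auto simp: openin_open)
      have "{p \<in> fst c. f p \<in> V} = {p \<in> fst c. snd c p \<in> W}"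
      proof (rule Collect_cong)
        fix p
        show "(p \<in> fst c \<and> f p \<in> V) = (p \<in> fst c \<and> snd c p \<in> W)"
          using W(2)[unfolded set_eq_iff, rule_format, of "snd c p"] in_chart_apply[OF c, of p f] by auto
      qed
      then show ?thesis using chart_open_preimage[OF c W(1)] by simp
    qed
    moreover have eq: "{p \<in> topspace T. f p \<in> V} = (\<Union>c\<in>A. {p \<in> fst c. f p \<in> V})"
      using chart_cover chart_sub by blast
    ultimately show ?thesis unfolding eq by (intro openin_Union) blast
  qed
  then show ?thesis by (simp add: continuous_map_def)
qed

end

section \<open>Change of variables over an arbitrary finite index type\<close>

text \<open>The change of variables theorem of the library needs a well-ordered index type. The copy
  below of an arbitrary finite type carries such an order.\<close>

typedef ('a::finite) wo = "UNIV :: 'a set" by simp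

instance wo :: (finite) finite
proof
  have "a \<in> Abs_wo ` (UNIV :: 'a set)" for a :: "'a wo"
    by (rule image_eqI[of _ _ "Rep_wo a"]) (simp_all add: Rep_wo_inverse)
  then show "finite (UNIV :: 'a wo set)"
    by (intro finite_subset[OF _ finite_imageI[of "UNIV :: 'a set" Abs_wo]]) auto
qed

instantiation wo :: (finite) wellorder
begin

definition less_eq_wo :: "'a wo \<Rightarrow> 'a wo \<Rightarrow> bool" where
  "less_eq_wo a b \<longleftrightarrow> to_nat (Rep_wo a) \<le> to_nat (Rep_wo b)"

definition less_wo :: "'a wo \<Rightarrow> 'a wo \<Rightarrow> bool" where
  "less_wo a b \<longleftrightarrow> to_nat (Rep_wo a) < to_nat (Rep_wo b)"

instance
proof
  fix P :: "'a wo \<Rightarrow> bool" and a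
  assume H: "\<And>x. (\<And>y. y < x \<Longrightarrow> P y) \<Longrightarrow> P x"
  show "P a" by (rule measure_induct_rule[where f="\<lambda>a. to_nat (Rep_wo a)"]) (rule H, simp add: less_wo_def)
qed (auto simp: less_eq_wo_def less_wo_def Rep_wo_inject)

end

definition to_wo :: "real^'n \<Rightarrow> real^('n wo)" where "to_wo y = (\<chi> a. y $ Rep_wo a)"

definition from_wo :: "real^('n wo) \<Rightarrow> real^'n" where "from_wo y = (\<chi> i. y $ Abs_wo i)"

lemma from_to_wo [simp]: "from_wo (to_wo y) = y" and to_from_wo [simp]: "to_wo (from_wo z) = z"
  by (simp_all add: to_wo_def from_wo_def vec_eq_iff Abs_wo_inverse Rep_wo_inverse)

lemma linear_to_wo: "linear to_wo" and linear_from_wo: "linear from_wo"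
  by (auto intro!: linearI simp: to_wo_def from_wo_def vec_eq_iff)

lemma bounded_linear_to_wo: "bounded_linear to_wo" and bounded_linear_from_wo: "bounded_linear from_wo"
  using linear_to_wo linear_from_wo by (simp_all add: linear_conv_bounded_linear)

lemma measurable_to_wo [measurable]: "to_wo \<in> borel \<rightarrow>\<^sub>M borel"
  and measurable_from_wo [measurable]: "from_wo \<in> borel \<rightarrow>\<^sub>M borel"
  by (intro borel_measurable_continuous_onI bounded_linear.continuous_on[OF bounded_linear_to_wo]
      bounded_linear.continuous_on[OF bounded_linear_from_wo] continuous_on_id)+

lemma bij_Abs_wo: "bij (Abs_wo :: 'n::finite \<Rightarrow> 'n wo)"
  by (rule bijI') (auto simp: Abs_wo_inject intro: Rep_wo_inverse[symmetric])

lemma prod_Basis_cart: "(\<Prod>b\<in>(Basis :: (real^'n) set). g (v \<bullet> b)) = (\<Prod>i\<in>UNIV. g (v $ i))"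
proof -
  have B: "(Basis :: (real^'n) set) = range (\<lambda>i. axis i 1)" by (auto simp: Basis_vec_def)
  have inj: "inj (\<lambda>i. axis i 1 :: real^'n)" by (auto simp: inj_on_def axis_eq_axis)
  show ?thesis unfolding B by (subst prod.reindex[OF inj]) (simp add: inner_axis)
qed

text \<open>Relabelling coordinates maps boxes to boxes with the same side lengths, and Lebesgue
  measure is determined by its values on boxes.\<close>

lemma distr_to_wo: "distr lborel borel (to_wo :: real^'n \<Rightarrow> _) = lborel"
proof (rule lborel_eqI[symmetric])
  fix l u :: "real^('n wo)" assume lu: "\<And>b. b \<in> Basis \<Longrightarrow> l \<bullet> b \<le> u \<bullet> b"
  have le: "l $ a \<le> u $ a" for a using lu[of "axis a 1"] by (simp add: inner_axis axis_in_Basis_iff)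
  have pre: "to_wo -` box l u = box (from_wo l) (from_wo u)"
    by (auto simp: mem_box_cart to_wo_def from_wo_def) (metis Rep_wo_inverse Abs_wo_inverse UNIV_I)+
  have "emeasure (distr lborel borel to_wo) (box l u) = emeasure lborel (box (from_wo l) (from_wo u))"
    by (simp add: emeasure_distr pre)
  also have "\<dots> = ennreal (\<Prod>b\<in>Basis. (from_wo u - from_wo l) \<bullet> b)"
    using le by (intro emeasure_lborel_box) (auto simp: Basis_vec_def inner_axis from_wo_def)
  also have "(\<Prod>b\<in>Basis. (from_wo u - from_wo l) \<bullet> b) = (\<Prod>i\<in>UNIV. (from_wo u - from_wo l) $ i)"
    by (rule prod_Basis_cart[where g = "\<lambda>x. x"])
  also have "\<dots> = (\<Prod>i\<in>UNIV. (u - l) $ Abs_wo i)" by (simp add: from_wo_def)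
  also have "\<dots> = (\<Prod>a\<in>UNIV. (u - l) $ a)" by (rule prod.reindex_bij_betw[OF bij_Abs_wo])
  also have "\<dots> = (\<Prod>b\<in>Basis. (u - l) \<bullet> b)" by (rule prod_Basis_cart[where g = "\<lambda>x. x", symmetric])
  finally show "emeasure (distr lborel borel to_wo) (box l u) = ennreal (\<Prod>b\<in>Basis. (u - l) \<bullet> b)" .
qed simp

lemma nn_integral_to_wo:
  assumes "f \<in> borel_measurable borel"
  shows "(\<integral>\<^sup>+z. f (from_wo z) \<partial>lborel) = (\<integral>\<^sup>+y. f y \<partial>lborel)"
proof -
  have "(\<integral>\<^sup>+z. f (from_wo z) \<partial>lborel) = (\<integral>\<^sup>+z. f (from_wo z) \<partial>distr lborel borel to_wo)"
    by (simp only: distr_to_wo)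
  also have "\<dots> = (\<integral>\<^sup>+y. f (from_wo (to_wo y)) \<partial>lborel)"
    using assms by (intro nn_integral_distr) auto
  finally show ?thesis by simp
qed

text \<open>Rows and columns are relabelled by the same bijection: this is \<open>det_embed\<close>
  for an embedding that is onto.\<close>

lemma det_to_wo:
  fixes J :: "real^'n \<Rightarrow> real^'n"
  assumes "linear J"
  shows "det (matrix (to_wo \<circ> J \<circ> from_wo)) = det (matrix J)"
proof -
  have inv: "inv Abs_wo = (Rep_wo :: 'n wo \<Rightarrow> 'n)"
    by (rule inv_equality) (auto simp: Abs_wo_inverse Rep_wo_inverse)
  have rng: "range (Abs_wo :: 'n \<Rightarrow> 'n wo) = UNIV" using bij_Abs_wo by (rule bij_is_surj)
  have ax: "from_wo (axis b 1) = (axis (Rep_wo b) 1 :: real^'n)" for b :: "'n wo"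
    by (auto simp: from_wo_def axis_def vec_eq_iff Rep_wo_inverse Abs_wo_inverse)
  have "matrix (to_wo \<circ> J \<circ> from_wo) =
     (\<chi> a b. if a \<in> range Abs_wo then (if b \<in> range Abs_wo then matrix J $ inv Abs_wo a $ inv Abs_wo b else 0) else of_bool (a = b))"
    by (simp add: vec_eq_iff matrix_def rng inv ax to_wo_def)
  then show ?thesis
    by (simp only: det_embed[OF bij_is_inj[OF bij_Abs_wo]])
qed

text \<open>The change of variables theorem is about functions with values in \<open>real^_\<close>.
  Multiplication by a unit vector takes a scalar function there, and the inner product with that
  vector takes it back.\<close>

lemma has_integral_iff_lifted:
  fixes h :: "'a::euclidean_space \<Rightarrow> real" and w :: "'b::euclidean_space"
  assumes "\<And>x. x \<in> S \<Longrightarrow> 0 \<le> h x" and w: "w \<bullet> w = 1"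
  shows "(h has_integral r) S \<longleftrightarrow>
    (\<lambda>x. h x *\<^sub>R w) absolutely_integrable_on S \<and> integral S (\<lambda>x. h x *\<^sub>R w) = r *\<^sub>R w"
proof
  assume h: "(h has_integral r) S"
  then have "h absolutely_integrable_on S"
    using assms(1) by (intro nonnegative_absolutely_integrable_1) auto
  then have "integrable lebesgue (\<lambda>x. (indicator S x *\<^sub>R h x) *\<^sub>R w)"
    unfolding set_integrable_def by (rule integrable_scaleR_left)
  moreover have "((\<lambda>x. h x *\<^sub>R w) has_integral r *\<^sub>R w) S"
    using h by (rule has_integral_scaleR_left)
  ultimately show "(\<lambda>x. h x *\<^sub>R w) absolutely_integrable_on S \<and> integral S (\<lambda>x. h x *\<^sub>R w) = r *\<^sub>R w"
    by (auto simp: set_integrable_def integral_unique)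
next
  assume a: "(\<lambda>x. h x *\<^sub>R w) absolutely_integrable_on S \<and> integral S (\<lambda>x. h x *\<^sub>R w) = r *\<^sub>R w"
  then have "(\<lambda>x. h x *\<^sub>R w) integrable_on S" using set_lebesgue_integral_eq_integral(1) by blast
  then have "((\<lambda>x. h x *\<^sub>R w) has_integral r *\<^sub>R w) S" using a by (metis integrable_integral)
  then have "((\<lambda>v. v \<bullet> w) \<circ> (\<lambda>x. h x *\<^sub>R w) has_integral (r *\<^sub>R w) \<bullet> w) S"
    by (rule has_integral_linear) (rule bounded_linear_inner_left)
  then show "(h has_integral r) S" using w by (simp add: o_def)
qed

lemma has_integral_change_of_variables_nonneg:
  fixes g :: "real^'n::{finite,wellorder} \<Rightarrow> real^'n::_" and f :: "real^'n::_ \<Rightarrow> real"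
  assumes "E \<in> sets lebesgue" "\<And>x. x \<in> E \<Longrightarrow> (g has_derivative g' x) (at x within E)" "inj_on g E"
    and f: "\<And>x. x \<in> g ` E \<Longrightarrow> 0 \<le> f x"
  shows "((\<lambda>x. \<bar>det (matrix (g' x))\<bar> * f (g x)) has_integral r) E \<longleftrightarrow> (f has_integral r) (g ` E)"
proof -
  let ?w = "axis 1 1 :: real^1"
  have w: "?w \<bullet> ?w = 1" by (simp add: inner_axis)
  show ?thesis
    using has_absolute_integral_change_of_variables[OF assms(1-3), of "\<lambda>x. f x *\<^sub>R ?w" "r *\<^sub>R ?w"]
      has_integral_iff_lifted[OF f w, of "g ` E" "\<lambda>x. x" r]
      has_integral_iff_lifted[of E "\<lambda>x. \<bar>det (matrix (g' x))\<bar> * f (g x)" ?w r, OF _ w] f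
    by (simp add: mult.commute)
qed

lemma nn_integral_eq_has_integral:
  fixes f :: "'a::euclidean_space \<Rightarrow> real"
  assumes "(\<lambda>y. indicator S y * f y) \<in> borel_measurable borel" "\<And>y. y \<in> S \<Longrightarrow> 0 \<le> f y" "0 \<le> r"
  shows "(\<integral>\<^sup>+y. ennreal (f y) * indicator S y \<partial>lborel) = ennreal r \<longleftrightarrow> (f has_integral r) S"
proof
  have eq: "ennreal (f y) * indicator S y = ennreal (indicator S y * f y)" for y
    by (auto simp: indicator_def)
  assume "(\<integral>\<^sup>+y. ennreal (f y) * indicator S y \<partial>lborel) = ennreal r"
  then have "((\<lambda>y. indicator S y * f y) has_integral r) UNIV"
    unfolding eq by (intro nn_integral_has_integral) (use assms in \<open>auto simp: indicator_def\<close>)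
  moreover have "(\<lambda>y. indicator S y * f y) = (\<lambda>y. if y \<in> S then f y else 0)" by (auto simp: indicator_def)
  ultimately show "(f has_integral r) S" by (simp add: has_integral_restrict_UNIV)
next
  assume "(f has_integral r) S"
  then show "(\<integral>\<^sup>+y. ennreal (f y) * indicator S y \<partial>lborel) = ennreal r"
    using nn_integral_has_integral_lebesgue'[of S f r] assms(2) by blast
qed

text \<open>For each finite \<open>r\<close> the statement about integrable functions shows that one
  side equals \<open>r\<close> exactly if the other does. This forces equality in
  \<open>ennreal\<close>, the infinite value included.\<close>

lemma nn_integral_change_of_variables_wo:
  fixes g :: "real^'n::{finite,wellorder} \<Rightarrow> real^'n::_" and f :: "real^'n::_ \<Rightarrow> real"
  assumes E: "E \<in> sets borel" and g: "\<And>x. x \<in> E \<Longrightarrow> (g has_derivative g' x) (at x within E)" "inj_on g E"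
    and f: "\<And>x. x \<in> g ` E \<Longrightarrow> 0 \<le> f x"
    and m1: "(\<lambda>y. indicator (g ` E) y * f y) \<in> borel_measurable borel"
    and m2: "(\<lambda>y. indicator E y * (\<bar>det (matrix (g' y))\<bar> * f (g y))) \<in> borel_measurable borel"
  shows "(\<integral>\<^sup>+y. ennreal (\<bar>det (matrix (g' y))\<bar> * f (g y)) * indicator E y \<partial>lborel) = (\<integral>\<^sup>+y. ennreal (f y) * indicator (g ` E) y \<partial>lborel)"
    (is "?L = ?R")
proof -
  have E': "E \<in> sets lebesgue" using E by simp
  have key: "?L = ennreal r \<longleftrightarrow> ?R = ennreal r" if "0 \<le> r" for r
  proof -
    have "?L = ennreal r \<longleftrightarrow> ((\<lambda>x. \<bar>det (matrix (g' x))\<bar> * f (g x)) has_integral r) E"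
      by (rule nn_integral_eq_has_integral[OF m2 _ that]) (use f in auto)
    also have "\<dots> \<longleftrightarrow> (f has_integral r) (g ` E)"
      by (rule has_integral_change_of_variables_nonneg[OF E' g f])
    also have "\<dots> \<longleftrightarrow> ?R = ennreal r"
      by (rule nn_integral_eq_has_integral[OF m1 f that, symmetric])
    finally show ?thesis .
  qed
  show ?thesis
  proof (cases ?L rule: ennreal_cases)
    case (real r) then show ?thesis using key[of r] by simp
  next
    case top
    then show ?thesis using key by (cases ?R rule: ennreal_cases) auto
  qed
qed

lemma nn_integral_change_of_variables:
  fixes g :: "real^'n \<Rightarrow> real^'n" and f :: "real^'n \<Rightarrow> real"
  assumes E: "E \<in> sets borel" and g: "\<And>x. x \<in> E \<Longrightarrow> (g has_derivative g' x) (at x within E)" "inj_on g E"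
    and f: "\<And>x. x \<in> g ` E \<Longrightarrow> 0 \<le> f x"
    and m1: "(\<lambda>y. indicator (g ` E) y * f y) \<in> borel_measurable borel"
    and m2: "(\<lambda>y. indicator E y * (\<bar>det (matrix (g' y))\<bar> * f (g y))) \<in> borel_measurable borel"
  shows "(\<integral>\<^sup>+y. ennreal (\<bar>det (matrix (g' y))\<bar> * f (g y)) * indicator E y \<partial>lborel) = (\<integral>\<^sup>+y. ennreal (f y) * indicator (g ` E) y \<partial>lborel)"
proof -
  let ?g = "to_wo \<circ> g \<circ> from_wo" and ?f = "f \<circ> from_wo" and ?E = "to_wo ` E"
  let ?g' = "\<lambda>z. to_wo \<circ> g' (from_wo z) \<circ> from_wo"
  have mem: "z \<in> to_wo ` X \<longleftrightarrow> from_wo z \<in> X" for z and X :: "(real^'n) set"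
    by (metis from_to_wo imageE image_eqI to_from_wo)
  have im: "?g ` ?E = to_wo ` (g ` E)" by (auto simp: image_iff)
  have "?E = from_wo -` E" using mem by auto
  then have E2: "?E \<in> sets borel" using measurable_sets[OF measurable_from_wo E] by simp
  have d: "(?g has_derivative ?g' z) (at z within ?E)" if "z \<in> ?E" for z
  proof -
    have z: "from_wo z \<in> E" using that mem by blast
    have 1: "(from_wo has_derivative from_wo) (at z within ?E)"
      by (rule bounded_linear_imp_has_derivative[OF bounded_linear_from_wo])
    have fE: "from_wo ` ?E = E" by (auto simp: image_image)
    have 2: "(g \<circ> from_wo has_derivative g' (from_wo z) \<circ> from_wo) (at z within ?E)"
      by (rule diff_chain_within[OF 1]) (use g(1)[OF z] fE in simp)
    have "(to_wo \<circ> (g \<circ> from_wo) has_derivative to_wo \<circ> (g' (from_wo z) \<circ> from_wo)) (at z within ?E)"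
      by (rule diff_chain_within[OF 2 bounded_linear_imp_has_derivative[OF bounded_linear_to_wo]])
    then show ?thesis by (simp add: o_assoc)
  qed
  have dets: "det (matrix (?g' z)) = det (matrix (g' (from_wo z)))" if "from_wo z \<in> E" for z
    using has_derivative_linear[OF g(1)[OF that]] by (rule det_to_wo)
  have inj: "inj_on ?g ?E"
    using g(2) by (auto simp: inj_on_def) (metis from_to_wo)
  have "(\<integral>\<^sup>+z. ennreal (\<bar>det (matrix (?g' z))\<bar> * ?f (?g z)) * indicator ?E z \<partial>lborel) = (\<integral>\<^sup>+z. ennreal (?f z) * indicator (?g ` ?E) z \<partial>lborel)"
  proof (rule nn_integral_change_of_variables_wo[OF E2 d inj])
    show "0 \<le> ?f z" if "z \<in> ?g ` ?E" for z using f that unfolding im mem by auto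
    have "(\<lambda>z. indicator (?g ` ?E) z * ?f z) = (\<lambda>y. indicator (g ` E) y * f y) \<circ> from_wo"
      unfolding im by (auto simp: fun_eq_iff mem indicator_def)
    then show "(\<lambda>z. indicator (?g ` ?E) z * ?f z) \<in> borel_measurable borel"
      using measurable_comp[OF measurable_from_wo m1] by simp
    have "(\<lambda>z. indicator ?E z * (\<bar>det (matrix (?g' z))\<bar> * ?f (?g z))) = (\<lambda>y. indicator E y * (\<bar>det (matrix (g' y))\<bar> * f (g y))) \<circ> from_wo"
      using dets by (auto simp: fun_eq_iff mem indicator_def)
    then show "(\<lambda>z. indicator ?E z * (\<bar>det (matrix (?g' z))\<bar> * ?f (?g z))) \<in> borel_measurable borel"
      using measurable_comp[OF measurable_from_wo m2] by simp
  qed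
  moreover have "(\<integral>\<^sup>+z. ennreal (?f z) * indicator (?g ` ?E) z \<partial>lborel) = (\<integral>\<^sup>+y. ennreal (f y) * indicator (g ` E) y \<partial>lborel)"
  proof -
    have m: "(\<lambda>y. ennreal (indicator (g ` E) y * f y)) \<in> borel_measurable borel" using m1 by simp
    have "(\<integral>\<^sup>+z. ennreal (?f z) * indicator (?g ` ?E) z \<partial>lborel) = (\<integral>\<^sup>+z. ennreal (indicator (g ` E) (from_wo z) * f (from_wo z)) \<partial>lborel)"
      unfolding im by (intro nn_integral_cong) (auto simp: mem indicator_def)
    also have "\<dots> = (\<integral>\<^sup>+y. ennreal (indicator (g ` E) y * f y) \<partial>lborel)" by (rule nn_integral_to_wo[OF m])
    also have "\<dots> = (\<integral>\<^sup>+y. ennreal (f y) * indicator (g ` E) y \<partial>lborel)"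
      by (intro nn_integral_cong) (auto simp: indicator_def)
    finally show ?thesis .
  qed
  moreover have "(\<integral>\<^sup>+z. ennreal (\<bar>det (matrix (?g' z))\<bar> * ?f (?g z)) * indicator ?E z \<partial>lborel)
     = (\<integral>\<^sup>+y. ennreal (\<bar>det (matrix (g' y))\<bar> * f (g y)) * indicator E y \<partial>lborel)"
  proof -
    have m: "(\<lambda>y. ennreal (indicator E y * (\<bar>det (matrix (g' y))\<bar> * f (g y)))) \<in> borel_measurable borel" using m2 by simp
    have "(\<integral>\<^sup>+z. ennreal (\<bar>det (matrix (?g' z))\<bar> * ?f (?g z)) * indicator ?E z \<partial>lborel)
      = (\<integral>\<^sup>+z. ennreal (indicator E (from_wo z) * (\<bar>det (matrix (g' (from_wo z)))\<bar> * f (g (from_wo z)))) \<partial>lborel)"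
      using dets by (intro nn_integral_cong) (auto simp: mem indicator_def)
    also have "\<dots> = (\<integral>\<^sup>+y. ennreal (indicator E y * (\<bar>det (matrix (g' y))\<bar> * f (g y))) \<partial>lborel)" by (rule nn_integral_to_wo[OF m])
    also have "\<dots> = (\<integral>\<^sup>+y. ennreal (\<bar>det (matrix (g' y))\<bar> * f (g y)) * indicator E y \<partial>lborel)"
      by (intro nn_integral_cong) (auto simp: indicator_def)
    finally show ?thesis .
  qed
  ultimately show ?thesis by simp
qed

text \<open>The Gram matrix transforms by congruence with the matrix of \<open>J\<close>, so its
  determinant acquires a square, whose root is the Jacobian factor of a change of variables.\<close>

lemma area_density_linear_change:
  fixes a b :: "real^'n \<Rightarrow> 'a::euclidean_space"
  assumes b: "linear b" and J: "linear J" and a: "\<And>w. a w = b (J w)"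
  shows "sqrt (det ((\<chi> i j. a (axis i 1) \<bullet> a (axis j 1)) :: real^'n^'n))
       = \<bar>det (matrix J)\<bar> * sqrt (det ((\<chi> i j. b (axis i 1) \<bullet> b (axis j 1)) :: real^'n^'n))"
proof -
  let ?G = "(\<chi> i j. b (axis i 1) \<bullet> b (axis j 1)) :: real^'n^'n"
  have exp: "a (axis i 1) = (\<Sum>k\<in>UNIV. matrix J $ k $ i *\<^sub>R b (axis k 1))" for i
  proof -
    have "J (axis i 1) = (\<Sum>k\<in>UNIV. (J (axis i 1) $ k) *\<^sub>R axis k 1)"
      using basis_expansion[of "J (axis i 1)"] by (simp add: scalar_mult_eq_scaleR)
    then have "a (axis i 1) = b (\<Sum>k\<in>UNIV. (J (axis i 1) $ k) *\<^sub>R axis k 1)" using a by metis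
    then show ?thesis using b by (simp add: linear_sum linear_scale matrix_def)
  qed
  have "(\<chi> i j. a (axis i 1) \<bullet> a (axis j 1)) = transpose (matrix J) ** ?G ** matrix J"
    unfolding exp
    by (simp add: vec_eq_iff matrix_matrix_mult_def transpose_def inner_sum_left inner_sum_right sum_distrib_left sum_distrib_right mult_ac)
  then have "det ((\<chi> i j. a (axis i 1) \<bullet> a (axis j 1)) :: real^'n^'n) = (det (matrix J))\<^sup>2 * det ?G"
    by (simp add: det_mul power2_eq_square)
  then show ?thesis by (simp add: real_sqrt_mult)
qed

section \<open>Borel sets of a topology\<close>

definition borel_of_top :: "'p topology \<Rightarrow> 'p measure" where
  "borel_of_top T = sigma (topspace T) {U. openin T U}"

lemma borel_of_top_facts [simp]:
  "space (borel_of_top T) = topspace T"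
  "sets (borel_of_top T) = sigma_sets (topspace T) {U. openin T U}"
  unfolding borel_of_top_def by (auto intro!: space_measure_of sets_measure_of dest: openin_subset)

lemma openin_borel: "openin T U \<Longrightarrow> U \<in> sets (borel_of_top T)"
  by (auto intro: sigma_sets.Basic)

lemma continuous_map_borel:
  fixes f :: "'p \<Rightarrow> 'b::topological_space"
  assumes "continuous_map T euclidean f"
  shows "f \<in> borel_measurable (borel_of_top T)"
proof (rule borel_measurableI)
  fix S :: "'b set" assume "open S"
  then have "openin T {p \<in> topspace T. f p \<in> S}"
    using assms by (simp add: continuous_map_def)
  moreover have "f -` S \<inter> space (borel_of_top T) = {p \<in> topspace T. f p \<in> S}" by auto
  ultimately show "f -` S \<inter> space (borel_of_top T) \<in> sets (borel_of_top T)" using openin_borel by metis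
qed

section \<open>The area measure\<close>

context corner_mfd
begin

abbreviation "img c \<equiv> snd c ` fst c"
abbreviation "par c \<equiv> inv_into (fst c) (snd c)"

lemma img_borel: "c \<in> A \<Longrightarrow> img c \<in> sets borel"
proof -
  assume "c \<in> A"
  then obtain O1 where "open O1" "img c = corner K \<inter> O1" using chart_img_open by (metis openin_open)
  then show ?thesis using borel_open[of O1] borel_closed[OF corner_closed[of K]] by auto
qed

lemma par_img: "c \<in> A \<Longrightarrow> y \<in> img c \<Longrightarrow> par c y \<in> fst c \<and> snd c (par c y) = y"
  by (simp add: f_inv_into_f inv_into_into)

text \<open>The preimage of an open set is a chart image, relatively open in the closed set
  \<open>corner K\<close> and therefore Borel in the coordinate space.\<close>

lemma par_measurable: "c \<in> A \<Longrightarrow> par c \<in> restrict_space borel (img c) \<rightarrow>\<^sub>M borel_of_top T"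
proof -
  assume c: "c \<in> A"
  show ?thesis
    unfolding borel_of_top_def
  proof (rule measurable_measure_of)
    show "{U. openin T U} \<subseteq> Pow (topspace T)" by (auto dest: openin_subset)
    show "par c \<in> space (restrict_space borel (img c)) \<rightarrow> topspace T"
      using par_img[OF c] chart_sub[OF c] by (auto simp: space_restrict_space)
    fix W assume "W \<in> {U. openin T U}"
    then have "openin (top_of_set (corner K)) (snd c ` (fst c \<inter> W))" using chart_open_image[OF c] by simp
    then obtain O1 where O1: "open O1" "snd c ` (fst c \<inter> W) = corner K \<inter> O1" by (metis openin_open)
    have "par c -` W \<inter> space (restrict_space borel (img c)) = snd c ` (fst c \<inter> W)"
      using chart_inv[OF c] by (auto simp: space_restrict_space)
    moreover have "snd c ` (fst c \<inter> W) \<in> sets borel"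
      unfolding O1(2) using borel_open[OF O1(1)] borel_closed[OF corner_closed[of K]] by auto
    ultimately show "par c -` W \<inter> space (restrict_space borel (img c)) \<in> sets (restrict_space borel (img c))"
      using img_borel[OF c] by (auto simp: sets_restrict_space_iff)
  qed
qed

lemma chart_image_preimage: "c \<in> A \<Longrightarrow> par c -` B \<inter> img c = snd c ` (B \<inter> fst c)"
  using chart_inv by auto

lemma chart_image_borel:
  assumes c: "c \<in> A" and B: "B \<in> sets (borel_of_top T)"
  shows "snd c ` (B \<inter> fst c) \<in> sets borel"
proof -
  have "par c -` B \<inter> space (restrict_space borel (img c)) \<in> sets (restrict_space borel (img c))"
    by (rule measurable_sets[OF par_measurable[OF c] B])
  then show ?thesis
    using img_borel[OF c] chart_image_preimage[OF c, of B] by (auto simp: sets_restrict_space_iff space_restrict_space)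
qed

end

lemma measurable_restrict_lborel:
  "f \<in> restrict_space borel X \<rightarrow>\<^sub>M N \<Longrightarrow> f \<in> restrict_space lborel X \<rightarrow>\<^sub>M N"
proof -
  have "sets (restrict_space lborel X) = sets (restrict_space borel X)" by (rule sets_restrict_space_cong) simp
  then show "f \<in> restrict_space borel X \<rightarrow>\<^sub>M N \<Longrightarrow> f \<in> restrict_space lborel X \<rightarrow>\<^sub>M N"
    using measurable_cong_sets[OF _ refl] by blast
qed

text \<open>The function \<open>sqrt\<close> takes negative values at negative arguments, so the
  sign of \<open>area_density\<close> is not visible from its form. The assumption on it is
  discharged for the hypersurface by identifying the density with the absolute value of a
  determinant.\<close>

locale C1_mfd = corner_mfd T A K for T :: "'p topology" and A :: "('p, 'n::finite) chart set" and K +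
  fixes x :: "'p \<Rightarrow> 'a::euclidean_space"
  assumes C1x: "C1_map A x" and comp: "compact_space T"
    and dens_nonneg: "\<And>c p. c \<in> A \<Longrightarrow> p \<in> fst c \<Longrightarrow> 0 \<le> area_density c x p"
begin

abbreviation "dens c \<equiv> in_chart c (area_density c x)"

lemma dens_continuous: "c \<in> A \<Longrightarrow> continuous_on (img c) (dens c)"
  using chart_diff_continuous[OF C1x, of c]
  unfolding in_chart_def area_density_def det_def vec_lambda_beta
  by (intro continuous_intros) auto

lemma dens_pos: "c \<in> A \<Longrightarrow> y \<in> img c \<Longrightarrow> 0 \<le> dens c y"
  using dens_nonneg[of c] by (auto simp: in_chart_apply)

lemma dens_change:
  assumes "c \<in> A" "d \<in> A" "p \<in> fst c" "p \<in> fst d"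
  shows "area_density c x p = \<bar>det (matrix (transition_diff c d p))\<bar> * area_density d x p"
  unfolding area_density_def
  by (rule area_density_linear_change[OF C1_map_linear[OF C1x assms(2,4)]
        has_derivative_linear[OF transition_derivative[OF assms]] chart_change[OF assms C1x]])

lemma dens_measurable: "c \<in> A \<Longrightarrow> dens c \<in> borel_measurable (restrict_space borel (img c))"
  by (rule borel_measurable_continuous_on_restrict[OF dens_continuous])

lemma dens_indicator_measurable:
  assumes c: "c \<in> A" and B: "B \<in> sets borel" "B \<subseteq> img c"
  shows "(\<lambda>y. indicator B y * dens c y) \<in> borel_measurable borel"
proof -
  have "(\<lambda>y. indicator (img c) y *\<^sub>R dens c y) \<in> borel_measurable borel"
    using dens_measurable[OF c] img_borel[OF c] by (simp add: borel_measurable_restrict_space_iff)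
  then have "(\<lambda>y. indicator B y * (indicator (img c) y *\<^sub>R dens c y)) \<in> borel_measurable borel"
    using B(1) by measurable
  moreover have "(\<lambda>y. indicator B y * (indicator (img c) y *\<^sub>R dens c y)) = (\<lambda>y. indicator B y * dens c y)"
  proof
    fix y show "indicator B y * (indicator (img c) y *\<^sub>R dens c y) = indicator B y * dens c y"
      using B(2) by (cases "y \<in> B") auto
  qed
  ultimately show ?thesis by (simp only:)
qed

text \<open>The push-forward is a measure on the whole space that is concentrated on one chart; the
  area measure is glued from these.\<close>

definition chart_meas :: "('p, 'n) chart \<Rightarrow> 'p measure" where
  "chart_meas c = distr (density (restrict_space lborel (img c)) (\<lambda>y. ennreal (dens c y))) (borel_of_top T) (par c)"

lemma chart_meas_facts [simp]: "space (chart_meas c) = topspace T" "sets (chart_meas c) = sigma_sets (topspace T) {U. openin T U}"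
  by (simp_all add: chart_meas_def)

lemma par_measurable':
  "c \<in> A \<Longrightarrow> par c \<in> density (restrict_space lborel (img c)) (\<lambda>y. ennreal (dens c y)) \<rightarrow>\<^sub>M borel_of_top T"
  using measurable_restrict_lborel[OF par_measurable[of c]] measurable_cong_sets[OF sets_density refl] by blast

lemma emeasure_chart_meas:
  assumes c: "c \<in> A" and B: "B \<in> sets (borel_of_top T)"
  shows "emeasure (chart_meas c) B = (\<integral>\<^sup>+y. ennreal (dens c y) * indicator (snd c ` (B \<inter> fst c)) y \<partial>lborel)"
proof -
  have m: "(\<lambda>y. ennreal (dens c y)) \<in> borel_measurable (restrict_space lborel (img c))"
    by (intro measurable_compose[OF measurable_restrict_lborel[OF dens_measurable[OF c]]] measurable_ennreal)
  have S: "snd c ` (B \<inter> fst c) \<in> sets (restrict_space lborel (img c))"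
    using chart_image_borel[OF c B] img_borel[OF c] by (auto simp: sets_restrict_space_iff)
  have "emeasure (chart_meas c) B = emeasure (density (restrict_space lborel (img c)) (\<lambda>y. ennreal (dens c y))) (par c -` B \<inter> img c)"
    unfolding chart_meas_def using par_measurable'[OF c] B by (subst emeasure_distr) (auto simp: space_restrict_space)
  also have "\<dots> = (\<integral>\<^sup>+y. ennreal (dens c y) * indicator (snd c ` (B \<inter> fst c)) y \<partial>restrict_space lborel (img c))"
    unfolding chart_image_preimage[OF c] by (rule emeasure_density[OF m S])
  also have "\<dots> = (\<integral>\<^sup>+y. ennreal (dens c y) * indicator (snd c ` (B \<inter> fst c)) y * indicator (img c) y \<partial>lborel)"
    using img_borel[OF c] by (intro nn_integral_restrict_space) auto
  also have "\<dots> = (\<integral>\<^sup>+y. ennreal (dens c y) * indicator (snd c ` (B \<inter> fst c)) y \<partial>lborel)"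
    by (intro nn_integral_cong) (auto simp: indicator_def)
  finally show ?thesis .
qed

text \<open>Change of variables by the transition map, whose Jacobian factor relates the two area
  densities.\<close>

lemma chart_meas_agree:
  assumes c: "c \<in> A" and d: "d \<in> A" and B: "B \<in> sets (borel_of_top T)" "B \<subseteq> fst c" "B \<subseteq> fst d"
  shows "emeasure (chart_meas c) B = emeasure (chart_meas d) B"
proof -
  let ?g = "in_chart c (snd d)" and ?E = "snd c ` B"
  have E: "?E \<in> sets borel" "snd d ` B \<in> sets borel"
    using chart_image_borel[OF c B(1)] chart_image_borel[OF d B(1)] B by (simp_all add: inf.absorb1)
  have gE: "?g (snd c p) = snd d p" if "p \<in> B" for p using that B by (auto simp: in_chart_apply[OF c])
  then have im: "?g ` ?E = snd d ` B" by (auto simp: image_image)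
  have inj: "inj_on ?g ?E"
    using gE chart_inj[OF d] B by (auto simp: inj_on_def) (metis subsetD)
  let ?g' = "\<lambda>y. transition_diff c d (par c y)"
  have par: "par c (snd c p) = p" if "p \<in> B" for p using that B chart_inv[OF c] by auto
  have der: "(?g has_derivative ?g' y) (at y within ?E)" if y: "y \<in> ?E" for y
  proof -
    obtain p where p: "p \<in> B" "y = snd c p" using y by blast
    have "(?g has_derivative transition_diff c d p) (at (snd c p) within snd c ` (fst c \<inter> fst d))"
      using transition_derivative[OF c d] p B by blast
    then have "(?g has_derivative transition_diff c d p) (at (snd c p) within ?E)"
      by (rule has_derivative_subset) (use B in auto)
    then show ?thesis using p par by simp
  qed
  have ch: "\<bar>det (matrix (?g' y))\<bar> * dens d (?g y) = dens c y" if y: "y \<in> ?E" for y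
  proof -
    obtain p where p: "p \<in> B" "y = snd c p" using y by blast
    then have "p \<in> fst c" "p \<in> fst d" using B by auto
    then show ?thesis
      using dens_change[OF c d, of p] p by (simp add: gE par in_chart_apply[OF c] in_chart_apply[OF d])
  qed
  have "(\<integral>\<^sup>+y. ennreal (\<bar>det (matrix (?g' y))\<bar> * dens d (?g y)) * indicator ?E y \<partial>lborel)
      = (\<integral>\<^sup>+y. ennreal (dens d y) * indicator (?g ` ?E) y \<partial>lborel)"
  proof (rule nn_integral_change_of_variables[OF E(1) der inj])
    show "0 \<le> dens d y" if "y \<in> ?g ` ?E" for y using that dens_pos[OF d] B unfolding im by auto
    show "(\<lambda>y. indicator (?g ` ?E) y * dens d y) \<in> borel_measurable borel"
      unfolding im by (rule dens_indicator_measurable[OF d E(2)]) (use B in auto)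
    have "(\<lambda>y. indicator ?E y * (\<bar>det (matrix (?g' y))\<bar> * dens d (?g y))) = (\<lambda>y. indicator ?E y * dens c y)"
      using ch by (auto simp: fun_eq_iff indicator_def)
    then show "(\<lambda>y. indicator ?E y * (\<bar>det (matrix (?g' y))\<bar> * dens d (?g y))) \<in> borel_measurable borel"
      using dens_indicator_measurable[OF c E(1) image_mono[OF B(2)]] by (simp only:)
  qed
  moreover have "(\<integral>\<^sup>+y. ennreal (\<bar>det (matrix (?g' y))\<bar> * dens d (?g y)) * indicator ?E y \<partial>lborel)
      = (\<integral>\<^sup>+y. ennreal (dens c y) * indicator ?E y \<partial>lborel)"
    using ch by (intro nn_integral_cong) (auto simp: indicator_def)
  ultimately show ?thesis
    unfolding emeasure_chart_meas[OF c B(1)] emeasure_chart_meas[OF d B(1)] im using B by (simp add: inf.absorb1)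
qed

text \<open>The predicate inside the definite description of \<open>area_measure\<close>, isolated
  so that existence and uniqueness can be proved for it.\<close>

definition is_area :: "'p measure \<Rightarrow> bool" where
  "is_area \<mu> \<longleftrightarrow> space \<mu> = topspace T \<and> sets \<mu> = sigma_sets (topspace T) {U. openin T U} \<and>
        (\<forall>c\<in>A. \<forall>B\<in>sets \<mu>. B \<subseteq> fst c \<longrightarrow>
           emeasure \<mu> B = (\<integral>\<^sup>+y\<in>snd c ` B. ennreal (dens c y) \<partial>lborel))"

lemma is_area_iff: "is_area \<mu> \<longleftrightarrow> space \<mu> = topspace T \<and> sets \<mu> = sets (borel_of_top T) \<and>
    (\<forall>c\<in>A. \<forall>B\<in>sets \<mu>. B \<subseteq> fst c \<longrightarrow> emeasure \<mu> B = emeasure (chart_meas c) B)"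
proof -
  have s: "sets (borel_of_top T) = sigma_sets (topspace T) {U. openin T U}" by simp
  have e: "(\<integral>\<^sup>+y\<in>snd c ` B. ennreal (dens c y) \<partial>lborel) = emeasure (chart_meas c) B"
    if "c \<in> A" "B \<in> sets (borel_of_top T)" "B \<subseteq> fst c" for c B
    using emeasure_chart_meas[OF that(1,2)] that(3) by (simp only: Int_absorb2)
  have "(\<forall>c\<in>A. \<forall>B\<in>sets \<mu>. B \<subseteq> fst c \<longrightarrow>
       emeasure \<mu> B = (\<integral>\<^sup>+y\<in>snd c ` B. ennreal (dens c y) \<partial>lborel)) \<longleftrightarrow>
     (\<forall>c\<in>A. \<forall>B\<in>sets \<mu>. B \<subseteq> fst c \<longrightarrow> emeasure \<mu> B = emeasure (chart_meas c) B)"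
    if st: "sets \<mu> = sets (borel_of_top T)"
    unfolding st by (intro ball_cong refl imp_cong) (simp only: e)
  then show ?thesis unfolding is_area_def s[symmetric] by blast
qed

lemma finite_chart_cover: "\<exists>cs. set cs \<subseteq> A \<and> topspace T \<subseteq> (\<Union>c\<in>set cs. fst c)"
proof -
  have "compactin T (topspace T)" using comp by (simp add: compact_space_def)
  moreover have "topspace T \<subseteq> \<Union>(fst ` A)" using chart_cover by auto
  ultimately obtain F where "finite F" "F \<subseteq> fst ` A" "topspace T \<subseteq> \<Union>F"
    using chart_open unfolding compactin_def by (metis (no_types, lifting) imageE)
  then obtain G where "finite G" "G \<subseteq> A" "F = fst ` G" by (meson finite_subset_image)
  then show ?thesis using \<open>topspace T \<subseteq> \<Union>F\<close> finite_list[of G] by auto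
qed

text \<open>Compactness gives finitely many charts. Made disjoint, they cut every Borel set into
  pieces whose measure is prescribed by a single chart. This determines the measure, and the sum
  over the pieces defines it, consistently because chart measures agree on overlaps.\<close>

lemma ex1_area: "\<exists>!\<mu>. is_area \<mu>"
proof -
  obtain cs where cs: "set cs \<subseteq> A" "topspace T \<subseteq> (\<Union>c\<in>set cs. fst c)" using finite_chart_cover by blast
  let ?n = "length cs"
  define P where "P j = fst (cs ! j) - (\<Union>i<j. fst (cs ! i))" for j
  have csA: "cs ! j \<in> A" if "j < ?n" for j using cs that by (meson nth_mem subsetD)
  have Pm: "P j \<in> sets (borel_of_top T)" if "j < ?n" for j
    unfolding P_def using that csA openin_borel[OF chart_open]
    by (intro sets.Diff sets.finite_UN) (auto simp del: borel_of_top_facts)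
  have disj: "P i \<inter> P j = {}" if "i < j" for i j using that by (auto simp: P_def)
  then have disjP: "disjoint_family_on P {..<?n}"
    unfolding disjoint_family_on_def by (metis inf_commute linorder_neqE_nat)
  have cover: "p \<in> (\<Union>j<?n. P j)" if "p \<in> topspace T" for p
  proof -
    have "\<exists>j. j < ?n \<and> p \<in> fst (cs ! j)" using cs(2) that by (force simp: in_set_conv_nth)
    then obtain J where J: "J < ?n" "p \<in> fst (cs ! J)" "\<And>i. i < J \<Longrightarrow> \<not> (i < ?n \<and> p \<in> fst (cs ! i))"
      using exists_least_iff[of "\<lambda>j. j < ?n \<and> p \<in> fst (cs ! j)"] by blast
    then have "p \<in> P J" unfolding P_def by force
    then show ?thesis using J(1) by blast
  qed
  have split: "emeasure \<mu> B = (\<Sum>j<?n. emeasure \<mu> (B \<inter> P j))"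
    if s: "sets \<mu> = sets (borel_of_top T)" and B: "B \<in> sets (borel_of_top T)" for \<mu> B
  proof -
    have "B \<subseteq> topspace T" using sets.sets_into_space[OF B] by simp
    then have "B = (\<Union>j<?n. B \<inter> P j)" using cover by blast
    moreover have "emeasure \<mu> (\<Union>j<?n. B \<inter> P j) = (\<Sum>j<?n. emeasure \<mu> (B \<inter> P j))"
    proof (rule sum_emeasure[symmetric])
      show "(\<lambda>j. B \<inter> P j) ` {..<?n} \<subseteq> sets \<mu>" using s B Pm by (auto simp del: borel_of_top_facts)
      show "disjoint_family_on (\<lambda>j. B \<inter> P j) {..<?n}"
        using disjP by (auto simp: disjoint_family_on_def)
    qed simp
    ultimately show ?thesis by (simp only:)
  qed
  define m where "m B = (\<Sum>j<?n. emeasure (chart_meas (cs ! j)) (B \<inter> P j))" for B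
  define \<mu> where "\<mu> = measure_of (topspace T) {U. openin T U} m"
  have sub: "{U. openin T U} \<subseteq> Pow (topspace T)" by (auto dest: openin_subset)
  have sp: "space \<mu> = topspace T" and st: "sets \<mu> = sets (borel_of_top T)"
    unfolding \<mu>_def using sub by (simp_all add: space_measure_of sets_measure_of)
  have em: "emeasure \<mu> B = m B" if B: "B \<in> sets (borel_of_top T)" for B
  proof (rule emeasure_measure_of[OF \<mu>_def sub])
    show "positive (sets \<mu>) m" by (simp add: positive_def m_def)
    show "countably_additive (sets \<mu>) m"
    proof (rule countably_additiveI)
      fix F :: "nat \<Rightarrow> 'p set"
      assume F: "range F \<subseteq> sets \<mu>" "disjoint_family F" "\<Union> (range F) \<in> sets \<mu>"
      have "(\<Sum>i. m (F i)) = (\<Sum>j<?n. \<Sum>i. emeasure (chart_meas (cs ! j)) (F i \<inter> P j))"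
        unfolding m_def by (rule suminf_sum) (rule summableI)
      also have "\<dots> = (\<Sum>j<?n. emeasure (chart_meas (cs ! j)) (\<Union>(range F) \<inter> P j))"
      proof (rule sum.cong[OF refl])
        fix j assume j: "j \<in> {..<?n}"
        have "(\<Sum>i. emeasure (chart_meas (cs ! j)) (F i \<inter> P j)) = emeasure (chart_meas (cs ! j)) (\<Union>i. F i \<inter> P j)"
        proof (rule suminf_emeasure)
          show "range (\<lambda>i. F i \<inter> P j) \<subseteq> sets (chart_meas (cs ! j))"
          proof safe
            fix i
            have "F i \<in> sets (borel_of_top T)" using F(1) st by blast
            from sets.Int[OF this Pm] j show "F i \<inter> P j \<in> sets (chart_meas (cs ! j))" by simp
          qed
          show "disjoint_family (\<lambda>i. F i \<inter> P j)" using F(2) by (auto simp: disjoint_family_on_def)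
        qed
        then show "(\<Sum>i. emeasure (chart_meas (cs ! j)) (F i \<inter> P j)) = emeasure (chart_meas (cs ! j)) (\<Union>(range F) \<inter> P j)"
          by (simp only: UN_extend_simps)
      qed
      finally show "(\<Sum>i. m (F i)) = m (\<Union>(range F))" by (simp only: m_def)
    qed
    show "B \<in> sets \<mu>" using B st by simp
  qed
  have "is_area \<mu>"
    unfolding is_area_iff
  proof (intro conjI ballI impI)
    fix c B assume c: "c \<in> A" and B: "B \<in> sets \<mu>" "B \<subseteq> fst c"
    then have B': "B \<in> sets (borel_of_top T)" using st by simp
    have "emeasure \<mu> B = (\<Sum>j<?n. emeasure (chart_meas (cs ! j)) (B \<inter> P j))" using em[OF B'] by (simp add: m_def)
    also have "\<dots> = (\<Sum>j<?n. emeasure (chart_meas c) (B \<inter> P j))"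
    proof (rule sum.cong[OF refl])
      fix j assume j: "j \<in> {..<?n}"
      show "emeasure (chart_meas (cs ! j)) (B \<inter> P j) = emeasure (chart_meas c) (B \<inter> P j)"
        by (rule chart_meas_agree[OF csA c]) (use j B' B(2) Pm in \<open>auto simp: P_def simp del: borel_of_top_facts\<close>)
    qed
    also have "\<dots> = emeasure (chart_meas c) B" by (rule split[symmetric]) (use B' in auto)
    finally show "emeasure \<mu> B = emeasure (chart_meas c) B" .
  qed (use sp st in auto)
  moreover have "\<mu>' = \<mu>" if "is_area \<mu>'" for \<mu>'
  proof (rule measure_eqI)
    have a: "is_area \<mu>" "is_area \<mu>'" by fact+
    then show "sets \<mu>' = sets \<mu>" by (simp add: is_area_iff)
    fix B assume "B \<in> sets \<mu>'"
    then have B: "B \<in> sets (borel_of_top T)" using a by (simp add: is_area_iff)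
    have *: "emeasure \<mu>' (B \<inter> P j) = emeasure \<mu> (B \<inter> P j)" if "j < ?n" for j
    proof -
      have "B \<inter> P j \<in> sets (borel_of_top T)" using B Pm[OF that] by (rule sets.Int)
      moreover have "B \<inter> P j \<subseteq> fst (cs ! j)" by (auto simp: P_def)
      moreover have "sets \<mu>' = sets (borel_of_top T)" "sets \<mu> = sets (borel_of_top T)" using a unfolding is_area_iff by blast+
      ultimately show ?thesis using a csA[OF that] unfolding is_area_iff by simp
    qed
    then show "emeasure \<mu>' B = emeasure \<mu> B"
    proof -
      have "sets \<mu>' = sets (borel_of_top T)" "sets \<mu> = sets (borel_of_top T)" using a unfolding is_area_iff by blast+
      then show ?thesis using split[OF _ B, of \<mu>'] split[OF _ B, of \<mu>] * by (metis (no_types, lifting) sum.cong lessThan_iff)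
    qed
  qed
  ultimately show ?thesis by blast
qed

abbreviation "dA \<equiv> area_measure T A x"

lemma dA_area: "is_area dA"
proof -
  have "area_measure T A x = (THE \<mu>. is_area \<mu>)" unfolding area_measure_def is_area_def ..
  then show ?thesis using theI'[OF ex1_area] by simp
qed

lemma space_dA: "space dA = topspace T" and sets_dA: "sets dA = sets (borel_of_top T)"
  and emeasure_dA: "\<And>c B. c \<in> A \<Longrightarrow> B \<in> sets (borel_of_top T) \<Longrightarrow> B \<subseteq> fst c \<Longrightarrow> emeasure dA B = emeasure (chart_meas c) B"
  using dA_area by (auto simp: is_area_iff)

lemma integral_dA_chart:
  fixes f :: "'p \<Rightarrow> real"
  assumes c: "c \<in> A" and f: "f \<in> borel_measurable (borel_of_top T)" and supp: "\<And>p. p \<in> topspace T \<Longrightarrow> p \<notin> fst c \<Longrightarrow> f p = 0"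
  shows "integral\<^sup>L dA f = (\<integral>y. indicator (img c) y *\<^sub>R (dens c y * in_chart c f y) \<partial>lborel)"
proof -
  have U: "fst c \<in> sets (borel_of_top T)" by (rule openin_borel[OF chart_open[OF c]])
  have fs: "f p = indicator (fst c) p *\<^sub>R f p" if "p \<in> topspace T" for p using supp[OF that] by (auto simp: indicator_def)
  \<comment> \<open>Both measures have the same values on Borel subsets of the chart, so the
    integral of a function supported there may be computed with the push-forward.\<close>
  have eq: "restrict_space dA (fst c) = restrict_space (chart_meas c) (fst c)"
  proof (rule measure_eqI)
    show "sets (restrict_space dA (fst c)) = sets (restrict_space (chart_meas c) (fst c))"
      using sets_dA by (simp add: sets_restrict_space)
    fix B assume "B \<in> sets (restrict_space dA (fst c))"
    then have B: "B \<in> sets (borel_of_top T)" "B \<subseteq> fst c"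
      using U sets_dA space_dA chart_sub[OF c] by (auto simp: sets_restrict_space_iff inf.absorb1 simp del: borel_of_top_facts)
    have i: "fst c \<inter> space dA \<in> sets dA" "fst c \<inter> space (chart_meas c) \<in> sets (chart_meas c)"
      using U chart_sub[OF c] sets_dA space_dA by (auto simp: inf.absorb1)
    show "emeasure (restrict_space dA (fst c)) B = emeasure (restrict_space (chart_meas c) (fst c)) B"
      using emeasure_restrict_space[OF i(1) B(2)] emeasure_restrict_space[OF i(2) B(2)] emeasure_dA[OF c B] by simp
  qed
  have i: "fst c \<inter> space dA \<in> sets dA" "fst c \<inter> space (chart_meas c) \<in> sets (chart_meas c)"
    using U chart_sub[OF c] sets_dA space_dA by (auto simp: inf.absorb1)
  have "integral\<^sup>L dA f = integral\<^sup>L (restrict_space dA (fst c)) f"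
    unfolding integral_restrict_space[OF i(1)] using fs space_dA by (intro Bochner_Integration.integral_cong) auto
  also have "\<dots> = integral\<^sup>L (chart_meas c) f"
    unfolding eq integral_restrict_space[OF i(2)] using fs by (intro Bochner_Integration.integral_cong) auto
  also have "\<dots> = integral\<^sup>L (density (restrict_space lborel (img c)) (\<lambda>y. ennreal (dens c y))) (\<lambda>y. f (par c y))"
    unfolding chart_meas_def by (rule integral_distr[OF par_measurable'[OF c] f])
  also have "\<dots> = integral\<^sup>L (restrict_space lborel (img c)) (\<lambda>y. dens c y *\<^sub>R f (par c y))"
  proof (rule integral_density)
    show "(\<lambda>y. f (par c y)) \<in> borel_measurable (restrict_space lborel (img c))"
      by (rule measurable_restrict_lborel[OF measurable_compose[OF par_measurable[OF c] f]])
    show "dens c \<in> borel_measurable (restrict_space lborel (img c))"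
      by (rule measurable_restrict_lborel[OF dens_measurable[OF c]])
    show "AE y in restrict_space lborel (img c). 0 \<le> dens c y"
      using dens_pos[OF c] by (intro AE_I2) (auto simp: space_restrict_space)
  qed
  also have "\<dots> = (\<integral>y. indicator (img c) y *\<^sub>R (dens c y *\<^sub>R f (par c y)) \<partial>lborel)"
    using img_borel[OF c] by (intro integral_restrict_space) auto
  finally show ?thesis by (simp add: in_chart_def)
qed

lemma chart_ball:
  assumes "p \<in> topspace T"
  shows "\<exists>c r. c \<in> A \<and> p \<in> fst c \<and> 0 < r \<and> cball (snd c p) r \<inter> corner K \<subseteq> img c"
proof -
  obtain c where c: "c \<in> A" "p \<in> fst c" using chart_cover[OF assms] by blast
  obtain O1 where O1: "open O1" "img c = corner K \<inter> O1" using chart_img_open[OF c(1)] by (metis openin_open)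
  then have "snd c p \<in> O1" using c by blast
  then obtain r where "0 < r" "cball (snd c p) r \<subseteq> O1" using O1 open_contains_cball by blast
  then show ?thesis using c O1 by (intro exI[of _ c] exI[of _ r]) auto
qed

text \<open>Every point has a neighbourhood in a compact piece of a chart image, over which the
  continuous density has finite integral; finitely many such neighbourhoods cover the compact
  space.\<close>

lemma finite_measure_dA: "finite_measure dA"
proof
  have "\<forall>p\<in>topspace T. \<exists>V. openin T V \<and> p \<in> V \<and> emeasure dA V < \<infinity>"
  proof
    fix p assume "p \<in> topspace T"
    then obtain c r where c: "c \<in> A" "p \<in> fst c" "0 < r" "cball (snd c p) r \<inter> corner K \<subseteq> img c" using chart_ball by blast
    let ?V = "{q \<in> fst c. snd c q \<in> ball (snd c p) r}"
    let ?D = "cball (snd c p) r \<inter> corner K"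
    have V: "openin T ?V" by (rule chart_open_preimage[OF c(1)]) simp
    have D: "compact ?D" by (simp add: compact_Int_closed corner_closed)
    have imgK: "img c \<subseteq> corner K" using chart_img_open[OF c(1)] openin_subset by fastforce
    have "emeasure dA ?V = emeasure (chart_meas c) ?V"
      by (rule emeasure_dA[OF c(1) openin_borel[OF V]]) auto
    also have "\<dots> = (\<integral>\<^sup>+y. ennreal (dens c y) * indicator (snd c ` (?V \<inter> fst c)) y \<partial>lborel)"
      by (rule emeasure_chart_meas[OF c(1) openin_borel[OF V]])
    also have "\<dots> \<le> (\<integral>\<^sup>+y. ennreal (indicator ?D y *\<^sub>R dens c y) \<partial>lborel)"
      using imgK by (intro nn_integral_mono) (auto simp: indicator_def image_subset_iff)
    also have "\<dots> < \<infinity>"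
    proof -
      have i: "integrable lborel (\<lambda>y. indicator ?D y *\<^sub>R dens c y)"
        by (rule borel_integrable_compact[OF D continuous_on_subset[OF dens_continuous[OF c(1)] c(4)]])
      have "0 \<le> indicator ?D y *\<^sub>R dens c y" for y
        using dens_pos[OF c(1)] c(4) by (auto simp: indicator_def)
      then show ?thesis using i by (subst nn_integral_eq_integral) auto
    qed
    finally have "emeasure dA ?V < \<infinity>" .
    moreover have "p \<in> ?V" using c by simp
    ultimately show "\<exists>V. openin T V \<and> p \<in> V \<and> emeasure dA V < \<infinity>" using V by blast
  qed
  then obtain V where V: "\<And>p. p \<in> topspace T \<Longrightarrow> openin T (V p) \<and> p \<in> V p \<and> emeasure dA (V p) < \<infinity>" by metis
  have "compactin T (topspace T)" using comp by (simp add: compact_space_def)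
  moreover have "topspace T \<subseteq> \<Union>(V ` topspace T)" using V by auto
  ultimately obtain F where "finite F" "F \<subseteq> V ` topspace T" "topspace T \<subseteq> \<Union>F"
    using V unfolding compactin_def by (metis (no_types, lifting) imageE)
  then obtain G where G: "finite G" "G \<subseteq> topspace T" "topspace T \<subseteq> (\<Union>p\<in>G. V p)" by (metis finite_subset_image)
  have "emeasure dA (topspace T) \<le> emeasure dA (\<Union>p\<in>G. V p)"
    using G V by (intro emeasure_mono) (auto simp: sets_dA intro!: sets.finite_UN openin_borel simp del: borel_of_top_facts)
  also have "\<dots> \<le> (\<Sum>p\<in>G. emeasure dA (V p))"
    using G V by (intro emeasure_subadditive_finite) (auto simp: sets_dA intro!: openin_borel simp del: borel_of_top_facts)
  also have "\<dots> < \<infinity>"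
    using G V by (auto simp: subset_iff)
  finally show "emeasure dA (space dA) \<noteq> \<infinity>" by (simp add: space_dA)
qed

text \<open>Continuity in all charts is continuity on the compact space, so the function is bounded,
  and the area measure is finite.\<close>

lemma continuous_integrable:
  fixes f :: "'p \<Rightarrow> real"
  assumes "\<And>c. c \<in> A \<Longrightarrow> continuous_on (img c) (in_chart c f)"
  shows "integrable dA f" "f \<in> borel_measurable (borel_of_top T)"
proof -
  have f: "continuous_map T euclidean f" by (rule continuous_map_charts[OF assms])
  then show m: "f \<in> borel_measurable (borel_of_top T)" by (rule continuous_map_borel)
  have "compact (f ` topspace T)"
    using image_compactin[OF _ f, of "topspace T"] comp by (simp add: compact_space_def)
  then obtain B where B: "\<And>p. p \<in> topspace T \<Longrightarrow> norm (f p) \<le> B"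
    using compact_imp_bounded[of "f ` topspace T"] by (auto simp: bounded_iff)
  interpret finite_measure dA by (rule finite_measure_dA)
  show "integrable dA f"
  proof (rule integrable_const_bound[of _ B])
    show "f \<in> borel_measurable dA" using m measurable_cong_sets[OF sets_dA refl] by blast
  qed (use B space_dA in auto)
qed

end

section \<open>Gauges and the anisotropic shape operator\<close>

lemma unit_radial_derivative:
  fixes \<xi> :: "'a::euclidean_space"
  assumes "norm \<xi> = 1"
  shows "((\<lambda>x. x /\<^sub>R norm x) has_derivative (\<lambda>u. u - (\<xi> \<bullet> u) *\<^sub>R \<xi>)) (at \<xi>)"
proof -
  have n: "\<xi> \<bullet> \<xi> = 1" using assms by (simp add: norm_eq_1)
  have "((\<lambda>x. inverse (sqrt (x \<bullet> x)) *\<^sub>R x) has_derivative (\<lambda>u. u - (\<xi> \<bullet> u) *\<^sub>R \<xi>)) (at \<xi>)"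
    by (rule derivative_eq_intros refl | simp add: n)+ (auto simp: n inner_commute algebra_simps)
  then show ?thesis by (simp add: norm_eq_sqrt_inner)
qed

lemma C1_on_radial: "C1_on (- {0}) (\<lambda>x :: 'a::euclidean_space. x /\<^sub>R norm x)"
proof -
  have q: "C1_on (- {0 :: 'a}) (\<lambda>x. x \<bullet> x)"
    by (rule C1_onI[of UNIV _ "\<lambda>x v. 2 * (x \<bullet> v)"]) (auto intro!: derivative_eq_intros continuous_intros simp: inner_commute)
  have s: "C1_on {0<..} sqrt"
    by (rule C1_onI[of "{0<..}" _ "\<lambda>x v. v * (inverse (sqrt x) / 2)"])
       (auto intro!: has_field_derivative_imp_has_derivative[OF DERIV_real_sqrt, THEN has_derivative_eq_rhs] continuous_intros)
  have "C1_on (- {0 :: 'a}) (\<lambda>x. sqrt (x \<bullet> x))"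
    by (rule C1_on_compose[OF s q]) auto
  then have "C1_on (- {0 :: 'a}) (\<lambda>x. inverse (sqrt (x \<bullet> x)))" by (rule C1_on_inverse) auto
  moreover have "C1_on (- {0 :: 'a}) (\<lambda>x. x)" by (rule C1_onI[of UNIV _ "\<lambda>x v. v"]) auto
  ultimately have "C1_on (- {0 :: 'a}) (\<lambda>x. inverse (sqrt (x \<bullet> x)) *\<^sub>R x)" by (rule C1_on_scaleR)
  then show ?thesis by (simp add: norm_eq_sqrt_inner)
qed

lemma Ck1_C1_on: "open U \<Longrightarrow> Ck_on 1 U f \<Longrightarrow> C1_on U f"
  unfolding C1_on_def by blast

context
  fixes F :: "'a::euclidean_space \<Rightarrow> real"
  assumes gauge: "anisotropic_gauge F"
begin

private definition "D x v = frechet_derivative (radial_ext F) (at x) v"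
private definition "D2 v x = frechet_derivative (\<lambda>x. D x v) (at x)"

lemma gauge_D: "x \<noteq> 0 \<Longrightarrow> (radial_ext F has_derivative D x) (at x)"
  and gauge_Ck1_D: "Ck_on 1 (- {0}) (\<lambda>x. D x v)"
proof -
  have "Ck_on (Suc 1) (- {0}) (radial_ext F)" using gauge by (simp add: anisotropic_gauge_def numeral_2_eq_2)
  then have *: "\<forall>x\<in>- {0}. radial_ext F differentiable (at x)" "\<And>v. Ck_on 1 (- {0}) (\<lambda>x. D x v)"
    unfolding D_def Ck_on.simps(2) by blast+
  then show "x \<noteq> 0 \<Longrightarrow> (radial_ext F has_derivative D x) (at x)"
    unfolding D_def[abs_def] by (simp add: frechet_derivative_works[symmetric])
  show "Ck_on 1 (- {0}) (\<lambda>x. D x v)" by (rule *(2))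
qed

lemma gauge_D2: "x \<noteq> 0 \<Longrightarrow> ((\<lambda>x. D x v) has_derivative D2 v x) (at x)"
  and gauge_D2_cont: "continuous_on (- {0}) (\<lambda>x. D2 v x w)"
  using Ck1D(1,2)[OF gauge_Ck1_D] by (auto simp: D2_def)

lemma D_linear: "x \<noteq> 0 \<Longrightarrow> linear (D x)"
  using gauge_D has_derivative_linear by blast

lemma D2_sym: "x \<noteq> 0 \<Longrightarrow> D2 v x w = D2 w x v"
  by (rule symmetric_second_derivative[of "- {0}" x "radial_ext F" D]) (auto intro: gauge_D gauge_D2 gauge_D2_cont)

lemma D_expand: "x \<noteq> 0 \<Longrightarrow> D x v = (\<Sum>b\<in>Basis. (v \<bullet> b) * D x b)"
  using linear_expand_Basis[OF D_linear, of x v] by simp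

lemma D2_expand: "x \<noteq> 0 \<Longrightarrow> D2 v x w = (\<Sum>b\<in>Basis. (v \<bullet> b) * D2 b x w)"
proof -
  assume x: "x \<noteq> 0"
  have "((\<lambda>x. \<Sum>b\<in>Basis. (v \<bullet> b) * D x b) has_derivative (\<lambda>w. \<Sum>b\<in>Basis. (v \<bullet> b) * D2 b x w)) (at x)"
    by (intro has_derivative_sum has_derivative_mult_right gauge_D2 x)
  then have "((\<lambda>x. D x v) has_derivative (\<lambda>w. \<Sum>b\<in>Basis. (v \<bullet> b) * D2 b x w)) (at x)"
    by (rule has_derivative_transform_within_open[of _ _ _ _ "- {0}"]) (use x D_expand in auto)
  then show ?thesis using has_derivative_unique[OF gauge_D2[OF x]] by metis
qed

text \<open>The radial extension is constant on rays, and for \<open>s\<close> greater than -1 the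
  point \<open>x + s *\<^sub>R x\<close> stays on the ray through \<open>x\<close>.\<close>

lemma D_radial: assumes x: "x \<noteq> 0" shows "D x x = 0"
proof -
  have "((\<lambda>s. radial_ext F (x + s *\<^sub>R x)) has_vector_derivative D x x) (at 0)"
    by (rule has_vector_derivative_along_line) (use gauge_D[OF x] in simp)
  moreover have "((\<lambda>s. radial_ext F (x + s *\<^sub>R x)) has_vector_derivative 0) (at 0)"
  proof -
    have "((\<lambda>s :: real. radial_ext F x) has_vector_derivative 0) (at 0)" by simp
    moreover have *: "radial_ext F x = radial_ext F (x + s *\<^sub>R x)" if "s \<in> {-1<..}" for s
    proof -
      have s: "0 < 1 + s" using that by simp
      have "x + s *\<^sub>R x = (1 + s) *\<^sub>R x" by (simp add: algebra_simps)
      then have "(x + s *\<^sub>R x) /\<^sub>R norm (x + s *\<^sub>R x) = x /\<^sub>R norm x"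
        using s by simp
      then show ?thesis by (simp only: radial_ext_def)
    qed
    ultimately show ?thesis
      by (elim has_vector_derivative_transform_within_open[of _ _ _ "{-1<..}"]) (simp, simp, rule *)
  qed
  ultimately show ?thesis by (rule vector_derivative_unique_at)
qed

text \<open>Differentiate the identity \<open>D x x = 0\<close> in the direction \<open>w\<close>.
  The normal part of the derivative of the gradient found in this way cancels the derivative of the
  factor \<open>F\<close> in the Cahn-Hoffman map, which makes dPhi tangential.\<close>

lemma D2_radial: assumes x: "x \<noteq> 0" shows "D2 x x w = - D x w"
proof -
  have d1: "((\<lambda>x. \<Sum>b\<in>Basis. (x \<bullet> b) * D x b) has_derivative (\<lambda>w. \<Sum>b\<in>Basis. (x \<bullet> b) * D2 b x w + (w \<bullet> b) * D x b)) (at x)"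
    by (intro has_derivative_sum has_derivative_mult gauge_D2 x has_derivative_inner_left has_derivative_ident)
  have d2: "((\<lambda>x. \<Sum>b\<in>Basis. (x \<bullet> b) * D x b) has_derivative (\<lambda>_. 0)) (at x)"
    by (rule has_derivative_transform_within_open[OF has_derivative_const[of 0], of "- {0}"])
       (use x D_radial in \<open>auto simp: D_expand[symmetric]\<close>)
  have "(\<Sum>b\<in>Basis. (x \<bullet> b) * D2 b x w + (w \<bullet> b) * D x b) = 0"
    by (rule fun_cong[OF has_derivative_unique[OF d1 d2]])
  then have "D2 x x w + D x w = 0"
    by (simp add: sum.distrib D2_expand[OF x, symmetric] D_expand[OF x, symmetric])
  then show ?thesis by linarith
qed

lemma sphere_grad_D: "sphere_grad F \<xi> = (\<Sum>b\<in>Basis. D \<xi> b *\<^sub>R b)"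
  by (simp add: sphere_grad_def sphere_diff_def D_def)

lemma radial_grad: "radial_ext (sphere_grad F) = (\<lambda>x. \<Sum>b\<in>Basis. D (x /\<^sub>R norm x) b *\<^sub>R b)"
  by (simp add: radial_ext_def fun_eq_iff sphere_grad_D)

lemma radial_Cahn_Hoffman:
  "radial_ext (Cahn_Hoffman F) = (\<lambda>x. (\<Sum>b\<in>Basis. D (x /\<^sub>R norm x) b *\<^sub>R b) + radial_ext F x *\<^sub>R (x /\<^sub>R norm x))"
  by (simp add: radial_ext_def fun_eq_iff sphere_grad_D Cahn_Hoffman_def)

lemma Cahn_Hoffman_C1: "C1_on (- {0}) (radial_ext (Cahn_Hoffman F))"
  unfolding radial_Cahn_Hoffman
proof (rule C1_on_add[OF C1_on_sum[OF _ C1_on_scaleR[OF _ C1_on_const]] C1_on_scaleR[OF _ C1_on_radial]])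
  show "C1_on (- {0}) (radial_ext F)"
    by (rule C1_onI[of "- {0}" _ D]) (auto intro: gauge_D Ck1D(3)[OF gauge_Ck1_D])
  show "C1_on (- {0}) (\<lambda>x. D (x /\<^sub>R norm x) b)" for b
    by (rule C1_on_compose[OF Ck1_C1_on[OF _ gauge_Ck1_D] C1_on_radial]) auto
qed auto

text \<open>The spherical gradient is tangential by \<open>D_radial\<close>. This is the source of
  the term F(\<nu>) in the formula.\<close>

lemma Cahn_Hoffman_inner: assumes "norm \<xi> = 1" shows "Cahn_Hoffman F \<xi> \<bullet> \<xi> = F \<xi>"
proof -
  have x0: "\<xi> \<noteq> 0" using assms by auto
  have "sphere_grad F \<xi> \<bullet> \<xi> = (\<Sum>b\<in>Basis. (\<xi> \<bullet> b) * D \<xi> b)"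
    unfolding sphere_grad_D inner_sum_left by (rule sum.cong) (simp_all add: inner_commute)
  then have "sphere_grad F \<xi> \<bullet> \<xi> = 0"
    using D_radial[OF x0] D_expand[OF x0, of \<xi>] by linarith
  then show ?thesis using assms by (simp add: Cahn_Hoffman_def inner_add_left norm_eq_1)
qed

lemma grad_derivative:
  assumes \<xi>: "norm \<xi> = 1"
  shows "(radial_ext (sphere_grad F) has_derivative (\<lambda>u. \<Sum>b\<in>Basis. D2 b \<xi> (u - (\<xi> \<bullet> u) *\<^sub>R \<xi>) *\<^sub>R b)) (at \<xi>)"
  unfolding radial_grad
proof (intro has_derivative_sum has_derivative_scaleR_left)
  fix b
  have "\<xi> \<noteq> 0" "\<xi> /\<^sub>R norm \<xi> = \<xi>" using \<xi> by auto
  then show "((\<lambda>x. D (x /\<^sub>R norm x) b) has_derivative (\<lambda>u. D2 b \<xi> (u - (\<xi> \<bullet> u) *\<^sub>R \<xi>))) (at \<xi>)"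
    by (intro has_derivative_compose[OF unit_radial_derivative[OF \<xi>]]) (auto intro: gauge_D2)
qed

text \<open>On tangent vectors \<open>L\<close> represents the Hessian of \<open>F\<close> plus
  \<open>F\<close> times the metric. Symmetry of second derivatives makes it symmetric and the
  convexity condition on the gauge makes it positive definite.\<close>

lemma Cahn_Hoffman_derivative:
  assumes \<xi>: "norm \<xi> = 1"
  obtains L where "linear L" "(radial_ext (Cahn_Hoffman F) has_derivative L) (at \<xi>)"
    "\<And>u. u \<bullet> \<xi> = 0 \<Longrightarrow> L u \<bullet> \<xi> = 0"
    "\<And>u v. u \<bullet> \<xi> = 0 \<Longrightarrow> v \<bullet> \<xi> = 0 \<Longrightarrow> L u \<bullet> v = L v \<bullet> u"
    "\<And>u. u \<bullet> \<xi> = 0 \<Longrightarrow> u \<noteq> 0 \<Longrightarrow> 0 < L u \<bullet> u"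
proof -
  have x0: "\<xi> \<noteq> 0" using \<xi> by auto
  have R: "\<xi> /\<^sub>R norm \<xi> = \<xi>" "\<xi> \<bullet> \<xi> = 1" using \<xi> by (simp, simp add: norm_eq_1)
  have F\<xi>: "radial_ext F \<xi> = F \<xi>" by (simp add: radial_ext_def R)
  define H where "H u = (\<Sum>b\<in>Basis. D2 b \<xi> u *\<^sub>R b)" for u
  define P where "P u = u - (\<xi> \<bullet> u) *\<^sub>R \<xi>" for u
  \<comment> \<open>\<open>P\<close> is the tangential projection, the derivative of normalisation
    at a unit vector. The summands of \<open>L\<close> come from the gradient, from the unit vector
    and from its factor \<open>F\<close>.\<close>
  define L where "L u = H (P u) + (F \<xi> *\<^sub>R P u + D \<xi> u *\<^sub>R \<xi>)" for u
  have d: "(radial_ext (Cahn_Hoffman F) has_derivative L) (at \<xi>)"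
  proof -
    have "((\<lambda>x. radial_ext (sphere_grad F) x + radial_ext F x *\<^sub>R (x /\<^sub>R norm x)) has_derivative
      (\<lambda>u. (\<Sum>b\<in>Basis. D2 b \<xi> (u - (\<xi> \<bullet> u) *\<^sub>R \<xi>) *\<^sub>R b) +
        (radial_ext F \<xi> *\<^sub>R (u - (\<xi> \<bullet> u) *\<^sub>R \<xi>) + D \<xi> u *\<^sub>R (\<xi> /\<^sub>R norm \<xi>)))) (at \<xi>)"
      by (intro has_derivative_add grad_derivative has_derivative_scaleR gauge_D unit_radial_derivative \<xi> x0)
    then show ?thesis
      unfolding radial_Cahn_Hoffman radial_grad L_def[abs_def] H_def P_def by (simp only: F\<xi> R)
  qed
  have Hin: "H u \<bullet> v = D2 v \<xi> u" for u v
    unfolding H_def D2_expand[OF x0, of v] inner_sum_left by (rule sum.cong) (simp_all add: inner_commute)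
  have P: "P u = u" if "u \<bullet> \<xi> = 0" for u using that by (simp add: P_def inner_commute)
  have Luv: "L u \<bullet> v = D2 v \<xi> u + F \<xi> * (u \<bullet> v)" if "u \<bullet> \<xi> = 0" "v \<bullet> \<xi> = 0" for u v
    using that by (simp add: L_def P inner_add_left Hin inner_commute[of \<xi> v])
  have hess: "sphere_hess F \<xi> u v = D2 v \<xi> u" if "u \<bullet> \<xi> = 0" for u v
  proof -
    have "frechet_derivative (radial_ext (sphere_grad F)) (at \<xi>) = (\<lambda>u. H (P u))"
      using frechet_derivative_at[OF grad_derivative[OF \<xi>]] by (simp add: H_def P_def)
    then show ?thesis using P[OF that] by (simp add: sphere_hess_def sphere_diff_def Hin)
  qed
  show ?thesis
  proof (rule that[OF has_derivative_linear[OF d] d])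
    show "L u \<bullet> \<xi> = 0" if "u \<bullet> \<xi> = 0" for u
      using that D2_radial[OF x0, of u] by (simp add: L_def P inner_add_left Hin R)
    show "L u \<bullet> v = L v \<bullet> u" if "u \<bullet> \<xi> = 0" "v \<bullet> \<xi> = 0" for u v
      unfolding Luv[OF that] Luv[OF that(2,1)] D2_sym[OF x0, of v u] by (simp only: inner_commute[of v u])
    show "0 < L u \<bullet> u" if "u \<bullet> \<xi> = 0" "u \<noteq> 0" for u
    proof -
      have "\<xi> \<in> sphere 0 1" using \<xi> by simp
      then have "0 < sphere_hess F \<xi> u u + F \<xi> * (u \<bullet> u)"
        using gauge that unfolding anisotropic_gauge_def by blast
      then show ?thesis using that by (simp add: Luv hess)
    qed
  qed
qed

end

text \<open>A product of a positive definite and a symmetric endomorphism is self-adjoint for the inner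
  product defined by the inverse of the former.\<close>

lemma shape_selfadjoint:
  fixes a b :: "real^'n \<Rightarrow> 'a::euclidean_space" and L :: "'a \<Rightarrow> 'a"
  assumes a: "linear a" "inj a" and range: "range a = {v. v \<bullet> \<xi> = 0}"
    and b: "linear b" "\<And>u. b u \<bullet> \<xi> = 0" and symm: "\<And>u v. b u \<bullet> a v = b v \<bullet> a u"
    and L: "linear L" "\<And>u. u \<bullet> \<xi> = 0 \<Longrightarrow> L u \<bullet> \<xi> = 0"
      "\<And>u v. u \<bullet> \<xi> = 0 \<Longrightarrow> v \<bullet> \<xi> = 0 \<Longrightarrow> L u \<bullet> v = L v \<bullet> u"
      "\<And>u. u \<bullet> \<xi> = 0 \<Longrightarrow> u \<noteq> 0 \<Longrightarrow> 0 < L u \<bullet> u"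
  defines "S \<equiv> \<lambda>w. THE u. a u = L (b w)"
  shows "linear S" "a (S w) = L (b w)"
    "det (matrix (\<lambda>w. w + t *\<^sub>R S w)) = (\<Sum>r\<le>CARD('n). elem_sym r (eigenvalue_list S) * t ^ r)"
proof -
  obtain g where g: "linear g" "\<And>u. g (a u) = u"
    using linear_injective_left_inverse[OF a] by (auto simp: fun_eq_iff)
  have ag: "a (g v) = v" if "v \<bullet> \<xi> = 0" for v
  proof -
    have "v \<in> range a" using range that by simp
    then show ?thesis using g(2) by auto
  qed
  have aX: "a u \<bullet> \<xi> = 0" for u using range by blast
  have Sg: "S w = g (L (b w))" for w
  proof -
    have "a (g (L (b w))) = L (b w)" by (intro ag L(2) b(2))
    then show ?thesis unfolding S_def using a(2) by (intro the_equality) (auto simp: inj_def)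
  qed
  show aS: "a (S w) = L (b w)" for w unfolding Sg by (intro ag L(2) b(2))
  show linS: "linear S"
    unfolding Sg[abs_def] using linear_compose[OF linear_compose[OF b(1) L(1)] g(1)] by (simp add: o_def)
  \<comment> \<open>\<open>T0\<close> is dPhi transported to the coordinates by \<open>a\<close>,
    and \<open>C\<close> below is its inverse; \<open>T0\<close> is injective because
    \<open>L\<close> is positive on tangent vectors.\<close>
  define T0 where "T0 w = g (L (a w))" for w
  have aT0: "a (T0 w) = L (a w)" for w unfolding T0_def by (intro ag L(2) aX)
  have linT0: "linear T0"
    unfolding T0_def[abs_def] using linear_compose[OF linear_compose[OF a(1) L(1)] g(1)] by (simp add: o_def)
  have "inj T0"
    unfolding linear_injective_0[OF linT0]
  proof (intro allI impI)
    fix w assume "T0 w = 0"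
    then have "L (a w) = 0" using aT0[of w] linear_0[OF a(1)] by simp
    then have "a w = 0" using L(4)[OF aX, of w] by fastforce
    then show "w = 0" using g(2)[of w] linear_0[OF g(1)] by simp
  qed
  then obtain C where C: "linear C" "\<And>u. T0 (C u) = u" "\<And>u. C (T0 u) = u"
    using linear_injective_isomorphism[OF linT0] by blast
  have aC: "L (a (C u)) = a u" for u using aT0[of "C u"] C(2) by simp
  \<comment> \<open>The product of \<open>a u\<close> and \<open>a v\<close> weighted with the
    inverse of \<open>L\<close>. As \<open>a (S u) = L (b u)\<close>, the factor \<open>L\<close>
    cancels and \<open>B (S u) v\<close> is \<open>b u \<bullet> a v\<close>, the second fundamental
    form.\<close>
  define B where "B u v = a (C u) \<bullet> a v" for u v
  have "bilinear B"
    unfolding bilinear_def B_def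
    by (auto intro!: linearI simp: linear_add[OF a(1)] linear_add[OF C(1)] linear_scale[OF a(1)] linear_scale[OF C(1)]
        inner_add_left inner_add_right)
  moreover have "0 < B u u" if "u \<noteq> 0" for u
  proof -
    have "C u \<noteq> 0" using C(2)[of u] that linear_0[OF linT0] by metis
    then have "a (C u) \<noteq> 0" using g(2) linear_0[OF g(1)] by metis
    then show ?thesis using L(4)[OF aX, of "C u"] aC[of u] by (simp add: B_def inner_commute)
  qed
  moreover have "B u v = B v u" for u v
    using L(3)[OF aX aX, of "C u" "C v"] by (simp add: B_def aC inner_commute)
  moreover have "B (S u) v = B u (S v)" for u v
  proof -
    have BS: "B (S u) v = b u \<bullet> a v" for u v
    proof -
      have "T0 (g (b u)) = S u" unfolding T0_def Sg by (simp add: ag b(2))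
      then have "C (S u) = g (b u)" using C(3) by metis
      then show ?thesis by (simp add: B_def ag b(2))
    qed
    have "B u (S v) = B (S v) u" using calculation by (simp add: B_def)
    then show ?thesis using symm BS by simp
  qed
  ultimately show "det (matrix (\<lambda>w. w + t *\<^sub>R S w)) = (\<Sum>r\<le>CARD('n). elem_sym r (eigenvalue_list S) * t ^ r)"
    by (intro det_selfadjoint_eq_elem_sym[OF linS])
qed

section \<open>Hypersurfaces in a wedge\<close>

context corner_mfd
begin

text \<open>Directions with nonnegative components preserve all constraints of the corner. Such
  segments serve for one-sided derivatives along faces and for reaching boundary points as
  limits.\<close>

lemma corner_ray:
  assumes c: "c \<in> A" and y: "y \<in> img c" and v: "\<And>i. 0 \<le> v $ i" and W: "open W" "y \<in> W"
  obtains \<epsilon> where "0 < \<epsilon>" "\<And>s. 0 \<le> s \<Longrightarrow> s \<le> \<epsilon> \<Longrightarrow> y + s *\<^sub>R v \<in> img c \<and> y + s *\<^sub>R v \<in> W"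
proof -
  obtain O1 where O1: "open O1" "img c = corner K \<inter> O1" using chart_img_open[OF c] by (metis openin_open)
  have "open (O1 \<inter> W)" "y \<in> O1 \<inter> W" using O1 W y by auto
  then obtain r where r: "0 < r" "ball y r \<subseteq> O1 \<inter> W" by (meson openE)
  define N where "N = norm v + 1"
  define \<epsilon> where "\<epsilon> = r / (2 * N)"
  have n: "0 < N" by (simp add: N_def add_nonneg_pos)
  have \<epsilon>: "0 < \<epsilon>" using r n by (simp add: \<epsilon>_def)
  show ?thesis
  proof (rule that[OF \<epsilon>])
    fix s :: real assume s: "0 \<le> s" "s \<le> \<epsilon>"
    have "norm (s *\<^sub>R v) \<le> \<epsilon> * N" using s n by (auto simp: N_def intro!: mult_mono)
    also have "\<dots> = r / 2" using n by (simp add: \<epsilon>_def)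
    also have "\<dots> < r" using r by simp
    finally have "y + s *\<^sub>R v \<in> ball y r" by (simp add: dist_norm)
    moreover have "y + s *\<^sub>R v \<in> corner K" using y O1 s v by (auto simp: corner_def)
    ultimately show "y + s *\<^sub>R v \<in> img c \<and> y + s *\<^sub>R v \<in> W" using r O1 by blast
  qed
qed

lemma chart_diff_add:
  assumes "C1_map A f" "C1_map A g" "c \<in> A" "p \<in> fst c"
  shows "chart_diff c (\<lambda>q. f q + g q) p = (\<lambda>w. chart_diff c f p w + chart_diff c g p w)"
  by (rule chart_diff_eqI[OF assms(3,4)])
     (use has_derivative_add[OF C1_map_derivative[OF assms(1,3,4)] C1_map_derivative[OF assms(2,3,4)]] in \<open>simp add: in_chart_def[abs_def]\<close>)

lemma chart_diff_scaleR:
  assumes "C1_map A g" "c \<in> A" "p \<in> fst c"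
  shows "chart_diff c (\<lambda>q. t *\<^sub>R g q) p = (\<lambda>w. t *\<^sub>R chart_diff c g p w)"
  by (rule chart_diff_eqI[OF assms(2,3)])
     (use has_derivative_scaleR_right[OF C1_map_derivative[OF assms(1,2,3)], of t] in \<open>simp add: in_chart_def[abs_def]\<close>)

lemma chart_diff_local_zero:
  assumes c: "c \<in> A" "p \<in> fst c" and W: "openin T W" "p \<in> W" "\<And>q. q \<in> W \<Longrightarrow> f q = 0"
  shows "chart_diff c f p = (\<lambda>_. 0)"
proof (rule chart_diff_eqI[OF c])
  have "openin (top_of_set (corner K)) (snd c ` (fst c \<inter> W))" by (rule chart_open_image[OF c(1) W(1)])
  then obtain O1 where O1: "open O1" "snd c ` (fst c \<inter> W) = corner K \<inter> O1" by (metis openin_open)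
  have "snd c p \<in> O1" using O1 c W by blast
  then obtain r where r: "0 < r" "ball (snd c p) r \<subseteq> O1" using O1 by (meson openE)
  have imgK: "img c \<subseteq> corner K" using chart_img_open[OF c(1)] openin_subset by fastforce
  show "(in_chart c f has_derivative (\<lambda>_. 0)) (at (snd c p) within img c)"
  proof (rule has_derivative_transform_within[OF has_derivative_const[of 0] r(1)])
    fix y assume y: "y \<in> img c" "dist y (snd c p) < r"
    then have "y \<in> snd c ` (fst c \<inter> W)" using r O1 imgK by (auto simp: dist_commute subset_iff)
    then show "0 = in_chart c f y" using W(3) by (auto simp: in_chart_apply[OF c(1)])
  qed (use c in auto)
qed

lemma chart_at: "p \<in> topspace T \<Longrightarrow> chart_at A p \<in> A \<and> p \<in> fst (chart_at A p)"
  unfolding chart_at_def using chart_cover by (metis (mono_tags, lifting) someI_ex)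

lemma linear_matrix_expand:
  fixes b :: "real^'k \<Rightarrow> 'b::real_vector"
  assumes "linear b"
  shows "b (J (axis i 1)) = (\<Sum>j\<in>UNIV. matrix J $ j $ i *\<^sub>R b (axis j 1))"
proof -
  have "J (axis i 1) = (\<Sum>j\<in>UNIV. (J (axis i 1) $ j) *\<^sub>R axis j 1)"
    using basis_expansion[of "J (axis i 1)"] by (simp add: scalar_mult_eq_scaleR)
  then have "b (J (axis i 1)) = b (\<Sum>j\<in>UNIV. (J (axis i 1) $ j) *\<^sub>R axis j 1)" by (rule arg_cong)
  then show ?thesis using assms by (simp add: linear_sum linear_scale matrix_def)
qed

lemma C1_map_add: "C1_map A f \<Longrightarrow> C1_map A g \<Longrightarrow> C1_map A (\<lambda>q. f q + g q)"
  unfolding C1_map_def in_chart_def[abs_def] by (auto intro: C1_on_add)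

lemma C1_map_scaleR: "C1_map A f \<Longrightarrow> C1_map A g \<Longrightarrow> C1_map A (\<lambda>q. f q *\<^sub>R g q)" for f :: "'p \<Rightarrow> real"
  unfolding C1_map_def in_chart_def[abs_def] by (auto intro: C1_on_scaleR)

lemma C1_map_const: "C1_map A (\<lambda>_. v)"
  unfolding C1_map_def in_chart_def[abs_def] by (auto intro: C1_on_const)

lemma C1_map_sum: "finite I \<Longrightarrow> (\<And>i. i \<in> I \<Longrightarrow> C1_map A (f i)) \<Longrightarrow> C1_map A (\<lambda>q. \<Sum>i\<in>I. f i q)"
  unfolding C1_map_def in_chart_def[abs_def] by (intro ballI C1_on_sum) auto

lemma C1_map_inverse:
  fixes f :: "'p \<Rightarrow> real"
  assumes "C1_map A f" "\<And>p. p \<in> topspace T \<Longrightarrow> f p \<noteq> 0"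
  shows "C1_map A (\<lambda>q. inverse (f q))"
  unfolding C1_map_def
proof
  fix c assume c: "c \<in> A"
  have "C1_on (img c) (\<lambda>y. inverse (in_chart c f y))"
    by (rule C1_on_inverse) (use assms chart_sub[OF c] c in \<open>auto simp: C1_map_def in_chart_apply[OF c]\<close>)
  then show "C1_on (img c) (in_chart c (\<lambda>q. inverse (f q)))" by (simp add: in_chart_def[abs_def])
qed

lemma C1_map_continuous: "C1_map A f \<Longrightarrow> c \<in> A \<Longrightarrow> continuous_on (img c) (in_chart c f)"
  unfolding C1_map_def by (auto intro: C1_on_imp_continuous_on)

end

text \<open>The bijection \<open>e\<close> assigns the rows of a determinant to the distinguished
  vector and to the chart coordinates. Another choice changes at most the sign of
  \<open>vol\<close>, which cancels in quotients by \<open>vx\<close>.\<close>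

locale wedge_hypersurface =
  fixes T :: "'p topology" and A :: "('p, 'n::finite) chart set" and K :: "'n set"
    and x \<nu> :: "'p \<Rightarrow> real^'m" and F :: "real^'m \<Rightarrow> real" and n1 n2 k :: "real^'m" and \<omega>1 \<omega>2 :: real
    and e :: "'n option \<Rightarrow> 'm"
  assumes gauge: "anisotropic_gauge F" and e: "bij e"
    and hyp: "immersed_hypersurface_in_wedge T A K x \<nu> n1 n2"
    and nonzero: "n1 \<noteq> 0" "n2 \<noteq> 0"
    and bd1: "\<And>p. p \<in> boundary_part A K x n1 n2 \<Longrightarrow> Cahn_Hoffman F (\<nu> p) \<bullet> n1 = \<omega>1"
    and bd2: "\<And>p. p \<in> boundary_part A K x n2 n1 \<Longrightarrow> Cahn_Hoffman F (\<nu> p) \<bullet> n2 = \<omega>2"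
    and k1: "k \<bullet> n1 = \<omega>1" and k2: "k \<bullet> n2 = \<omega>2"
begin

section \<open>Tangent spaces, second fundamental form and shape operator of the immersion\<close>

lemma mfd: "corner_manifold T A K"
  using hyp by (auto simp: immersed_hypersurface_in_wedge_def immersed_hypersurface_def)

sublocale corner_mfd T A K by unfold_locales (rule mfd)

lemma smooth_x: "smooth_map A x" and C1x: "C1_map A x" and C1\<nu>: "C1_map A \<nu>" and compact_T: "compact_space T"
  using hyp by (auto simp: immersed_hypersurface_in_wedge_def immersed_hypersurface_def intro: smooth_map_C1_map)

lemma hyp_facts:
  "\<forall>c\<in>A. \<forall>p\<in>fst c. inj (chart_diff c x p)"
  "\<forall>p\<in>topspace T. norm (\<nu> p) = 1"
  "\<forall>c\<in>A. \<forall>p\<in>fst c. \<forall>w. chart_diff c x p w \<bullet> \<nu> p = 0"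
  using hyp unfolding immersed_hypersurface_in_wedge_def immersed_hypersurface_def
  by - (elim conjE, assumption)+

lemma dx_inj: "c \<in> A \<Longrightarrow> p \<in> fst c \<Longrightarrow> inj (chart_diff c x p)"
  and dx_normal: "c \<in> A \<Longrightarrow> p \<in> fst c \<Longrightarrow> chart_diff c x p w \<bullet> \<nu> p = 0"
  and norm_\<nu>: "p \<in> topspace T \<Longrightarrow> norm (\<nu> p) = 1"
  using hyp_facts by simp_all

lemma norm_\<nu>_chart: "c \<in> A \<Longrightarrow> p \<in> fst c \<Longrightarrow> norm (\<nu> p) = 1"
  using norm_\<nu> chart_sub by blast

abbreviation "vx c p \<equiv> vol e (\<nu> p) (\<lambda>i. chart_diff c x p (axis i 1))"

lemma area_density_vol: "c \<in> A \<Longrightarrow> p \<in> fst c \<Longrightarrow> area_density c x p = \<bar>vx c p\<bar>"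
  unfolding area_density_def by (subst gram_det_eq_vol_sq[OF e norm_\<nu>_chart dx_normal]) auto

sublocale C1_mfd T A K x
  by unfold_locales (use C1x compact_T area_density_vol in auto)

lemma vx_nonzero: assumes "c \<in> A" "p \<in> fst c" shows "vx c p \<noteq> 0"
proof (rule vol_nonzero[OF e norm_\<nu>_chart[OF assms] dx_normal[OF assms]])
  fix v :: "real^'n" assume v: "(\<Sum>i\<in>UNIV. v $ i *\<^sub>R chart_diff c x p (axis i 1)) = 0"
  have lin: "linear (chart_diff c x p)" by (rule C1_map_linear[OF C1x assms])
  have "chart_diff c x p v = chart_diff c x p (\<Sum>i\<in>UNIV. v $ i *\<^sub>R axis i 1)"
    using basis_expansion[of v] by (simp add: scalar_mult_eq_scaleR)
  also have "\<dots> = 0" using v by (simp add: linear_sum[OF lin] linear_scale[OF lin])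
  finally show "v = 0" using dx_inj[OF assms] linear_0[OF lin] by (metis injD)
qed

text \<open>Differentiate the constant \<nu> \<bullet> \<nu> = 1 within the chart image, where
  derivatives are unique.\<close>

lemma d\<nu>_tangent: assumes "c \<in> A" "p \<in> fst c" shows "chart_diff c \<nu> p w \<bullet> \<nu> p = 0"
proof -
  have d: "((\<lambda>y. in_chart c \<nu> y \<bullet> in_chart c \<nu> y) has_derivative (\<lambda>w. \<nu> p \<bullet> chart_diff c \<nu> p w + chart_diff c \<nu> p w \<bullet> \<nu> p)) (at (snd c p) within img c)"
    using has_derivative_inner[OF C1_map_derivative[OF C1\<nu> assms] C1_map_derivative[OF C1\<nu> assms]]
    by (simp add: in_chart_apply[OF assms])
  have "((\<lambda>y. in_chart c \<nu> y \<bullet> in_chart c \<nu> y) has_derivative (\<lambda>_. 0)) (at (snd c p) within img c)"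
    by (rule has_derivative_transform[OF _ _ has_derivative_const[of 1]])
       (use assms norm_\<nu>_chart[OF assms(1)] in \<open>auto simp: in_chart_apply[OF assms(1)] norm_eq_1\<close>)
  from corner_derivative_unique[OF chart_img_open[OF assms(1)] _ d this] assms(2)
  have "\<nu> p \<bullet> chart_diff c \<nu> p w + chart_diff c \<nu> p w \<bullet> \<nu> p = 0" by (auto dest: fun_cong)
  then show ?thesis by (simp add: inner_commute)
qed

text \<open>The image lies in the tangent hyperplane and has its dimension, because dx is injective
  and the codimension is one.\<close>

lemma dx_range: assumes "c \<in> A" "p \<in> fst c" shows "range (chart_diff c x p) = {v. v \<bullet> \<nu> p = 0}"
proof (rule subspace_dim_equal)
  have lin: "linear (chart_diff c x p)" by (rule C1_map_linear[OF C1x assms])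
  show "subspace (range (chart_diff c x p))" using linear_subspace_image[OF lin subspace_UNIV] .
  show "subspace {v. v \<bullet> \<nu> p = 0}" by (auto simp: subspace_def inner_add_left)
  show "range (chart_diff c x p) \<subseteq> {v. v \<bullet> \<nu> p = 0}" using dx_normal[OF assms] by auto
  have "\<nu> p \<noteq> 0" using norm_\<nu>_chart[OF assms] by auto
  then have "dim {v. \<nu> p \<bullet> v = 0} = CARD('m) - 1" by (simp add: dim_hyperplane)
  moreover have "CARD('m) = CARD('n) + 1" using bij_betw_same_card[OF e] by (simp add: card_UNIV_option)
  moreover have "dim (range (chart_diff c x p)) = CARD('n)"
    using dim_image_eq[OF lin] dx_inj[OF assms] by simp
  ultimately show "dim {v. v \<bullet> \<nu> p = 0} \<le> dim (range (chart_diff c x p))" by (simp add: inner_commute)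
qed

abbreviation "\<nu>F q \<equiv> Cahn_Hoffman F (\<nu> q)"

lemma \<nu>F_in_chart: "c \<in> A \<Longrightarrow> y \<in> img c \<Longrightarrow> radial_ext (Cahn_Hoffman F) (in_chart c \<nu> y) = in_chart c \<nu>F y"
  using norm_\<nu>_chart[of c] by (auto simp: in_chart_apply radial_ext_def)

text \<open>The normal has length one, so Phi may be replaced by its radial extension, which is C^1
  on an open set containing the values of \<nu>.\<close>

lemma C1\<nu>F: "C1_map A \<nu>F"
  unfolding C1_map_def
proof
  fix c assume c: "c \<in> A"
  have "C1_on (img c) (\<lambda>y. radial_ext (Cahn_Hoffman F) (in_chart c \<nu> y))"
  proof (rule C1_on_compose[OF Cahn_Hoffman_C1[OF gauge]])
    show "C1_on (img c) (in_chart c \<nu>)" using C1\<nu> c by (auto simp: C1_map_def)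
    show "in_chart c \<nu> ` img c \<subseteq> - {0}" using norm_\<nu>_chart[OF c] by (force simp: in_chart_apply[OF c])
  qed
  then show "C1_on (img c) (in_chart c \<nu>F)" by (rule C1_on_cong) (rule \<nu>F_in_chart[OF c])
qed

lemma d\<nu>F:
  assumes c: "c \<in> A" "p \<in> fst c" and L: "(radial_ext (Cahn_Hoffman F) has_derivative L) (at (\<nu> p))"
  shows "chart_diff c \<nu>F p w = L (chart_diff c \<nu> p w)"
proof -
  have "(radial_ext (Cahn_Hoffman F) \<circ> in_chart c \<nu> has_derivative L \<circ> chart_diff c \<nu> p) (at (snd c p) within img c)"
    by (rule diff_chain_within[OF C1_map_derivative[OF C1\<nu> c]])
       (use L in \<open>auto simp: in_chart_apply[OF c] intro: has_derivative_at_withinI\<close>)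
  then have "(in_chart c \<nu>F has_derivative L \<circ> chart_diff c \<nu> p) (at (snd c p) within img c)"
    by (rule has_derivative_transform[rotated 2]) (use c in \<open>auto simp: \<nu>F_in_chart[OF c(1)]\<close>)
  from chart_diff_eqI[OF c this] show ?thesis by simp
qed

text \<open>Where no restricted coordinate vanishes, differentiating dx(u) \<bullet> \<nu> = 0 along
  v expresses the form by second derivatives of x, which are symmetric. Boundary points are reached
  by continuity.\<close>

lemma second_fundamental_form_sym:
  assumes c: "c \<in> A" "p \<in> fst c"
  shows "chart_diff c \<nu> p u \<bullet> chart_diff c x p v = chart_diff c \<nu> p v \<bullet> chart_diff c x p u"
proof -
  define h where "h y = chart_diff c \<nu> (par c y) u \<bullet> chart_diff c x (par c y) v - chart_diff c \<nu> (par c y) v \<bullet> chart_diff c x (par c y) u" for y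
  have ch: "continuous_on (img c) h"
    unfolding h_def using chart_diff_continuous[OF C1\<nu> c(1)] chart_diff_continuous[OF C1x c(1)]
    by (auto simp: in_chart_def[abs_def] intro!: continuous_intros)
  obtain O1 where O1: "open O1" "img c = corner K \<inter> O1" using chart_img_open[OF c(1)] by (metis openin_open)
  have "{y :: real^'n. \<forall>k\<in>K. 0 < y $ k} = (\<Inter>k\<in>K. {y. 0 < y $ k})" by auto
  then have op: "open {y :: real^'n. \<forall>k\<in>K. 0 < y $ k}"
    by (auto intro!: open_INT open_Collect_less continuous_intros)
  have inner: "h y = 0" if y: "y \<in> img c" "\<forall>k\<in>K. 0 < y $ k" for y
  proof -
    have "smooth_on (img c) (in_chart c x)" using smooth_x c by (auto simp: smooth_map_def)
    from bspec[OF this[unfolded smooth_on_def] y(1)]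
    obtain V g where V0: "open V" "y \<in> V" "\<forall>j. Ck_on j V g" "\<forall>y\<in>V \<inter> img c. g y = in_chart c x y"
      by (elim exE conjE) (rule that)
    note V = V0(1,2) V0(3)[rule_format] V0(4)[rule_format]
    define U where "U = V \<inter> O1 \<inter> {y. \<forall>k\<in>K. 0 < y $ k}"
    have U: "open U" "y \<in> U" "U \<subseteq> V" "U \<subseteq> img c"
      unfolding U_def using V O1 op y by (auto simp: corner_def less_imp_le)
    define Dg where "Dg y v = frechet_derivative g (at y) v" for y v
    define D2 where "D2 v y = frechet_derivative (\<lambda>y. Dg y v) (at y)" for v y
    have Ck2: "Ck_on (Suc 1) V g" using V(3)[of "Suc 1"] .
    have g1: "(g has_derivative Dg y) (at y)" if "y \<in> U" for y
      using Ck1D(1)[OF V(3)[of 1]] that U(3) unfolding Dg_def[abs_def] by blast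
    have "\<And>v. Ck_on 1 V (\<lambda>y. Dg y v)" using Ck2 unfolding Dg_def Ck_on.simps(2)[of 1] by blast
    note Ck1 = this
    have g2: "((\<lambda>y. Dg y v) has_derivative D2 v y) (at y)" if "y \<in> U" for y v
      unfolding D2_def by (rule Ck1D(1)[OF Ck1]) (use that U(3) in auto)
    have g2c: "continuous_on U (\<lambda>y. D2 v y w)" for v w
      unfolding D2_def by (rule continuous_on_subset[OF Ck1D(2)[OF Ck1] U(3)])
    have dxg: "chart_diff c x (par c z) = Dg z" if z: "z \<in> U" for z
    proof -
      have pz: "par c z \<in> fst c" "snd c (par c z) = z" using par_img[OF c(1)] z U(4) by auto
      have "(in_chart c x has_derivative Dg z) (at z)"
        by (rule has_derivative_transform_within_open[OF g1[OF z] U(1) z], rule V(4)) (use U(3,4) in blast)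
      then have "(in_chart c x has_derivative Dg z) (at (snd c (par c z)) within img c)"
        unfolding pz(2) by (rule has_derivative_at_withinI)
      then show ?thesis by (rule chart_diff_eqI[OF c(1) pz(1)])
    qed
    define N where "N = chart_diff c \<nu> (par c y)"
    have dN: "(in_chart c \<nu> has_derivative N) (at y)"
    proof -
      have "(in_chart c \<nu> has_derivative N) (at y within img c)"
        using C1_map_derivative[OF C1\<nu> c(1), of "par c y"] par_img[OF c(1) y(1)] by (simp add: N_def)
      then have "(in_chart c \<nu> has_derivative N) (at y within U)" using U(4) by (rule has_derivative_subset)
      then show ?thesis using at_within_open[OF U(2,1)] by (simp only:)
    qed
    have key: "Dg y u \<bullet> N v = - (D2 u y v \<bullet> in_chart c \<nu> y)" for u v
    proof -
      have d1: "((\<lambda>z. Dg z u \<bullet> in_chart c \<nu> z) has_derivative (\<lambda>v. Dg y u \<bullet> N v + D2 u y v \<bullet> in_chart c \<nu> y)) (at y)"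
        by (rule has_derivative_inner[OF g2[OF U(2)] dN])
      have d2: "((\<lambda>z. Dg z u \<bullet> in_chart c \<nu> z) has_derivative (\<lambda>_. 0)) (at y)"
      proof (rule has_derivative_transform_within_open[OF has_derivative_const[of 0] U(1,2)])
        fix z assume z: "z \<in> U"
        then have "par c z \<in> fst c" using par_img[OF c(1)] U(4) by blast
        then show "0 = Dg z u \<bullet> in_chart c \<nu> z"
          using dx_normal[OF c(1), of "par c z" u] dxg[OF z] by (simp add: in_chart_def)
      qed
      have "Dg y u \<bullet> N v + D2 u y v \<bullet> in_chart c \<nu> y = 0"
        by (rule fun_cong[OF has_derivative_unique[OF d1 d2]])
      then show ?thesis by linarith
    qed
    have "D2 u y v = D2 v y u"
      by (rule symmetric_second_derivative[OF U(1,2) g1 g2 g2 g2c g2c]) (use U(2) in auto)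
    then have "Dg y u \<bullet> N v = Dg y v \<bullet> N u" using key by simp
    then show ?thesis by (simp add: h_def N_def[symmetric] dxg[OF U(2)] inner_commute)
  qed
  have y: "snd c p \<in> img c" using c by auto
  \<comment> \<open>All components are positive, so a move along \<open>v1\<close> leaves every face
    at once.\<close>
  define v1 :: "real^'n" where "v1 = (\<chi> i. 1)"
  obtain \<epsilon> where \<epsilon>: "0 < \<epsilon>" "\<And>s. 0 \<le> s \<Longrightarrow> s \<le> \<epsilon> \<Longrightarrow> snd c p + s *\<^sub>R v1 \<in> img c"
    using corner_ray[OF c(1) y, of v1 UNIV] by (auto simp: v1_def)
  have imgK: "img c \<subseteq> corner K" using chart_img_open[OF c(1)] openin_subset by fastforce
  have "h (snd c p + 0 *\<^sub>R v1) = 0"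
  proof (rule continuous_constant_on_closure[of "{0<..\<epsilon>}" "\<lambda>s. h (snd c p + s *\<^sub>R v1)"])
    show "continuous_on (closure {0<..\<epsilon>}) (\<lambda>s. h (snd c p + s *\<^sub>R v1))"
      using \<epsilon> by (auto intro!: continuous_on_compose2[OF ch] continuous_intros)
    show "(0::real) \<in> closure {0<..\<epsilon>}" using \<epsilon> by simp
    fix s assume s: "s \<in> {0<..\<epsilon>}"
    show "h (snd c p + s *\<^sub>R v1) = 0"
    proof (rule inner)
      show "snd c p + s *\<^sub>R v1 \<in> img c" using \<epsilon> s by auto
      show "\<forall>k\<in>K. 0 < (snd c p + s *\<^sub>R v1) $ k"
        using y imgK s by (auto simp: corner_def v1_def intro!: add_nonneg_pos)
    qed
  qed
  then show ?thesis by (simp add: h_def chart_inv[OF c])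
qed

definition \<sigma> :: "nat \<Rightarrow> 'p \<Rightarrow> real" where
  "\<sigma> r p = elem_sym r (eigenvalue_list (anisotropic_shape A F x \<nu> p))"

text \<open>The description in \<open>anisotropic_shape\<close> denotes a vector because
  \<open>L\<close> maps tangent vectors to tangent vectors and dx is injective. Self-adjointness
  then makes det(1 + t S) the generating polynomial of the unnormalised curvatures \<sigma>.\<close>

lemma shape_facts:
  assumes p: "p \<in> topspace T"
  defines "c \<equiv> chart_at A p" and "S \<equiv> anisotropic_shape A F x \<nu> p"
  shows "chart_diff c x p (S w) = chart_diff c \<nu>F p w"
    "det (matrix (\<lambda>w. w + t *\<^sub>R S w)) = (\<Sum>r\<le>CARD('n). \<sigma> r p * t ^ r)"
proof -
  have c: "c \<in> A" "p \<in> fst c" using chart_at[OF p] by (auto simp: c_def)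
  obtain L where L: "linear L" "(radial_ext (Cahn_Hoffman F) has_derivative L) (at (\<nu> p))"
    "\<And>u. u \<bullet> \<nu> p = 0 \<Longrightarrow> L u \<bullet> \<nu> p = 0"
    "\<And>u v. u \<bullet> \<nu> p = 0 \<Longrightarrow> v \<bullet> \<nu> p = 0 \<Longrightarrow> L u \<bullet> v = L v \<bullet> u"
    "\<And>u. u \<bullet> \<nu> p = 0 \<Longrightarrow> u \<noteq> 0 \<Longrightarrow> 0 < L u \<bullet> u"
    using Cahn_Hoffman_derivative[OF gauge norm_\<nu>[OF p]] by metis
  have S: "S = (\<lambda>w. THE u. chart_diff c x p u = L (chart_diff c \<nu> p w))"
    unfolding S_def anisotropic_shape_def Let_def c_def[symmetric] d\<nu>F[OF c L(2)] ..
  note rules = C1_map_linear[OF C1x c] dx_inj[OF c] dx_range[OF c] C1_map_linear[OF C1\<nu> c] d\<nu>_tangent[OF c]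
    second_fundamental_form_sym[OF c] L(1)
  note SA = shape_selfadjoint[where a = "chart_diff c x p" and b = "chart_diff c \<nu> p" and \<xi> = "\<nu> p" and L = L]
  have S2: "chart_diff c x p (S w) = L (chart_diff c \<nu> p w)" for w
    unfolding S by (rule SA(2)) (rule rules | rule L(3-5), assumption+)+
  then show "chart_diff c x p (S w) = chart_diff c \<nu>F p w" using d\<nu>F[OF c L(2), of w] by (simp only:)
  have "det (matrix (\<lambda>w. w + t *\<^sub>R S w)) = (\<Sum>r\<le>CARD('n). elem_sym r (eigenvalue_list S) * t ^ r)"
    unfolding S by (rule SA(3)) (rule rules | rule L(3-5), assumption+)+
  then show "det (matrix (\<lambda>w. w + t *\<^sub>R S w)) = (\<Sum>r\<le>CARD('n). \<sigma> r p * t ^ r)"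
    by (simp only: \<sigma>_def S_def)
qed

section \<open>Densities of the parallel hypersurfaces\<close>

definition y where "y q = \<nu>F q - k"

definition z where "z t q = x q + t *\<^sub>R y q"

lemma C1y: "C1_map A y"
proof -
  have "C1_map A (\<lambda>q. \<nu>F q + (- k))" by (rule C1_map_add[OF C1\<nu>F C1_map_const])
  then show ?thesis by (simp add: y_def[abs_def])
qed

lemma C1z: "C1_map A (z t)"
proof -
  have "C1_map A (\<lambda>q. x q + t *\<^sub>R y q)" by (rule C1_map_add[OF C1x C1_map_scaleR[OF C1_map_const C1y]])
  then show ?thesis by (simp add: z_def[abs_def])
qed

lemma dy: assumes "c \<in> A" "p \<in> fst c" shows "chart_diff c y p w = chart_diff c \<nu>F p w"
proof -
  have "chart_diff c y p = (\<lambda>w. chart_diff c \<nu>F p w + chart_diff c (\<lambda>_. - k) p w)"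
    using chart_diff_add[OF C1\<nu>F C1_map_const assms, of "- k"] by (simp add: y_def[abs_def])
  moreover have "chart_diff c (\<lambda>_. - k) p = (\<lambda>_. 0)"
    by (rule chart_diff_eqI[OF assms]) (simp add: in_chart_def[abs_def])
  ultimately show ?thesis by simp
qed

lemma dz: assumes "c \<in> A" "p \<in> fst c" shows "chart_diff c (z t) p w = chart_diff c x p w + t *\<^sub>R chart_diff c y p w"
  unfolding z_def[abs_def]
  by (subst chart_diff_add[OF C1x C1_map_scaleR[OF C1_map_const C1y] assms]) (simp add: chart_diff_scaleR[OF C1y assms])

lemma y_normal: "p \<in> topspace T \<Longrightarrow> y p \<bullet> \<nu> p = F (\<nu> p) - k \<bullet> \<nu> p"
  by (simp add: y_def inner_diff_left Cahn_Hoffman_inner[OF gauge norm_\<nu>])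

text \<open>The integrand of the divergence identity in one chart. The field \<open>Y\<close> is a
  parameter in order that \<open>y\<close> can be cut into pieces supported in single
  charts.\<close>

definition tau_num :: "real \<Rightarrow> ('p \<Rightarrow> real^'m) \<Rightarrow> ('p, 'n) chart \<Rightarrow> 'p \<Rightarrow> real" where
  "tau_num t Y c p = dvol e (z t p) (\<lambda>i. chart_diff c (z t) p (axis i 1)) (\<lambda>i. chart_diff c Y p (axis i 1))
     - real CARD('n) * vol e (Y p) (\<lambda>i. chart_diff c (z t) p (axis i 1))"

text \<open>Division by the signed density \<open>vx\<close> turns a coordinate expression into a
  function on the hypersurface: a change of chart multiplies both by the same determinant, sign
  included.\<close>

definition tau :: "real \<Rightarrow> ('p \<Rightarrow> real^'m) \<Rightarrow> 'p \<Rightarrow> real" where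
  "tau t Y p = tau_num t Y (chart_at A p) p / vx (chart_at A p) p"

text \<open>The signed ratio of the area of the parallel hypersurface to that of the original one,
  both measured with the normal \<nu>. As a polynomial in \<open>t\<close> it carries all
  curvatures.\<close>

definition jac :: "real \<Rightarrow> 'p \<Rightarrow> real" where
  "jac t p = vol e (\<nu> p) (\<lambda>i. chart_diff (chart_at A p) (z t) p (axis i 1)) / vx (chart_at A p) p"

lemma chart_independence:
  assumes c: "c \<in> A" "p \<in> fst c" and d: "d \<in> A" "p \<in> fst d" and Y: "C1_map A Y"
  shows "tau_num t Y c p / vx c p = tau_num t Y d p / vx d p"
    and "vol e (\<nu> p) (\<lambda>i. chart_diff c (z t) p (axis i 1)) / vx c p = vol e (\<nu> p) (\<lambda>i. chart_diff d (z t) p (axis i 1)) / vx d p"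
proof -
  define J where "J = matrix (transition_diff c d p)"
  have ex: "chart_diff c f p (axis i 1) = (\<Sum>j\<in>UNIV. J $ j $ i *\<^sub>R chart_diff d f p (axis j 1))"
    if "C1_map A f" for f :: "'p \<Rightarrow> real^'m" and i
    unfolding chart_change[OF c(1) d(1) c(2) d(2) that] J_def
    by (rule linear_matrix_expand[OF C1_map_linear[OF that d]])
  have V: "vx c p = det J * vx d p" unfolding ex[OF C1x] by (rule vol_matrix[OF e])
  then have J: "det J \<noteq> 0" using vx_nonzero[OF c] by auto
  have "tau_num t Y c p = det J * tau_num t Y d p"
    unfolding tau_num_def ex[OF C1z] ex[OF Y] by (simp add: vol_matrix[OF e] dvol_matrix[OF e] algebra_simps)
  then show "tau_num t Y c p / vx c p = tau_num t Y d p / vx d p" using J by (simp add: V)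
  have "vol e (\<nu> p) (\<lambda>i. chart_diff c (z t) p (axis i 1)) = det J * vol e (\<nu> p) (\<lambda>i. chart_diff d (z t) p (axis i 1))"
    unfolding ex[OF C1z] by (rule vol_matrix[OF e])
  then show "vol e (\<nu> p) (\<lambda>i. chart_diff c (z t) p (axis i 1)) / vx c p = vol e (\<nu> p) (\<lambda>i. chart_diff d (z t) p (axis i 1)) / vx d p"
    using J by (simp add: V)
qed

lemma tau_chart:
  assumes "c \<in> A" "p \<in> fst c" "C1_map A Y"
  shows "tau t Y p = tau_num t Y c p / vx c p"
    and "jac t p = vol e (\<nu> p) (\<lambda>i. chart_diff c (z t) p (axis i 1)) / vx c p"
proof -
  have "p \<in> topspace T" using assms chart_sub by blast
  then have d: "chart_at A p \<in> A" "p \<in> fst (chart_at A p)" using chart_at by auto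
  show "tau t Y p = tau_num t Y c p / vx c p"
    and "jac t p = vol e (\<nu> p) (\<lambda>i. chart_diff c (z t) p (axis i 1)) / vx c p"
    unfolding tau_def jac_def by (rule chart_independence[OF d assms])+
qed

lemma chart_continuities:
  assumes c: "c \<in> A" and Y: "C1_map A Y"
  shows "continuous_on (img c) (\<lambda>w. tau_num t Y c (par c w))" "continuous_on (img c) (\<lambda>w. vx c (par c w))"
    "continuous_on (img c) (\<lambda>w. vol e (\<nu> (par c w)) (\<lambda>i. chart_diff c (z t) (par c w) (axis i 1)))"
  unfolding tau_num_def
  using chart_diff_continuous[OF C1z c] chart_diff_continuous[OF Y c] chart_diff_continuous[OF C1x c]
    C1_map_continuous[OF C1z c] C1_map_continuous[OF Y c] C1_map_continuous[OF C1\<nu> c]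
  by (auto simp: in_chart_def[abs_def] intro!: continuous_on_diff continuous_on_mult continuous_on_const continuous_on_dvol[OF e] continuous_on_vol[OF e])

lemma tau_continuous:
  assumes c: "c \<in> A" and Y: "C1_map A Y"
  shows "continuous_on (img c) (in_chart c (tau t Y))" "continuous_on (img c) (in_chart c (jac t))"
proof -
  have nz: "vx c (par c w) \<noteq> 0" if "w \<in> img c" for w using vx_nonzero[OF c] par_img[OF c that] by blast
  have "continuous_on (img c) (\<lambda>w. tau_num t Y c (par c w) / vx c (par c w))"
    using chart_continuities[OF c Y] nz by (intro continuous_on_divide) auto
  then show "continuous_on (img c) (in_chart c (tau t Y))"
    by (rule continuous_on_eq) (use tau_chart(1)[OF c _ Y] par_img[OF c] in \<open>auto simp: in_chart_def\<close>)
  have "continuous_on (img c) (\<lambda>w. vol e (\<nu> (par c w)) (\<lambda>i. chart_diff c (z t) (par c w) (axis i 1)) / vx c (par c w))"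
    using chart_continuities[OF c Y] nz by (intro continuous_on_divide) auto
  then show "continuous_on (img c) (in_chart c (jac t))"
    by (rule continuous_on_eq) (use tau_chart(2)[OF c _ Y] par_img[OF c] in \<open>auto simp: in_chart_def\<close>)
qed

text \<open>From dz = dx o (1 + t S) and dy = dx o S, adding \<open>s\<close> times dy to dz
  replaces \<open>t\<close> by \<open>t + s\<close>. So every volume is a value of the polynomial
  \<open>D\<close> times \<open>vol e v u\<close>, and \<open>dvol\<close> is obtained from the
  derivative of \<open>D\<close>.\<close>

lemma tau_jac_polynomial:
  assumes p: "p \<in> topspace T"
  shows "jac t p = (\<Sum>r\<le>CARD('n). \<sigma> r p * t ^ r)"
    and "tau t y p = (\<Sum>r\<le>CARD('n). \<sigma> r p * (real r * t ^ (r - 1))) * (z t p \<bullet> \<nu> p)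
       - real CARD('n) * (\<Sum>r\<le>CARD('n). \<sigma> r p * t ^ r) * (y p \<bullet> \<nu> p)"
proof -
  define c where "c = chart_at A p"
  define S where "S = anisotropic_shape A F x \<nu> p"
  have c: "c \<in> A" "p \<in> fst c" using chart_at[OF p] by (auto simp: c_def)
  define u where "u i = chart_diff c x p (axis i 1)" for i
  define D where "D s = (\<Sum>r\<le>CARD('n). \<sigma> r p * s ^ r)" for s
  note sf = shape_facts[OF p, folded c_def S_def]
  have lin: "linear (chart_diff c x p)" by (rule C1_map_linear[OF C1x c])
  have dzs: "chart_diff c (z t) p (axis i 1) + s *\<^sub>R chart_diff c y p (axis i 1)
      = (\<Sum>j\<in>UNIV. matrix (\<lambda>w. w + (t + s) *\<^sub>R S w) $ j $ i *\<^sub>R u j)" for i s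
  proof -
    have "chart_diff c (z t) p (axis i 1) + s *\<^sub>R chart_diff c y p (axis i 1) = chart_diff c x p (axis i 1 + (t + s) *\<^sub>R S (axis i 1))"
      by (simp add: dz[OF c] dy[OF c] sf(1) linear_add[OF lin] linear_scale[OF lin] algebra_simps)
    also have "\<dots> = (\<Sum>j\<in>UNIV. matrix (\<lambda>w. w + (t + s) *\<^sub>R S w) $ j $ i *\<^sub>R u j)"
      unfolding u_def by (rule linear_matrix_expand[OF lin, of "\<lambda>w. w + (t + s) *\<^sub>R S w"])
    finally show ?thesis .
  qed
  have vols: "vol e v (\<lambda>i. chart_diff c (z t) p (axis i 1) + s *\<^sub>R chart_diff c y p (axis i 1)) = D (t + s) * vol e v u" for v s
    unfolding dzs vol_matrix[OF e] sf(2) D_def ..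
  have vol0: "vol e v (\<lambda>i. chart_diff c (z t) p (axis i 1)) = D t * vol e v u" for v
    using vols[of v 0] by simp
  have tang: "vol e v u = (v \<bullet> \<nu> p) * vx c p" for v
    unfolding u_def by (rule vol_tangent[OF e norm_\<nu>[OF p] dx_normal[OF c]])
  have V: "vx c p \<noteq> 0" "vol e (\<nu> p) u = vx c p" using vx_nonzero[OF c] by (auto simp: u_def[abs_def])
  show "jac t p = (\<Sum>r\<le>CARD('n). \<sigma> r p * t ^ r)"
    unfolding tau_chart(2)[OF c C1y] vol0 V(2) D_def using V(1) by simp
  let ?D' = "\<Sum>r\<le>CARD('n). \<sigma> r p * (real r * t ^ (r - 1))"
  have "((\<lambda>s. D (t + s)) has_field_derivative ?D') (at 0)"
    unfolding D_def by (auto intro!: derivative_eq_intros sum.cong)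
  then have "((\<lambda>s. D (t + s) * vol e (z t p) u) has_field_derivative ?D' * vol e (z t p) u) (at 0)"
    by (rule DERIV_cmult_right)
  then have "dvol e (z t p) (\<lambda>i. chart_diff c (z t) p (axis i 1)) (\<lambda>i. chart_diff c y p (axis i 1)) = ?D' * vol e (z t p) u"
    using dvol_derivative[OF e, of "z t p" "\<lambda>i. chart_diff c (z t) p (axis i 1)" "\<lambda>i. chart_diff c y p (axis i 1)"]
    unfolding vols by (rule DERIV_unique[rotated])
  then have "tau_num t y c p = ?D' * (z t p \<bullet> \<nu> p) * vx c p - real CARD('n) * (D t * (y p \<bullet> \<nu> p) * vx c p)"
    unfolding tau_num_def vol0 by (simp add: tang)
  then show "tau t y p = ?D' * (z t p \<bullet> \<nu> p) - real CARD('n) * (\<Sum>r\<le>CARD('n). \<sigma> r p * t ^ r) * (y p \<bullet> \<nu> p)"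
    unfolding tau_chart(1)[OF c C1y] D_def[symmetric] using V(1) by (simp add: field_simps)
qed

end

section \<open>The Minkowski formula\<close>

text \<open>Lagrange interpolation at the nodes 0, ..., \<open>n\<close> recovers the coefficients
  linearly from the values; the weights \<open>a\<close>, coefficients of the Lagrange basis
  polynomials \<open>l\<close>, do not depend on the polynomial.\<close>

lemma poly_coeffs_from_values:
  "\<exists>a :: nat \<Rightarrow> nat \<Rightarrow> real. \<forall>c. \<forall>r\<le>n. c r = (\<Sum>s\<le>n. a r s * (\<Sum>j\<le>n. c j * real s ^ j))"
proof -
  define l where "l s = (\<Prod>i\<in>{..n} - {s}. smult (inverse (real s - real i)) [:- real i, 1:])" for s
  have deg_l: "degree (l s) \<le> n" if "s \<le> n" for s
  proof -
    have "degree (l s) \<le> (\<Sum>i\<in>{..n} - {s}. degree (smult (inverse (real s - real i)) [:- real i, 1:]))"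
      unfolding l_def by (rule degree_prod_sum_le[unfolded o_def]) simp
    also have "\<dots> \<le> (\<Sum>i\<in>{..n} - {s}. 1)" by (rule sum_mono) (simp add: degree_pCons_le order_trans[OF degree_smult_le])
    also have "\<dots> \<le> n" using that by simp
    finally show ?thesis .
  qed
  have poly_l: "poly (l s) (real t) = of_bool (s = t)" if "s \<le> n" "t \<le> n" for s t
  proof (cases "s = t")
    case True
    have "inverse (real s - real i) * (real t - real i) = 1" if "i \<noteq> s" for i using that True by simp
    then have "poly (l s) (real t) = 1"
      unfolding l_def poly_prod by (intro prod.neutral) (simp add: algebra_simps)
    then show ?thesis using True by simp
  next
    case False
    then have "poly (l s) (real t) = 0" unfolding l_def poly_prod using that by (intro prod_zero) (auto intro!: bexI[of _ t])
    then show ?thesis using False by simp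
  qed
  have "c r = (\<Sum>s\<le>n. coeff (l s) r * (\<Sum>j\<le>n. c j * real s ^ j))" if "r \<le> n" for c :: "nat \<Rightarrow> real" and r
  proof -
    define p where "p = (\<Sum>j\<le>n. monom (c j) j)"
    define q where "q = (\<Sum>s\<le>n. smult (poly p (real s)) (l s))"
    have dp: "degree p \<le> n" unfolding p_def by (rule degree_sum_le) (auto intro: order_trans[OF degree_monom_le])
    have dq: "degree q \<le> n" unfolding q_def by (rule degree_sum_le) (auto intro: order_trans[OF degree_smult_le] deg_l)
    have "p = q"
    proof (rule poly_eqI_degree[where A = "real ` {..n}"])
      fix x assume "x \<in> real ` {..n}"
      then obtain t where t: "t \<le> n" "x = real t" by auto
      have "poly q x = (\<Sum>s\<le>n. poly p (real s) * of_bool (s = t))"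
        unfolding q_def poly_sum t(2) by (rule sum.cong) (auto simp: poly_l t)
      also have "\<dots> = poly p x" using t by (simp add: of_bool_def if_distrib sum.delta cong: if_cong)
      finally show "poly p x = poly q x" ..
    next
      have "card (real ` {..n}) = n + 1" by (simp add: card_image)
      then show "card (real ` {..n}) > degree p" "card (real ` {..n}) > degree q" using dp dq by auto
    qed
    have pv: "poly p s = (\<Sum>j\<le>n. c j * s ^ j)" for s by (simp add: p_def poly_sum poly_monom)
    have "c r = coeff p r" using that by (simp add: p_def coeff_sum sum.delta)
    also have "\<dots> = (\<Sum>s\<le>n. poly p (real s) * coeff (l s) r)" unfolding \<open>p = q\<close> unfolding q_def[symmetric]
      by (subst q_def) (simp add: coeff_sum \<open>p = q\<close>)
    finally show ?thesis by (simp add: pv mult.commute)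
  qed
  then show ?thesis by (intro exI[of _ "\<lambda>r s. coeff (l s) r"]) blast
qed

context wedge_hypersurface
begin

text \<open>Continuity is read off from \<open>jac\<close>, without following single eigenvalues:
  the value of \<sigma> is a fixed linear combination of \<open>jac t\<close> at \<open>t\<close> =
  0, ..., \<open>CARD('n)\<close>.\<close>

lemma \<sigma>_continuous:
  assumes c: "c \<in> A" and r: "r \<le> CARD('n)"
  shows "continuous_on (img c) (in_chart c (\<sigma> r))"
proof -
  obtain a :: "nat \<Rightarrow> nat \<Rightarrow> real" where a: "\<And>f r. r \<le> CARD('n) \<Longrightarrow> f r = (\<Sum>s\<le>CARD('n). a r s * (\<Sum>j\<le>CARD('n). f j * real s ^ j))"
    using poly_coeffs_from_values[of "CARD('n)"] by blast
  have "continuous_on (img c) (\<lambda>w. \<Sum>s\<le>CARD('n). a r s * in_chart c (jac (real s)) w)"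
    by (intro continuous_intros tau_continuous(2)[OF c C1y])
  then show ?thesis
  proof (rule continuous_on_eq)
    fix w assume "w \<in> img c"
    then have "par c w \<in> topspace T" using par_img[OF c] chart_sub[OF c] by blast
    then show "(\<Sum>s\<le>CARD('n). a r s * in_chart c (jac (real s)) w) = in_chart c (\<sigma> r) w"
      using a[OF r, of "\<lambda>j. \<sigma> j (par c w)"] by (simp add: in_chart_def tau_jac_polynomial(1))
  qed
qed

section \<open>Vanishing of the flux on the boundary\<close>

lemma card_K: "card K = 2"
  using mfd by (simp add: corner_manifold_def)

text \<open>At a point where only the coordinate \<open>j0\<close> vanishes, every other coordinate
  direction stays in the same wall, along which \<open>z t\<close> remains orthogonal to
  \<open>m\<close>. The place \<open>j0\<close> is the one that holds \<open>y p\<close>, so all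
  rows are orthogonal to \<open>m\<close>.\<close>

lemma flux_regular:
  assumes c: "c \<in> A" and p: "p \<in> fst c" and j0: "j0 \<in> K" "snd c p $ j0 = 0" "\<And>l. l \<in> K \<Longrightarrow> l \<noteq> j0 \<Longrightarrow> snd c p $ l \<noteq> 0"
    and strat: "x ` stratum A K 1 \<subseteq> wedge_face m m' \<union> wedge_face m' m"
    and bd: "\<And>p. p \<in> boundary_part A K x m m' \<Longrightarrow> \<nu>F p \<bullet> m = k \<bullet> m"
    and face: "x p \<in> wedge_face m m'" and m: "m \<noteq> 0"
  shows "vol e (z t p) ((\<lambda>i. chart_diff c (z t) p (axis i 1))(j0 := y p)) = 0"
proof -
  have str: "q \<in> stratum A K 1" if "q \<in> fst c" "snd c q $ j0 = 0" "\<And>l. l \<in> K \<Longrightarrow> l \<noteq> j0 \<Longrightarrow> snd c q $ l \<noteq> 0" for q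
  proof -
    have "{l \<in> K. snd c q $ l = 0} = {j0}" using that j0(1) by blast
    then show ?thesis unfolding stratum_def using c that(1) by force
  qed
  have zy: "z t q \<bullet> m = 0 \<and> y q \<bullet> m = 0" if "q \<in> stratum A K 1" "x q \<in> wedge_face m m'" for q
  proof -
    have "q \<in> boundary_part A K x m m'"
      unfolding boundary_part_def using that closure_subset by blast
    then have "y q \<bullet> m = 0" using bd by (simp add: y_def inner_diff_left)
    moreover have "x q \<bullet> m = 0" using that(2) by (simp add: wedge_face_def)
    ultimately show ?thesis by (simp add: z_def inner_add_left)
  qed
  have p0: "z t p \<bullet> m = 0" "y p \<bullet> m = 0" using zy[OF str face] p j0 by auto
  have tang: "chart_diff c (z t) p (axis i 1) \<bullet> m = 0" if i: "i \<noteq> j0" for i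
  proof -
    let ?v = "axis i 1 :: real^'n"
    \<comment> \<open>Negativity of the product with \<open>m'\<close> is an open condition. It
      prevents boundary points in \<open>W\<close> from having changed to the other wall, where this
      product is zero.\<close>
    have "continuous_on (img c) (\<lambda>w. in_chart c x w \<bullet> m')"
      by (intro continuous_intros C1_map_continuous[OF C1x c])
    then have "openin (top_of_set (img c)) (img c \<inter> (\<lambda>w. in_chart c x w \<bullet> m') -` {..<0})"
      by (rule continuous_openin_preimage_gen) simp
    then obtain W where W: "open W" "img c \<inter> (\<lambda>w. in_chart c x w \<bullet> m') -` {..<0} = img c \<inter> W"
      by (auto simp: openin_open)
    have pim: "snd c p \<in> img c" using p by auto
    have "in_chart c x (snd c p) \<bullet> m' < 0" using face p by (simp add: in_chart_apply[OF c] wedge_face_def)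
    then have "snd c p \<in> W" using W(2) pim by auto
    obtain \<epsilon> where \<epsilon>: "0 < \<epsilon>" "\<And>s. 0 \<le> s \<Longrightarrow> s \<le> \<epsilon> \<Longrightarrow> snd c p + s *\<^sub>R ?v \<in> img c \<and> snd c p + s *\<^sub>R ?v \<in> W"
      by (rule corner_ray[OF c pim _ W(1) \<open>snd c p \<in> W\<close>, of ?v]) (simp_all add: axis_def)
    have zero: "in_chart c (z t) (snd c p + s *\<^sub>R ?v) \<bullet> m = 0" if s: "s \<in> {0..\<epsilon>}" for s
    proof -
      let ?w = "snd c p + s *\<^sub>R ?v"
      have w: "?w \<in> img c" "?w \<in> W" using \<epsilon>(2) s by auto
      note q = par_img[OF c w(1)]
      have neg: "x (par c ?w) \<bullet> m' < 0" using W(2) w by (auto simp: in_chart_def)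
      have pK: "snd c p \<in> corner K" using chart_img_open[OF c] openin_subset pim by fastforce
      have "par c ?w \<in> stratum A K 1"
      proof (rule str)
        show "snd c (par c ?w) $ j0 = 0" using q j0(2) i by (simp add: axis_def)
        show "snd c (par c ?w) $ l \<noteq> 0" if "l \<in> K" "l \<noteq> j0" for l
        proof -
          have "0 < snd c p $ l" using pK j0(3)[OF that] that(1) by (auto simp: corner_def less_le)
          moreover have "0 \<le> s * ?v $ l" using s by (simp add: axis_def)
          ultimately have "snd c p $ l + s * ?v $ l \<noteq> 0" by linarith
          then show ?thesis using q by simp
        qed
      qed (use q in simp)
      moreover from this have "x (par c ?w) \<in> wedge_face m m' \<union> wedge_face m' m" using strat by blast
      then have "x (par c ?w) \<in> wedge_face m m'" using neg by (auto simp: wedge_face_def)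
      ultimately show ?thesis using zy by (simp add: in_chart_def)
    qed
    let ?f = "\<lambda>s. in_chart c (z t) (snd c p + s *\<^sub>R ?v) \<bullet> m"
    have dz: "(in_chart c (z t) has_derivative chart_diff c (z t) p) (at (snd c p) within img c)"
      by (rule C1_map_derivative[OF C1z c p])
    \<comment> \<open>The segment is known to stay in the chart for \<open>s \<ge> 0\<close> only,
      so a one-sided derivative is taken; on a nondegenerate interval it is still unique.\<close>
    have "(in_chart c (z t) \<circ> (\<lambda>s. snd c p + s *\<^sub>R ?v) has_derivative chart_diff c (z t) p \<circ> (\<lambda>h. h *\<^sub>R ?v)) (at 0 within {0..\<epsilon>})"
    proof (rule diff_chain_within)
      show "((\<lambda>s. snd c p + s *\<^sub>R ?v) has_derivative (\<lambda>h. h *\<^sub>R ?v)) (at 0 within {0..\<epsilon>})"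
        by (auto intro!: derivative_eq_intros)
      have "(\<lambda>s. snd c p + s *\<^sub>R ?v) ` {0..\<epsilon>} \<subseteq> img c" using \<epsilon>(2) by auto
      then show "(in_chart c (z t) has_derivative chart_diff c (z t) p) (at (snd c p + 0 *\<^sub>R ?v) within (\<lambda>s. snd c p + s *\<^sub>R ?v) ` {0..\<epsilon>})"
        using has_derivative_subset[OF dz] by simp
    qed
    then have "((\<lambda>s. in_chart c (z t) (snd c p + s *\<^sub>R ?v) \<bullet> m) has_derivative (\<lambda>h. chart_diff c (z t) p (h *\<^sub>R ?v) \<bullet> m)) (at 0 within {0..\<epsilon>})"
      unfolding o_def by (rule has_derivative_inner_left)
    then have d1: "(?f has_vector_derivative chart_diff c (z t) p ?v \<bullet> m) (at 0 within {0..\<epsilon>})"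
      by (simp add: has_vector_derivative_def linear_scale[OF C1_map_linear[OF C1z c p]])
    have d2: "(?f has_vector_derivative 0) (at 0 within {0..\<epsilon>})"
      by (rule has_vector_derivative_transform[of _ _ _ "\<lambda>_. 0"]) (use zero \<epsilon>(1) in auto)
    show ?thesis
      by (rule vector_derivative_unique_within_closed_interval[of 0 \<epsilon> 0 ?f, unfolded cbox_interval, OF \<epsilon>(1) _ d1 d2])
         (use \<epsilon>(1) in simp)
  qed
  show ?thesis
    by (rule vol_rows_normal[OF m p0(1)]) (use tang p0(2) in simp)
qed

text \<open>Points where both restricted coordinates vanish are limits of regular ones: increasing
  \<open>l0\<close> leaves the other face and keeps \<open>j0\<close> at zero, and the flux is
  continuous.\<close>

lemma flux:
  assumes c: "c \<in> A" and p: "p \<in> fst c" and j0: "j0 \<in> K" "snd c p $ j0 = 0"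
  shows "vol e (z t p) ((\<lambda>i. chart_diff c (z t) p (axis i 1))(j0 := y p)) = 0"
proof -
  obtain l0 where l0: "K = {j0, l0}" "l0 \<noteq> j0"
  proof -
    obtain a b where "K = {a, b}" "a \<noteq> b" using card_K by (auto simp: card_2_iff)
    then show ?thesis using that[of "if j0 = a then b else a"] j0(1) by (cases "j0 = a") auto
  qed
  have strat: "x ` stratum A K 1 \<subseteq> wedge_face n1 n2 \<union> wedge_face n2 n1"
    using hyp unfolding immersed_hypersurface_in_wedge_def by (elim conjE)
  have regular: "vol e (z t q) ((\<lambda>i. chart_diff c (z t) q (axis i 1))(j0 := y q)) = 0"
    if q: "q \<in> fst c" "snd c q $ j0 = 0" "snd c q $ l0 \<noteq> 0" for q
  proof -
    have ne: "snd c q $ l \<noteq> 0" if "l \<in> K" "l \<noteq> j0" for l using that l0 q by auto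
    have "{l \<in> K. snd c q $ l = 0} = {j0}" using ne q j0(1) by blast
    then have "q \<in> stratum A K 1" unfolding stratum_def using c q(1) by force
    then consider "x q \<in> wedge_face n1 n2" | "x q \<in> wedge_face n2 n1" using strat by blast
    then show ?thesis
    proof cases
      case 1
      show ?thesis
        by (rule flux_regular[OF c q(1) j0(1) q(2) ne strat _ 1 nonzero(1)]) (auto simp: bd1 k1)
    next
      case 2
      have strat': "x ` stratum A K 1 \<subseteq> wedge_face n2 n1 \<union> wedge_face n1 n2" using strat by blast
      show ?thesis
        by (rule flux_regular[OF c q(1) j0(1) q(2) ne strat' _ 2 nonzero(2)]) (auto simp: bd2 k2)
    qed
  qed
  define h where "h w = vol e (z t (par c w)) ((\<lambda>i. chart_diff c (z t) (par c w) (axis i 1))(j0 := y (par c w)))" for w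
  have ch: "continuous_on (img c) h"
    unfolding h_def
  proof (rule continuous_on_vol[OF e])
    show "continuous_on (img c) (\<lambda>w. z t (par c w))" using C1_map_continuous[OF C1z c] by (simp add: in_chart_def[abs_def])
    show "continuous_on (img c) (\<lambda>w. ((\<lambda>i. chart_diff c (z t) (par c w) (axis i 1))(j0 := y (par c w))) i)" for i
      using C1_map_continuous[OF C1y c] chart_diff_continuous[OF C1z c] by (cases "i = j0") (auto simp: in_chart_def[abs_def])
  qed
  have pim: "snd c p \<in> img c" using p by auto
  have pK: "snd c p \<in> corner K" using chart_img_open[OF c] openin_subset pim by fastforce
  let ?v = "axis l0 1 :: real^'n"
  obtain \<epsilon> where \<epsilon>: "0 < \<epsilon>" "\<And>s. 0 \<le> s \<Longrightarrow> s \<le> \<epsilon> \<Longrightarrow> snd c p + s *\<^sub>R ?v \<in> img c \<and> snd c p + s *\<^sub>R ?v \<in> UNIV"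
    by (rule corner_ray[OF c pim _ open_UNIV UNIV_I, of ?v]) (simp_all add: axis_def)
  have "h (snd c p + 0 *\<^sub>R ?v) = 0"
  proof (rule continuous_constant_on_closure[of "{0<..\<epsilon>}" "\<lambda>s. h (snd c p + s *\<^sub>R ?v)"])
    show "continuous_on (closure {0<..\<epsilon>}) (\<lambda>s. h (snd c p + s *\<^sub>R ?v))"
      using \<epsilon> by (auto intro!: continuous_on_compose2[OF ch] continuous_intros)
    show "(0::real) \<in> closure {0<..\<epsilon>}" using \<epsilon> by simp
    fix s assume s: "s \<in> {0<..\<epsilon>}"
    then have w: "snd c p + s *\<^sub>R ?v \<in> img c" using \<epsilon> by auto
    note q = par_img[OF c w]
    have "0 \<le> snd c p $ l0" using pK l0 by (auto simp: corner_def)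
    then have "(snd c p + s *\<^sub>R ?v) $ l0 \<noteq> 0" using s by (simp add: axis_def)
    moreover have "(snd c p + s *\<^sub>R ?v) $ j0 = 0" using j0(2) l0(2) by (simp add: axis_def)
    ultimately show "h (snd c p + s *\<^sub>R ?v) = 0"
      unfolding h_def using q by (intro regular) auto
  qed
  then show ?thesis by (simp add: h_def chart_inv[OF c p])
qed

section \<open>Localisation by a partition of unity\<close>

lemma tau_off_support:
  assumes "openin T W" "p \<in> W" "\<And>q. q \<in> W \<Longrightarrow> Y q = 0" "c \<in> A" "p \<in> fst c"
  shows "tau_num t Y c p = 0"
proof -
  have v0: "vol e v (w(i := 0)) = 0" for v w i using linear_0[OF linear_vol_right[OF e]] .
  have v0': "vol e 0 w = 0" for w using linear_0[OF linear_vol_left[OF e]] .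
  have "chart_diff c Y p = (\<lambda>_. 0)" by (rule chart_diff_local_zero[OF assms(4,5,1,2,3)])
  then show ?thesis using assms(2,3) by (simp add: tau_num_def dvol_def v0 v0')
qed

text \<open>The scalar factor in \<open>Y\<close> multiplies the flux, which stays zero, so the
  divergence identity on a corner applies in the chart. The bump has half the radius, which keeps
  its support compact inside the ball.\<close>

lemma integral_tau_local:
  assumes c: "c \<in> A" and r: "0 < r" and ball: "cball a r \<inter> corner K \<subseteq> img c" and w: "C1_map A w"
  defines "Y \<equiv> \<lambda>q. (if q \<in> fst c then bump a (r / 2) (snd c q) else 0) *\<^sub>R (w q *\<^sub>R y q)"
  shows "integral\<^sup>L dA (tau t Y) = 0" "C1_map A Y"
proof -
  have r2: "0 < r / 2" using r by simp
  have "C1_map A (\<lambda>q. if q \<in> fst c then bump a (r / 2) (snd c q) else 0)"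
  proof (rule C1_map_bump[OF c, where D = "cball a (r / 2)"])
    show "C1_on UNIV (bump a (r / 2))"
      by (rule C1_onI[OF open_UNIV bump_deriv]) (auto intro!: continuous_intros)
    show "cball a (r / 2) \<inter> corner K \<subseteq> img c" using ball r by auto
    show "bump a (r / 2) y = 0" if "y \<notin> cball a (r / 2)" for y
      using that by (intro bump_zero[OF r2]) auto
  qed simp
  then show Y: "C1_map A Y" unfolding Y_def by (intro C1_map_scaleR w C1y)
  let ?Z = "{q \<in> fst c. snd c q \<in> cball a (r / 2) \<inter> corner K}"
  have "compactin T ?Z"
    by (rule chart_compact_preimage[OF c compact_Int_closed[OF compact_cball corner_closed]]) (use ball r in auto)
  then have Z: "openin T (topspace T - ?Z)"
    using M compactin_imp_closedin by (auto simp: corner_manifold_def closedin_def)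
  have imgK: "img c \<subseteq> corner K" using chart_img_open[OF c] openin_subset by fastforce
  have Y0: "Y q = 0" if "q \<in> topspace T - ?Z" for q
    using that bump_zero[OF r2, of "snd c q" a] imgK by (auto simp: Y_def)
  have off: "tau_num t Y d q = 0" if "d \<in> A" "q \<in> fst d" "q \<notin> ?Z" for d q
    by (rule tau_off_support[OF Z _ Y0]) (use that chart_sub[OF that(1)] in blast)+
  define S where "S = ball a r \<inter> corner K"
  have S: "S \<subseteq> img c" using ball by (auto simp: S_def)
  have convS: "convex S"
  proof -
    have "corner K = (\<Inter>k\<in>K. {y. 0 \<le> y $ k})" by (auto simp: corner_def)
    moreover have "convex {y :: real^'n. 0 \<le> y $ k}" for k
      by (auto simp: convex_def intro!: add_nonneg_nonneg mult_nonneg_nonneg)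
    ultimately have "convex (corner K)" by (simp add: convex_INT)
    then show ?thesis unfolding S_def by (intro convex_Int) auto
  qed
  define N where "N w = tau_num t Y c (par c w)" for w
  define V where "V w = vx c (par c w)" for w
  have V0: "V w \<noteq> 0" if "w \<in> S" for w
    unfolding V_def by (rule vx_nonzero[OF c]) (use par_img[OF c] S that in blast)
  have cV: "continuous_on S V"
    unfolding V_def by (rule continuous_on_subset[OF chart_continuities(2)[OF c C1y] S])
  \<comment> \<open>The area density is the absolute value of \<open>V\<close>, while the divergence
    identity has none. On the convex, hence connected, set \<open>S\<close> the nonvanishing
    \<open>V\<close> has one sign \<open>\<sigma>'\<close>, which comes out of the integral.\<close>
  obtain \<sigma>' where \<sigma>': "\<And>w. w \<in> S \<Longrightarrow> \<bar>V w\<bar> = \<sigma>' * V w"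
  proof -
    have "connected (V ` S)" by (rule connected_continuous_image[OF cV convex_connected[OF convS]])
    then have int: "\<And>a b c. a \<in> V ` S \<Longrightarrow> b \<in> V ` S \<Longrightarrow> a \<le> c \<Longrightarrow> c \<le> b \<Longrightarrow> c \<in> V ` S"
      unfolding connected_iff_interval by blast
    have "(\<forall>w\<in>S. 0 < V w) \<or> (\<forall>w\<in>S. V w < 0)"
    proof (rule ccontr)
      assume "\<not> ?thesis"
      then obtain w1 w2 where "w1 \<in> S" "w2 \<in> S" "V w1 \<le> 0" "0 \<le> V w2" by (auto simp: not_less)
      then have "0 \<in> V ` S" using int[of "V w1" "V w2" 0] by blast
      then show False using V0 by auto
    qed
    then show ?thesis
    proof
      assume "\<forall>w\<in>S. 0 < V w" then show ?thesis by (intro that[of 1]) auto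
    next
      assume "\<forall>w\<in>S. V w < 0" then show ?thesis by (intro that[of "- 1"]) auto
    qed
  qed
  have T_eq: "N w = dvol e (in_chart c (z t) w) (\<lambda>i. chart_diff c (z t) (par c w) (axis i 1)) (\<lambda>i. chart_diff c Y (par c w) (axis i 1))
     - real CARD('n) * vol e (in_chart c Y w) (\<lambda>i. chart_diff c (z t) (par c w) (axis i 1))" for w
    by (simp add: N_def tau_num_def in_chart_def)
  have der: "(in_chart c f has_derivative chart_diff c f (par c w)) (at w within S)"
    if "C1_map A f" "w \<in> S" for f :: "'p \<Rightarrow> real^'m" and w
  proof -
    have p: "par c w \<in> fst c" "snd c (par c w) = w" using par_img[OF c, of w] S that(2) by auto
    have "(in_chart c f has_derivative chart_diff c f (par c w)) (at w within img c)"
      using C1_map_derivative[OF that(1) c p(1)] p(2) by simp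
    then show ?thesis using S by (rule has_derivative_subset)
  qed
  have cder: "continuous_on S (\<lambda>w. chart_diff c f (par c w) v)" if "C1_map A f" for f :: "'p \<Rightarrow> real^'m" and v
    using continuous_on_subset[OF chart_diff_continuous[OF that c] S] by (simp add: in_chart_def[abs_def])
  have "(\<integral>w. indicator S w *\<^sub>R N w \<partial>lborel) = 0"
    unfolding T_eq
  proof (rule volume_variation_corner[OF e S_def der[OF C1z] cder[OF C1z] der[OF Y] cder[OF Y], where C = "cball a (r / 2)"])
    show "cball a (r / 2) \<subseteq> ball a r" using r by auto
    have out: "par c w \<in> topspace T - ?Z \<and> par c w \<in> fst c" if "w \<in> S" "w \<notin> cball a (r / 2)" for w
      using par_img[OF c, of w] S that chart_sub[OF c] by auto
    show "in_chart c Y w = 0" if "w \<in> S" "w \<notin> cball a (r / 2)" for w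
      using Y0 out[OF that] by (simp add: in_chart_def)
    show "chart_diff c Y (par c w) v = 0" if "w \<in> S" "w \<notin> cball a (r / 2)" for w v
      using chart_diff_local_zero[OF c _ Z _ Y0, of "par c w"] out[OF that] by simp
    show "vol e (in_chart c (z t) w') ((\<lambda>i. chart_diff c (z t) (par c w') (axis i 1))(j := in_chart c Y w')) = 0"
      if "j \<in> K" "w' \<in> S" "w' $ j = 0" for j w'
    proof -
      have p: "par c w' \<in> fst c" "snd c (par c w') = w'" using par_img[OF c, of w'] S that(2) by auto
      define s where "s = bump a (r / 2) w' * w (par c w')"
      have "in_chart c Y w' = s *\<^sub>R y (par c w')" using p by (simp add: in_chart_def Y_def s_def)
      then show ?thesis
        using flux[OF c p(1) that(1), of t] p(2) that(3)
        by (simp add: in_chart_def linear_scale[OF linear_vol_right[OF e]])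
    qed
  qed (assumption | rule compact_cball)+
  moreover have "integral\<^sup>L dA (tau t Y) = (\<integral>w. indicator (img c) w *\<^sub>R (dens c w * in_chart c (tau t Y) w) \<partial>lborel)"
  proof (rule integral_dA_chart[OF c])
    show "tau t Y \<in> borel_measurable (borel_of_top T)"
      by (rule continuous_integrable(2)[OF tau_continuous(1)[OF _ Y]])
    show "tau t Y p = 0" if "p \<in> topspace T" "p \<notin> fst c" for p
      unfolding tau_def using off[of "chart_at A p" p] chart_at[OF that(1)] that by simp
  qed
  moreover have "indicator (img c) w *\<^sub>R (dens c w * in_chart c (tau t Y) w) = \<sigma>' * (indicator S w *\<^sub>R N w)" for w
  proof (cases "w \<in> img c")
    case True
    note p = par_img[OF c True]
    have tauN: "in_chart c (tau t Y) w = N w / V w"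
      using tau_chart(1)[OF c _ Y] p by (simp add: in_chart_def N_def V_def)
    show ?thesis
    proof (cases "w \<in> S")
      case inS: True
      have "dens c w = \<bar>V w\<bar>" using area_density_vol[OF c] p by (simp add: in_chart_def V_def)
      then show ?thesis using True inS V0[OF inS] \<sigma>'[OF inS] tauN by simp
    next
      case False
      then have "w \<notin> ball a r" using True imgK by (auto simp: S_def)
      then have "par c w \<notin> ?Z" using p r by auto
      then have "N w = 0" unfolding N_def using off[OF c] p by blast
      then show ?thesis using False tauN by simp
    qed
  next
    case False
    then have "w \<notin> S" using S by blast
    then show ?thesis using False by simp
  qed
  ultimately show "integral\<^sup>L dA (tau t Y) = 0" by simp
qed

text \<open>\<open>tau t Y\<close> is linear in \<open>Y\<close>, and \<open>y\<close> is a finite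
  sum of pieces \<open>Y p\<close>, each supported in a chart ball and each with integral
  zero.\<close>

lemma integral_tau: "integral\<^sup>L dA (tau t y) = 0"
proof -
  have "\<forall>p\<in>topspace T. \<exists>cr. fst cr \<in> A \<and> p \<in> fst (fst cr) \<and> 0 < snd cr \<and> cball (snd (fst cr) p) (snd cr) \<inter> corner K \<subseteq> img (fst cr)"
    using chart_ball by (metis fst_conv snd_conv)
  then obtain cr where cr: "\<And>p. p \<in> topspace T \<Longrightarrow> fst (cr p) \<in> A \<and> p \<in> fst (fst (cr p)) \<and> 0 < snd (cr p) \<and>
      cball (snd (fst (cr p)) p) (snd (cr p)) \<inter> corner K \<subseteq> img (fst (cr p))" by metis
  define c where "c p = fst (cr p)" for p
  define r where "r p = snd (cr p)" for p
  have c: "c p \<in> A" "p \<in> fst (c p)" "0 < r p" "cball (snd (c p) p) (r p) \<inter> corner K \<subseteq> img (c p)" if "p \<in> topspace T" for p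
    using cr[OF that] by (auto simp: c_def r_def)
  define O' where "O' p = {q \<in> fst (c p). snd (c p) q \<in> ball (snd (c p) p) (r p / 2)}" for p
  have O': "openin T (O' p)" "p \<in> O' p" if "p \<in> topspace T" for p
    using chart_open_preimage[OF c(1)[OF that], of "ball (snd (c p) p) (r p / 2)"] c(2,3)[OF that] by (auto simp: O'_def)
  have "compactin T (topspace T)" using comp by (simp add: compact_space_def)
  moreover have "topspace T \<subseteq> \<Union>(O' ` topspace T)" using O'(2) by blast
  moreover have "\<And>U. U \<in> O' ` topspace T \<Longrightarrow> openin T U" using O'(1) by blast
  ultimately obtain \<U> where \<U>: "finite \<U>" "\<U> \<subseteq> O' ` topspace T" "topspace T \<subseteq> \<Union>\<U>"
    unfolding compactin_def by meson
  obtain G where G: "G \<subseteq> topspace T" "finite G" "\<U> = O' ` G" using finite_subset_image[OF \<U>(1,2)] by blast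
  define b where "b p q = (if q \<in> fst (c p) then bump (snd (c p) p) (r p / 2) (snd (c p) q) else 0)" for p q
  have bnn: "0 \<le> b p q" for p q by (simp add: b_def)
  have C1b: "C1_map A (b p)" if "p \<in> topspace T" for p
    unfolding b_def
  proof (rule C1_map_bump[OF c(1)[OF that], where D = "cball (snd (c p) p) (r p / 2)"])
    show "C1_on UNIV (bump (snd (c p) p) (r p / 2))"
      by (rule C1_onI[OF open_UNIV bump_deriv]) (auto intro!: continuous_intros)
    show "cball (snd (c p) p) (r p / 2) \<inter> corner K \<subseteq> img (c p)" using c(3,4)[OF that] by auto
    show "bump (snd (c p) p) (r p / 2) y = 0" if "y \<notin> cball (snd (c p) p) (r p / 2)" for y
      using that c(3)[OF \<open>p \<in> topspace T\<close>] by (intro bump_zero) auto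
  qed simp
  define B where "B q = (\<Sum>p\<in>G. b p q)" for q
  have Bpos: "0 < B q" if q: "q \<in> topspace T" for q
  proof -
    obtain p where p: "p \<in> G" "q \<in> O' p" using \<U>(3) G(3) q by blast
    then have "0 < b p q" using bump_pos[of "r p / 2" "snd (c p) p"] c(3)[of p] G(1) by (auto simp: b_def O'_def)
    then show ?thesis unfolding B_def using G(2) p bnn by (intro sum_pos2[of _ p]) auto
  qed
  \<comment> \<open>\<open>B\<close> is positive on the whole space, so division by it normalises
    the bumps to a partition of unity.\<close>
  define w where "w q = inverse (B q)" for q
  have C1w: "C1_map A w"
    unfolding w_def
  proof (rule C1_map_inverse)
    show "C1_map A B" unfolding B_def using G C1b by (intro C1_map_sum) auto
    show "B p \<noteq> 0" if "p \<in> topspace T" for p using Bpos[OF that] by simp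
  qed
  define Y where "Y p q = b p q *\<^sub>R (w q *\<^sub>R y q)" for p q
  have loc: "integral\<^sup>L dA (tau t (Y p)) = 0" "C1_map A (Y p)" if "p \<in> G" for p
  proof -
    have p: "p \<in> topspace T" using that G(1) by blast
    show "integral\<^sup>L dA (tau t (Y p)) = 0" "C1_map A (Y p)"
      using integral_tau_local(1)[OF c(1)[OF p] c(3)[OF p] c(4)[OF p] C1w, of t]
        integral_tau_local(2)[OF c(1)[OF p] c(3)[OF p] c(4)[OF p] C1w] by (simp_all only: Y_def[abs_def] b_def)
  qed
  have Ysum: "(\<Sum>p\<in>G. Y p q) = y q" if "q \<in> topspace T" for q
    using Bpos[OF that] by (simp add: Y_def w_def B_def scaleR_sum_left[symmetric] scaleR_scaleR[symmetric] del: scaleR_scaleR)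
       (simp add: B_def[symmetric])
  have "tau t y q = (\<Sum>p\<in>G. tau t (Y p) q)" if q: "q \<in> topspace T" for q
  proof -
    define d where "d = chart_at A q"
    have d: "d \<in> A" "q \<in> fst d" using chart_at[OF q] by (auto simp: d_def)
    have "((\<lambda>v. \<Sum>p\<in>G. in_chart d (Y p) v) has_derivative (\<lambda>v. \<Sum>p\<in>G. chart_diff d (Y p) q v)) (at (snd d q) within img d)"
      by (intro has_derivative_sum C1_map_derivative[OF loc(2) d])
    then have "(in_chart d y has_derivative (\<lambda>v. \<Sum>p\<in>G. chart_diff d (Y p) q v)) (at (snd d q) within img d)"
      by (rule has_derivative_transform[rotated 2]) (use d Ysum[OF subsetD[OF chart_sub[OF d(1)]]] in \<open>auto simp: in_chart_apply[OF d(1)]\<close>)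
    then have dy: "chart_diff d y q = (\<lambda>v. \<Sum>p\<in>G. chart_diff d (Y p) q v)" by (rule chart_diff_eqI[OF d])
    have "tau_num t y d q = (\<Sum>p\<in>G. tau_num t (Y p) d q)"
      unfolding tau_num_def dy Ysum[OF q, symmetric]
      by (simp add: dvol_sum[OF e G(2)] linear_sum[OF linear_vol_left[OF e]] sum_subtractf sum_distrib_left)
    then show ?thesis by (simp add: tau_def d_def[symmetric] sum_divide_distrib)
  qed
  then have "integral\<^sup>L dA (tau t y) = integral\<^sup>L dA (\<lambda>q. \<Sum>p\<in>G. tau t (Y p) q)"
    using space_dA by (intro Bochner_Integration.integral_cong) auto
  also have "\<dots> = (\<Sum>p\<in>G. integral\<^sup>L dA (tau t (Y p)))"
    by (rule Bochner_Integration.integral_sum) (rule continuous_integrable(1)[OF tau_continuous(1)[OF _ loc(2)]])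
  also have "\<dots> = 0" using loc by simp
  finally show ?thesis .
qed

section \<open>Comparison of coefficients\<close>

lemma minkowski:
  assumes r: "r \<in> {1..CARD('n)}"
  defines "H \<equiv> anisotropic_mean_curvature A F x \<nu>"
  shows "(\<integral>p. H (r - 1) p * (F (\<nu> p) - k \<bullet> \<nu> p) \<partial>dA) = (\<integral>p. H r p * (x p \<bullet> \<nu> p) \<partial>dA)"
proof -
  let ?n = "CARD('n)"
  have cy: "continuous_on (img c) (in_chart c (\<lambda>p. y p \<bullet> \<nu> p))" and cx: "continuous_on (img c) (in_chart c (\<lambda>p. x p \<bullet> \<nu> p))" if "c \<in> A" for c
    using C1_map_continuous[OF C1y that] C1_map_continuous[OF C1x that] C1_map_continuous[OF C1\<nu> that]
    by (auto simp: in_chart_def[abs_def] intro!: continuous_intros)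
  have iy: "integrable dA (\<lambda>p. \<sigma> r p * (y p \<bullet> \<nu> p))" and ix: "integrable dA (\<lambda>p. \<sigma> r p * (x p \<bullet> \<nu> p))" if "r \<le> ?n" for r
    using continuous_on_mult[OF \<sigma>_continuous[OF _ that] cy] continuous_on_mult[OF \<sigma>_continuous[OF _ that] cx]
    by (auto simp: in_chart_def[abs_def] intro!: continuous_integrable(1))
  define a where "a r = (\<integral>p. \<sigma> r p * (y p \<bullet> \<nu> p) \<partial>dA)" for r
  define b where "b r = (\<integral>p. \<sigma> r p * (x p \<bullet> \<nu> p) \<partial>dA)" for r
  \<comment> \<open>Since z \<bullet> \<nu> = x \<bullet> \<nu> + t (y \<bullet> \<nu>), the
    integral of \<open>tau t y\<close> is a polynomial in \<open>t\<close> with coefficients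
    combined from \<open>a\<close> and \<open>b\<close>, and it vanishes for all
    \<open>t\<close>.\<close>
  have poly0: "(\<Sum>r\<le>?n. real r * t ^ (r - 1) * b r + (real r - real ?n) * t ^ r * a r) = 0" for t
  proof -
    have tp: "tau t y p = (\<Sum>r\<le>?n. real r * t ^ (r - 1) * (\<sigma> r p * (x p \<bullet> \<nu> p)) + (real r - real ?n) * t ^ r * (\<sigma> r p * (y p \<bullet> \<nu> p)))"
      if p: "p \<in> topspace T" for p
    proof -
      have pow: "real r * t ^ r = real r * t ^ (r - 1) * t" for r by (cases r) auto
      have *: "(\<Sum>r\<le>?n. real r * t ^ r * (\<sigma> r p * Q)) = (\<Sum>r\<le>?n. real r * t ^ (r - 1) * \<sigma> r p) * (t * Q)" for Q
        unfolding sum_distrib_right by (intro sum.cong refl, unfold pow) (simp only: mult_ac)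
      show ?thesis
        unfolding tau_jac_polynomial(2)[OF p] z_def inner_add_left inner_scaleR_left left_diff_distrib sum.distrib sum_subtractf *
        by (simp add: sum_distrib_left sum_distrib_right sum.distrib distrib_left mult_ac)
    qed
    have "0 = integral\<^sup>L dA (tau t y)" by (simp add: integral_tau)
    also have "\<dots> = (\<integral>p. (\<Sum>r\<le>?n. real r * t ^ (r - 1) * (\<sigma> r p * (x p \<bullet> \<nu> p)) + (real r - real ?n) * t ^ r * (\<sigma> r p * (y p \<bullet> \<nu> p))) \<partial>dA)"
      using tp space_dA by (intro Bochner_Integration.integral_cong) auto
    also have "\<dots> = (\<Sum>r\<le>?n. \<integral>p. real r * t ^ (r - 1) * (\<sigma> r p * (x p \<bullet> \<nu> p)) + (real r - real ?n) * t ^ r * (\<sigma> r p * (y p \<bullet> \<nu> p)) \<partial>dA)"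
      by (rule Bochner_Integration.integral_sum) (use ix iy in auto)
    also have "\<dots> = (\<Sum>r\<le>?n. real r * t ^ (r - 1) * b r + (real r - real ?n) * t ^ r * a r)"
      by (rule sum.cong) (use ix iy in \<open>auto simp: a_def b_def\<close>)
    finally show ?thesis ..
  qed
  \<comment> \<open>The coefficient of \<open>t ^ j\<close> after the terms with \<open>b\<close>
    are shifted by one. The top coefficient has no such term, as they stop at \<open>b ?n\<close>;
    the term with \<open>b 0\<close> has the factor zero.\<close>
  define C where "C j = (if j < ?n then real (Suc j) * b (Suc j) else 0) + (real j - real ?n) * a j" for j
  have CC: "C j * t ^ j = (if j < ?n then real (Suc j) * b (Suc j) else 0) * t ^ j + (real j - real ?n) * t ^ j * a j" for j t
    by (simp add: C_def distrib_right)
  have "(\<Sum>j\<le>?n. C j * t ^ j) = 0" for t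
  proof -
    have "(\<Sum>r\<le>?n. real r * t ^ (r - 1) * b r) = (\<Sum>j<?n. real (Suc j) * t ^ j * b (Suc j))"
      by (simp add: sum.atMost_shift)
    also have "\<dots> = (\<Sum>j\<le>?n. (if j < ?n then real (Suc j) * b (Suc j) else 0) * t ^ j)"
      by (rule sum.mono_neutral_cong_left) auto
    finally have "(\<Sum>j\<le>?n. C j * t ^ j) = (\<Sum>r\<le>?n. real r * t ^ (r - 1) * b r) + (\<Sum>r\<le>?n. (real r - real ?n) * t ^ r * a r)"
      by (simp only: CC sum.distrib)
    then show ?thesis using poly0[of t] by (simp add: sum.distrib)
  qed
  then have "C (r - 1) = 0" using polyfun_eq_0[of C ?n] r by auto
  moreover have "r - 1 < ?n" "Suc (r - 1) = r" "real (r - 1) = real r - 1" using r by auto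
  ultimately have rel: "real r * b r = (real ?n - real (r - 1)) * a (r - 1)" by (simp add: C_def algebra_simps)
  \<comment> \<open>This relation of neighbouring binomial coefficients absorbs the factors of
    \<open>rel\<close> into the normalisation of the curvatures.\<close>
  have binom: "real r * real (?n choose r) = (real ?n - real (r - 1)) * real (?n choose (r - 1))"
  proof -
    have "Suc (r - 1) * (?n choose Suc (r - 1)) = (?n - (r - 1)) * (?n choose (r - 1))"
      using binomial_absorption[of "r - 1" ?n] binomial_absorb_comp[of ?n "r - 1"] by simp
    then have "r * (?n choose r) = (?n - (r - 1)) * (?n choose (r - 1))"
      using \<open>Suc (r - 1) = r\<close> by (simp only:)
    then have "real (r * (?n choose r)) = real ((?n - (r - 1)) * (?n choose (r - 1)))" by simp
    then show ?thesis using r by (simp add: of_nat_diff)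
  qed
  have pos: "0 < real (?n choose r)" "0 < real (?n choose (r - 1))" "0 < real r" using r by auto
  have "(\<integral>p. H (r - 1) p * (F (\<nu> p) - k \<bullet> \<nu> p) \<partial>dA) = (\<integral>p. \<sigma> (r - 1) p * (y p \<bullet> \<nu> p) / real (?n choose (r - 1)) \<partial>dA)"
    using space_dA by (intro Bochner_Integration.integral_cong) (auto simp: H_def anisotropic_mean_curvature_def \<sigma>_def y_normal)
  also have "\<dots> = a (r - 1) / real (?n choose (r - 1))" by (simp add: a_def)
  also have "\<dots> = b r / real (?n choose r)"
  proof -
    have ne: "real ?n - real (r - 1) \<noteq> 0" using r by auto
    have "(real ?n - real (r - 1)) * (a (r - 1) * real (?n choose r)) = real r * b r * real (?n choose r)" using rel by simp
    also have "\<dots> = (real ?n - real (r - 1)) * (b r * real (?n choose (r - 1)))" using binom by (simp add: mult_ac)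
    finally have "a (r - 1) * real (?n choose r) = b r * real (?n choose (r - 1))" using ne by simp
    then show ?thesis using pos by (simp add: field_simps)
  qed
  also have "\<dots> = (\<integral>p. \<sigma> r p * (x p \<bullet> \<nu> p) / real (?n choose r) \<partial>dA)" by (simp add: b_def)
  also have "\<dots> = (\<integral>p. H r p * (x p \<bullet> \<nu> p) \<partial>dA)"
    by (simp add: H_def anisotropic_mean_curvature_def \<sigma>_def)
  finally show ?thesis .
qed

end

lemma anisotropic_mean_curvature_0: "anisotropic_mean_curvature A F x \<nu> 0 p = 1"
proof -
  have "{I. I \<subseteq> {..<m} \<and> card I = 0} = {{}}" for m :: nat
    by (auto simp: card_eq_0_iff finite_subset)
  then show ?thesis by (simp add: anisotropic_mean_curvature_def elem_sym_def)
qed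

theorem theorem1p1:
  fixes n :: nat
    and F :: "real ^ 'm \<Rightarrow> real"
    and n1 n2 k :: "real ^ 'm"
    and T :: "'p topology" and A :: "('p, 'n::finite) chart set" and K :: "'n set"
    and x \<nu> :: "'p \<Rightarrow> real ^ 'm"
    and \<omega>1 \<omega>2 :: real
  assumes "n \<ge> 2" and "CARD('n) = n" and "CARD('m) = n + 1"
    and "anisotropic_gauge F"
    and "norm n1 = 1" and "norm n2 = 1" and "n1 \<noteq> n2" and "independent {n1, n2}"
    and "immersed_hypersurface_in_wedge T A K x \<nu> n1 n2"
    and "\<forall>p\<in>boundary_part A K x n1 n2. Cahn_Hoffman F (\<nu> p) \<bullet> n1 = \<omega>1"
    and "\<forall>p\<in>boundary_part A K x n2 n1. Cahn_Hoffman F (\<nu> p) \<bullet> n2 = \<omega>2"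
    and "k \<bullet> n1 = \<omega>1" and "k \<bullet> n2 = \<omega>2"
  shows "let H = anisotropic_mean_curvature A F x \<nu>; dA = area_measure T A x in
    (\<forall>r\<in>{1..n}. (\<integral>p. H (r - 1) p * (F (\<nu> p) - k \<bullet> \<nu> p) \<partial>dA) = (\<integral>p. H r p * (x p \<bullet> \<nu> p) \<partial>dA)) \<and>
    (\<integral>p. F (\<nu> p) - k \<bullet> \<nu> p \<partial>dA) = (\<integral>p. H 1 p * (x p \<bullet> \<nu> p) \<partial>dA) \<and>
    (\<omega>1 = 0 \<and> \<omega>2 = 0 \<longrightarrow>
       0 \<bullet> n1 = \<omega>1 \<and> 0 \<bullet> n2 = \<omega>2 \<and>
       (\<forall>r\<in>{1..n}. (\<integral>p. H (r - 1) p * F (\<nu> p) \<partial>dA) = (\<integral>p. H r p * (x p \<bullet> \<nu> p) \<partial>dA)))"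
proof -
  have "card (UNIV :: 'n option set) = card (UNIV :: 'm set)"
    using assms(2,3) by (simp add: card_UNIV_option)
  then obtain e :: "'n option \<Rightarrow> 'm" where e: "bij e"
    using finite_same_card_bij[of "UNIV :: 'n option set" "UNIV :: 'm set"] by auto
  have nz: "n1 \<noteq> 0" "n2 \<noteq> 0" using assms(5,6) by auto
  \<comment> \<open>Stated for an arbitrary vector with the prescribed products, so that the zero
    vector can be inserted in the case of free boundary.\<close>
  have main: "(\<integral>p. anisotropic_mean_curvature A F x \<nu> (r - 1) p * (F (\<nu> p) - k' \<bullet> \<nu> p) \<partial>area_measure T A x)
      = (\<integral>p. anisotropic_mean_curvature A F x \<nu> r p * (x p \<bullet> \<nu> p) \<partial>area_measure T A x)"
    if "k' \<bullet> n1 = \<omega>1" "k' \<bullet> n2 = \<omega>2" "r \<in> {1..n}" for k' r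
  proof -
    interpret wedge_hypersurface T A K x \<nu> F n1 n2 k' \<omega>1 \<omega>2 e
      by unfold_locales (use assms e nz that in auto)
    show ?thesis by (rule minkowski) (use that assms(2) in simp)
  qed
  have "1 \<in> {1..n}" using assms(1) by simp
  from main[OF assms(12,13) this]
  have first: "(\<integral>p. F (\<nu> p) - k \<bullet> \<nu> p \<partial>area_measure T A x)
      = (\<integral>p. anisotropic_mean_curvature A F x \<nu> 1 p * (x p \<bullet> \<nu> p) \<partial>area_measure T A x)"
    by (simp add: anisotropic_mean_curvature_0)
  have free: "(\<integral>p. anisotropic_mean_curvature A F x \<nu> (r - 1) p * F (\<nu> p) \<partial>area_measure T A x)
      = (\<integral>p. anisotropic_mean_curvature A F x \<nu> r p * (x p \<bullet> \<nu> p) \<partial>area_measure T A x)"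
    if "\<omega>1 = 0" "\<omega>2 = 0" "r \<in> {1..n}" for r
    using main[of 0 r] that by simp
  show ?thesis
    unfolding Let_def using main[OF assms(12,13)] first free by simp
qed

end
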